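(* Let $(T,\cdot,e)$ be a monoid and let $M$ be a $T$-graded monad on a locally presentable category $\mathbf{C}$ such that $M$ is accessible, i.e. each functor $M_t$ ($t\in T$) is accessible. Then the category $\mathbf{GCoAlg}(M)$ of graded $M$-coalgebras is complete; in particular it has a terminal object.
   Context: Accessible and locally presentable categories and accessible functors are meant in the standard sense (a functor between accessible categories is accessible if it preserves $\kappa$-directed colimits for some regular cardinal $\kappa$; a category is locally presentable if it is accessible and cocomplete). A monad $M$ graded by a monoid $(T,\cdot,e)$ on $\mathbf{C}$ consists of endofunctors $M_t$ ($t\in T$), natural transformations $\mu^{s,t}\colon M_sM_t\to M_{s\cdot t}$ and $\eta\colon\mathrm{Id}\to M_e$ such that $\mu^{r,s\cdot t}\circ M_r\mu^{s,t}=\mu^{r\cdot s,t}\circ\mu^{r,s}M_t$ and $\mu^{t,e}\circ M_t\eta=\mathrm{id}=\mu^{e,t}\circ\eta M_t$. A graded $M$-coalgebra is an object $X$ with morphisms $\gamma_t\colon X\to M_tX$ ($t\in T$) such that $\gamma_e=\eta_X$ and $\gamma_{s\cdot t}=\mu^{s,t}_X\circ M_s\gamma_t\circ\gamma_s$ for all $s,t\in T$. A homomorphism $h\colon(X,\gamma)\to(Y,\delta)$ is a morphism $h\colon X\to Y$ with $M_th\circ\gamma_t=\delta_t\circ h$ for all $t\in T$. These form the category $\mathbf{GCoAlg}(M)$. *)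

theory Defs
  imports Main "HOL-Library.FuncSet"
begin

unbundle cardinal_syntax

section \<open>Smallness\<close>

text \<open>
  The distinction between sets and classes is rendered by a universe: \<open>U\<close> is an uncountable
  strongly inaccessible cardinal (a cardinal order on a subset of the type \<open>'u\<close>), and a set of
  any type is small if its cardinality is below \<open>U\<close>. Every small set is then in bijection with a
  subset of \<open>'u\<close>, so that up to isomorphism all small categories, small posets and small
  cardinals already occur over \<open>'u\<close>; quantifying over those is quantifying over all of them.
\<close>

definition inaccessible :: "'u rel \<Rightarrow> bool" where
  "inaccessible U \<longleftrightarrow> Card_order U \<and> natLeq <o U \<and> regularCard U \<and>
     (\<forall>A \<subseteq> Field U. |A| <o U \<longrightarrow> |Pow A| <o U)"

definition small :: "'u rel \<Rightarrow> 'x set \<Rightarrow> bool" where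
  "small U A \<longleftrightarrow> |A| <o U"

definition regular_cardinal :: "'u rel \<Rightarrow> 'u rel \<Rightarrow> bool" where
  "regular_cardinal U \<kappa> \<longleftrightarrow> Cinfinite \<kappa> \<and> regularCard \<kappa> \<and> \<kappa> <o U"


section \<open>Categories, functors, natural transformations\<close>

text \<open>The fields are only meaningful on the carriers \<open>Obj\<close> and \<open>Arr\<close> and on composable pairs;
  \<open>g \<cdot> f\<close> is \<open>g\<close> after \<open>f\<close>.\<close>

record ('o, 'a) category =
  Obj :: "'o set"
  Arr :: "'a set"
  Dom :: "'a \<Rightarrow> 'o"
  Cod :: "'a \<Rightarrow> 'o"
  Idt :: "'o \<Rightarrow> 'a"
  Comp :: "'a \<Rightarrow> 'a \<Rightarrow> 'a" (infixr "\<cdot>\<index>" 70)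

definition hom :: "('o, 'a) category \<Rightarrow> 'o \<Rightarrow> 'o \<Rightarrow> 'a set" where
  "hom C X Y = {f \<in> Arr C. Dom C f = X \<and> Cod C f = Y}"

locale category =
  fixes C :: "('o, 'a) category" (structure)
  assumes Dom_in: "f \<in> Arr C \<Longrightarrow> Dom C f \<in> Obj C"
    and Cod_in: "f \<in> Arr C \<Longrightarrow> Cod C f \<in> Obj C"
    and Idt_in: "X \<in> Obj C \<Longrightarrow> Idt C X \<in> hom C X X"
    and Comp_in: "f \<in> hom C X Y \<Longrightarrow> g \<in> hom C Y Z \<Longrightarrow> g \<cdot> f \<in> hom C X Z"
    and Comp_Idt: "f \<in> hom C X Y \<Longrightarrow> f \<cdot> Idt C X = f"
    and Idt_Comp: "f \<in> hom C X Y \<Longrightarrow> Idt C Y \<cdot> f = f"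
    and Comp_assoc: "f \<in> hom C W X \<Longrightarrow> g \<in> hom C X Y \<Longrightarrow> h \<in> hom C Y Z \<Longrightarrow>
      (h \<cdot> g) \<cdot> f = h \<cdot> (g \<cdot> f)"

definition locally_small :: "'u rel \<Rightarrow> ('o, 'a) category \<Rightarrow> bool" where
  "locally_small U C \<longleftrightarrow> (\<forall>X \<in> Obj C. \<forall>Y \<in> Obj C. small U (hom C X Y))"

definition small_category :: "'u rel \<Rightarrow> ('i, 'j) category \<Rightarrow> bool" where
  "small_category U J \<longleftrightarrow> category J \<and> small U (Obj J) \<and> small U (Arr J)"

record ('o, 'a, 'p, 'b) cat_functor =
  Fobj :: "'o \<Rightarrow> 'p"
  Farr :: "'a \<Rightarrow> 'b"

definition is_functor ::
    "('o, 'a) category \<Rightarrow> ('p, 'b) category \<Rightarrow> ('o, 'a, 'p, 'b) cat_functor \<Rightarrow> bool" where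
  "is_functor C D F \<longleftrightarrow> category C \<and> category D \<and>
     (\<forall>X \<in> Obj C. Fobj F X \<in> Obj D) \<and>
     (\<forall>X \<in> Obj C. \<forall>Y \<in> Obj C. \<forall>f \<in> hom C X Y. Farr F f \<in> hom D (Fobj F X) (Fobj F Y)) \<and>
     (\<forall>X \<in> Obj C. Farr F (Idt C X) = Idt D (Fobj F X)) \<and>
     (\<forall>X \<in> Obj C. \<forall>Y \<in> Obj C. \<forall>Z \<in> Obj C. \<forall>f \<in> hom C X Y. \<forall>g \<in> hom C Y Z.
        Farr F (g \<cdot>\<^bsub>C\<^esub> f) = Farr F g \<cdot>\<^bsub>D\<^esub> Farr F f)"

definition id_functor :: "('o, 'a, 'o, 'a) cat_functor" where
  "id_functor = \<lparr>Fobj = (\<lambda>X. X), Farr = (\<lambda>f. f)\<rparr>"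

definition comp_functor ::
    "('p, 'b, 'q, 'c) cat_functor \<Rightarrow> ('o, 'a, 'p, 'b) cat_functor \<Rightarrow> ('o, 'a, 'q, 'c) cat_functor" where
  "comp_functor G F = \<lparr>Fobj = Fobj G \<circ> Fobj F, Farr = Farr G \<circ> Farr F\<rparr>"

definition natural_transformation ::
    "('o, 'a) category \<Rightarrow> ('p, 'b) category \<Rightarrow> ('o, 'a, 'p, 'b) cat_functor \<Rightarrow>
     ('o, 'a, 'p, 'b) cat_functor \<Rightarrow> ('o \<Rightarrow> 'b) \<Rightarrow> bool" where
  "natural_transformation C D F G \<alpha> \<longleftrightarrow> is_functor C D F \<and> is_functor C D G \<and>
     (\<forall>X \<in> Obj C. \<alpha> X \<in> hom D (Fobj F X) (Fobj G X)) \<and>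
     (\<forall>X \<in> Obj C. \<forall>Y \<in> Obj C. \<forall>f \<in> hom C X Y.
        \<alpha> Y \<cdot>\<^bsub>D\<^esub> Farr F f = Farr G f \<cdot>\<^bsub>D\<^esub> \<alpha> X)"


section \<open>Limits and colimits\<close>

definition cone ::
    "('i, 'j) category \<Rightarrow> ('o, 'a) category \<Rightarrow> ('i, 'j, 'o, 'a) cat_functor \<Rightarrow>
     'o \<Rightarrow> ('i \<Rightarrow> 'a) \<Rightarrow> bool" where
  "cone J C D X p \<longleftrightarrow> X \<in> Obj C \<and>
     (\<forall>i \<in> Obj J. p i \<in> hom C X (Fobj D i)) \<and>
     (\<forall>u \<in> Arr J. Farr D u \<cdot>\<^bsub>C\<^esub> p (Dom J u) = p (Cod J u))"

definition is_limit ::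
    "('i, 'j) category \<Rightarrow> ('o, 'a) category \<Rightarrow> ('i, 'j, 'o, 'a) cat_functor \<Rightarrow>
     'o \<Rightarrow> ('i \<Rightarrow> 'a) \<Rightarrow> bool" where
  "is_limit J C D X p \<longleftrightarrow> cone J C D X p \<and>
     (\<forall>Y q. cone J C D Y q \<longrightarrow>
        (\<exists>!h. h \<in> hom C Y X \<and> (\<forall>i \<in> Obj J. p i \<cdot>\<^bsub>C\<^esub> h = q i)))"

definition cocone ::
    "('i, 'j) category \<Rightarrow> ('o, 'a) category \<Rightarrow> ('i, 'j, 'o, 'a) cat_functor \<Rightarrow>
     'o \<Rightarrow> ('i \<Rightarrow> 'a) \<Rightarrow> bool" where
  "cocone J C D X c \<longleftrightarrow> X \<in> Obj C \<and>
     (\<forall>i \<in> Obj J. c i \<in> hom C (Fobj D i) X) \<and>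
     (\<forall>u \<in> Arr J. c (Cod J u) \<cdot>\<^bsub>C\<^esub> Farr D u = c (Dom J u))"

definition is_colimit ::
    "('i, 'j) category \<Rightarrow> ('o, 'a) category \<Rightarrow> ('i, 'j, 'o, 'a) cat_functor \<Rightarrow>
     'o \<Rightarrow> ('i \<Rightarrow> 'a) \<Rightarrow> bool" where
  "is_colimit J C D X c \<longleftrightarrow> cocone J C D X c \<and>
     (\<forall>Y d. cocone J C D Y d \<longrightarrow>
        (\<exists>!h. h \<in> hom C X Y \<and> (\<forall>i \<in> Obj J. h \<cdot>\<^bsub>C\<^esub> c i = d i)))"

definition complete_category :: "'u rel \<Rightarrow> ('o, 'a) category \<Rightarrow> bool" where
  "complete_category U C \<longleftrightarrow> category C \<and>
     (\<forall>(J :: ('u, 'u) category) D. small_category U J \<and> is_functor J C D \<longrightarrow>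
        (\<exists>X p. is_limit J C D X p))"

definition cocomplete_category :: "'u rel \<Rightarrow> ('o, 'a) category \<Rightarrow> bool" where
  "cocomplete_category U C \<longleftrightarrow> category C \<and>
     (\<forall>(J :: ('u, 'u) category) D. small_category U J \<and> is_functor J C D \<longrightarrow>
        (\<exists>X c. is_colimit J C D X c))"

definition terminal_object :: "('o, 'a) category \<Rightarrow> 'o \<Rightarrow> bool" where
  "terminal_object C Z \<longleftrightarrow> Z \<in> Obj C \<and> (\<forall>X \<in> Obj C. \<exists>!h. h \<in> hom C X Z)"


section \<open>Directed colimits and accessibility\<close>

definition directed_poset :: "'u rel \<Rightarrow> 'u rel \<Rightarrow> 'u set \<Rightarrow> 'u rel \<Rightarrow> bool" where
  "directed_poset U \<kappa> I r \<longleftrightarrow> small U I \<and> partial_order_on I r \<and>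
     (\<forall>S \<subseteq> I. |S| <o \<kappa> \<longrightarrow> (\<exists>b \<in> I. \<forall>a \<in> S. (a, b) \<in> r))"

definition poset_category :: "'i set \<Rightarrow> 'i rel \<Rightarrow> ('i, 'i \<times> 'i) category" where
  "poset_category I r = \<lparr>Obj = I, Arr = r, Dom = fst, Cod = snd, Idt = (\<lambda>i. (i, i)),
     Comp = (\<lambda>v u. (fst u, snd v))\<rparr>"

definition has_directed_colimits :: "'u rel \<Rightarrow> 'u rel \<Rightarrow> ('o, 'a) category \<Rightarrow> bool" where
  "has_directed_colimits U \<kappa> C \<longleftrightarrow>
     (\<forall>I r D. directed_poset U \<kappa> I r \<and> is_functor (poset_category I r) C D \<longrightarrow>
        (\<exists>X c. is_colimit (poset_category I r) C D X c))"

definition preserves_directed_colimits ::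
    "'u rel \<Rightarrow> 'u rel \<Rightarrow> ('o, 'a) category \<Rightarrow> ('p, 'b) category \<Rightarrow>
     ('o, 'a, 'p, 'b) cat_functor \<Rightarrow> bool" where
  "preserves_directed_colimits U \<kappa> C E F \<longleftrightarrow>
     (\<forall>I r D X c. directed_poset U \<kappa> I r \<and> is_functor (poset_category I r) C D \<and>
        is_colimit (poset_category I r) C D X c \<longrightarrow>
        is_colimit (poset_category I r) E (comp_functor F D) (Fobj F X) (\<lambda>i. Farr F (c i)))"

text \<open>The category of small subsets of \<open>'x\<close> and all functions between them, an arrow \<open>(A, f, B)\<close>
  being a function \<open>f\<close> together with its domain and codomain.\<close>

definition set_category :: "'u rel \<Rightarrow> ('x set, 'x set \<times> ('x \<Rightarrow> 'x) \<times> 'x set) category" where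
  "set_category U = \<lparr>Obj = {A. small U A},
     Arr = {(A, f, B). small U A \<and> small U B \<and> f \<in> A \<rightarrow>\<^sub>E B},
     Dom = fst, Cod = (\<lambda>u. snd (snd u)), Idt = (\<lambda>A. (A, restrict id A, A)),
     Comp = (\<lambda>v u. (fst u, compose (fst u) (fst (snd v)) (fst (snd u)), snd (snd v)))\<rparr>"

text \<open>The functor \<open>hom(K, -)\<close>. Its values are embedded into the subsets of \<open>'a + 'u\<close>, where \<open>'a\<close>
  is the type of arrows: by the summand \<open>'u\<close> every small set is in bijection with a small subset
  of that type, so its small subsets form (up to equivalence) the category of all small sets.
  Over \<open>'a\<close> alone, colimits of sets could be distorted by a lack of sets.\<close>

definition hom_functor :: "('o, 'a) category \<Rightarrow> 'o \<Rightarrow>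
    ('o, 'a, ('a + 'u) set, ('a + 'u) set \<times> ('a + 'u \<Rightarrow> 'a + 'u) \<times> ('a + 'u) set) cat_functor" where
  "hom_functor C K = \<lparr>Fobj = (\<lambda>X. Inl ` hom C K X),
     Farr = (\<lambda>f. (Inl ` hom C K (Dom C f),
                  (\<lambda>x \<in> Inl ` hom C K (Dom C f). Inl (f \<cdot>\<^bsub>C\<^esub> projl x)),
                  Inl ` hom C K (Cod C f)))\<rparr>"

definition presentable_object :: "'u rel \<Rightarrow> 'u rel \<Rightarrow> ('o, 'a) category \<Rightarrow> 'o \<Rightarrow> bool" where
  "presentable_object U \<kappa> C K \<longleftrightarrow> K \<in> Obj C \<and>
     preserves_directed_colimits U \<kappa> C
       (set_category U :: (('a + 'u) set, ('a + 'u) set \<times> ('a + 'u \<Rightarrow> 'a + 'u) \<times> ('a + 'u) set) category)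
       (hom_functor C K)"

definition accessible_for :: "'u rel \<Rightarrow> 'u rel \<Rightarrow> ('o, 'a) category \<Rightarrow> bool" where
  "accessible_for U \<kappa> C \<longleftrightarrow> category C \<and> locally_small U C \<and> has_directed_colimits U \<kappa> C \<and>
     (\<exists>A. small U A \<and> (\<forall>K \<in> A. presentable_object U \<kappa> C K) \<and>
        (\<forall>X \<in> Obj C. \<exists>I r D c. directed_poset U \<kappa> I r \<and>
           is_functor (poset_category I r) C D \<and> (\<forall>i \<in> I. Fobj D i \<in> A) \<and>
           is_colimit (poset_category I r) C D X c))"

definition accessible_category :: "'u rel \<Rightarrow> ('o, 'a) category \<Rightarrow> bool" where
  "accessible_category U C \<longleftrightarrow> (\<exists>\<kappa>. regular_cardinal U \<kappa> \<and> accessible_for U \<kappa> C)"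

definition locally_presentable :: "'u rel \<Rightarrow> ('o, 'a) category \<Rightarrow> bool" where
  "locally_presentable U C \<longleftrightarrow> accessible_category U C \<and> cocomplete_category U C"

definition accessible_functor ::
    "'u rel \<Rightarrow> ('o, 'a) category \<Rightarrow> ('p, 'b) category \<Rightarrow> ('o, 'a, 'p, 'b) cat_functor \<Rightarrow> bool" where
  "accessible_functor U C E F \<longleftrightarrow> accessible_category U C \<and> accessible_category U E \<and>
     is_functor C E F \<and>
     (\<exists>\<kappa>. regular_cardinal U \<kappa> \<and> preserves_directed_colimits U \<kappa> C E F)"


section \<open>Graded monads and graded coalgebras\<close>

record ('t, 'o, 'a) graded_monad =
  gfun :: "'t \<Rightarrow> ('o, 'a, 'o, 'a) cat_functor"
  gmult :: "'t \<Rightarrow> 't \<Rightarrow> 'o \<Rightarrow> 'a"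
  gunit :: "'o \<Rightarrow> 'a"

definition is_graded_monad ::
    "('o, 'a) category \<Rightarrow> ('t::monoid_mult, 'o, 'a) graded_monad \<Rightarrow> bool" where
  "is_graded_monad C M \<longleftrightarrow> category C \<and>
     (\<forall>t. is_functor C C (gfun M t)) \<and>
     (\<forall>s t. natural_transformation C C (comp_functor (gfun M s) (gfun M t)) (gfun M (s * t))
        (gmult M s t)) \<and>
     natural_transformation C C id_functor (gfun M 1) (gunit M) \<and>
     (\<forall>r s t. \<forall>X \<in> Obj C.
        gmult M r (s * t) X \<cdot>\<^bsub>C\<^esub> Farr (gfun M r) (gmult M s t X) =
        gmult M (r * s) t X \<cdot>\<^bsub>C\<^esub> gmult M r s (Fobj (gfun M t) X)) \<and>
     (\<forall>t. \<forall>X \<in> Obj C.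
        gmult M t 1 X \<cdot>\<^bsub>C\<^esub> Farr (gfun M t) (gunit M X) = Idt C (Fobj (gfun M t) X) \<and>
        gmult M 1 t X \<cdot>\<^bsub>C\<^esub> gunit M (Fobj (gfun M t) X) = Idt C (Fobj (gfun M t) X))"

definition is_gcoalgebra ::
    "('o, 'a) category \<Rightarrow> ('t::monoid_mult, 'o, 'a) graded_monad \<Rightarrow> 'o \<times> ('t \<Rightarrow> 'a) \<Rightarrow> bool" where
  "is_gcoalgebra C M = (\<lambda>(X, \<gamma>). X \<in> Obj C \<and>
     (\<forall>t. \<gamma> t \<in> hom C X (Fobj (gfun M t) X)) \<and>
     \<gamma> 1 = gunit M X \<and>
     (\<forall>s t. \<gamma> (s * t) = gmult M s t X \<cdot>\<^bsub>C\<^esub> Farr (gfun M s) (\<gamma> t) \<cdot>\<^bsub>C\<^esub> \<gamma> s))"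

definition is_gcoalgebra_hom ::
    "('o, 'a) category \<Rightarrow> ('t::monoid_mult, 'o, 'a) graded_monad \<Rightarrow>
     'o \<times> ('t \<Rightarrow> 'a) \<Rightarrow> 'o \<times> ('t \<Rightarrow> 'a) \<Rightarrow> 'a \<Rightarrow> bool" where
  "is_gcoalgebra_hom C M = (\<lambda>(X, \<gamma>) (Y, \<delta>) h. h \<in> hom C X Y \<and>
     (\<forall>t. Farr (gfun M t) h \<cdot>\<^bsub>C\<^esub> \<gamma> t = \<delta> t \<cdot>\<^bsub>C\<^esub> h))"

text \<open>Arrows carry their domain and codomain, since the same \<open>h\<close> may be a homomorphism between
  several pairs of coalgebras.\<close>

definition GCoAlg :: "('o, 'a) category \<Rightarrow> ('t::monoid_mult, 'o, 'a) graded_monad \<Rightarrow>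
    ('o \<times> ('t \<Rightarrow> 'a), ('o \<times> ('t \<Rightarrow> 'a)) \<times> 'a \<times> ('o \<times> ('t \<Rightarrow> 'a))) category" where
  "GCoAlg C M = \<lparr>Obj = {P. is_gcoalgebra C M P},
     Arr = {(P, h, Q). is_gcoalgebra C M P \<and> is_gcoalgebra C M Q \<and> is_gcoalgebra_hom C M P Q h},
     Dom = fst, Cod = (\<lambda>u. snd (snd u)), Idt = (\<lambda>P. (P, Idt C (fst P), P)),
     Comp = (\<lambda>v u. (fst u, fst (snd v) \<cdot>\<^bsub>C\<^esub> fst (snd u), snd (snd v)))\<rparr>"

end

theory Submission
  imports Defs
begin

text \<open>
  Limits of graded coalgebras are obtained from colimits. Colimits of coalgebras are computed in
  \<open>C\<close>, so by Freyd's argument it suffices to find a small set of coalgebras such that every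
  coalgebra is a colimit of members of it.

  Fix an infinite small set \<open>V\<close> whose cardinality bounds \<open>T\<close>, an accessibility index of \<open>C\<close>
  and one of each \<open>M\<^sub>t\<close>. The carrier of a coalgebra \<open>(X, \<gamma>)\<close> is the colimit of presentable objects
  \<open>L i\<close> with \<open>i \<in> I\<close>. For \<open>S \<subseteq> I\<close> with at most \<open>|V|\<close> elements let \<open>K S\<close> be the colimit of the
  subdiagram on \<open>S\<close>. Then \<open>X\<close> is the colimit of all \<open>K S\<close>, and this colimit is so highly directed
  that every \<open>M\<^sub>t\<close> preserves it; hence each composite \<open>L i \<rightarrow> X \<rightarrow> M\<^sub>t X\<close> factors through some
  \<open>M\<^sub>t (K S)\<close>, and any two factorisations agree after enlarging \<open>S\<close>. Choosing the factorisations once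
  and for all, those \<open>S\<close> that are closed under the choices carry a coalgebra structure on \<open>K S\<close>.
  As every \<open>S\<close> lies in a closed one, \<open>(X, \<gamma>)\<close> is the colimit of these coalgebras, of whose carriers
  there is only a small set up to isomorphism. No \<open>M\<^sub>t\<close> has to preserve presentable objects.
\<close>

section \<open>Small sets\<close>

text \<open>Limits of coalgebras are not computed in \<open>C\<close>, since the
  \<open>M\<^sub>t\<close> need not preserve limits; hence the detour through Freyd's argument. Its
  generators serve to cut the family of all cones over a diagram down to a small one: the colimit of
  the cones with vertex among the generators is a weak limit.

  The obstacle in finding generators is that the arrow from \<open>M\<^sub>t (K S)\<close> to
  \<open>M\<^sub>t X\<close> need not be monic, so that an equation valid over \<open>X\<close>
  becomes valid only after enlarging \<open>S\<close>. This forces two rounds of closure. The first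
  makes the factorisations compatible along edges, so that \<open>K S\<close> receives a coaction at
  all. The second, possible only once coactions exist, makes the unit and multiplication laws hold.

  The size of \<open>V\<close> is dictated by the unions that occur: over all grades, over all pairs
  of grades, over countably many rounds of closure, and over fewer sets than an accessibility
  index.\<close>

locale universe =
  fixes U :: "'u rel"
  assumes inaccessible: "inaccessible U"
begin

lemma Card_order_U: "Card_order U" and natLeq_less_U: "natLeq <o U"
  using inaccessible unfolding inaccessible_def by auto

lemma infinite_U: "infinite (Field U)"
  using natLeq_less_U ordLess_imp_ordLeq
    cinfinite_mono[OF _ natLeq_cinfinite] unfolding cinfinite_def by blast

text \<open>\<open>stable\<close> is regularity in terms of sums: fewer than \<open>U\<close> many
  sets, each below \<open>U\<close>, have a union below \<open>U\<close>. \<open>small_Sigma\<close>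
  and \<open>small_UN\<close> rest on it.\<close>

lemma stable_U: "stable U"
  using inaccessible regularCard_stable infinite_U unfolding inaccessible_def by blast

lemma small_ordLeq: "|A| \<le>o |B| \<Longrightarrow> small U B \<Longrightarrow> small U A"
  unfolding small_def by (rule ordLeq_ordLess_trans)

lemma small_subset: "A \<subseteq> B \<Longrightarrow> small U B \<Longrightarrow> small U A"
  by (rule small_ordLeq[OF card_of_mono1])

lemma small_image: "small U A \<Longrightarrow> small U (f ` A)"
  by (rule small_ordLeq[OF card_of_image])

lemma small_inj_on: "inj_on f A \<Longrightarrow> f ` A \<subseteq> B \<Longrightarrow> small U B \<Longrightarrow> small U A"
  by (rule small_ordLeq) (use card_of_ordLeq in blast)

lemma small_finite: "finite A \<Longrightarrow> small U A"
  unfolding small_def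
  by (rule ordLess_transitive[OF _ natLeq_less_U]) (simp add: finite_iff_ordLess_natLeq[symmetric])

lemma small_Field:
  assumes "regular_cardinal U \<mu>"
  shows "small U (Field \<mu>)"
  using assms ordIso_ordLess_trans[OF card_of_Field_ordIso, of \<mu> U]
  unfolding regular_cardinal_def small_def by simp

lemma small_Sigma: "small U A \<Longrightarrow> (\<And>a. a \<in> A \<Longrightarrow> small U (B a)) \<Longrightarrow> small U (Sigma A B)"
  unfolding small_def using stable_elim[OF stable_U] by blast

lemma small_UN: "small U A \<Longrightarrow> (\<And>a. a \<in> A \<Longrightarrow> small U (B a)) \<Longrightarrow> small U (\<Union>a\<in>A. B a)"
  unfolding small_def using stable_UNION[OF stable_U] by blast

text \<open>Completeness, cocompleteness and directed posets quantify over index sets in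
  \<open>'u\<close> only; this embedding renames small index sets of other types into
  \<open>'u\<close>.\<close>

lemma small_embedding:
  assumes "small U A"
  obtains f where "inj_on f A" "f ` A \<subseteq> Field U"
proof -
  have "|A| \<le>o |Field U|"
    using assms unfolding small_def
    by (meson Card_order_U card_of_Field_ordIso ordIso_symmetric ordLeq_ordIso_trans ordLess_imp_ordLeq)
  then show thesis using that unfolding card_of_ordLeq[symmetric] by blast
qed

lemma small_Pow:
  assumes "small U A"
  shows "small U (Pow A)"
proof -
  obtain f where f: "inj_on f A" "f ` A \<subseteq> Field U"
    using small_embedding[OF assms] .
  \<comment> \<open>Inaccessibility speaks only of subsets of \<open>Field U\<close>, so the power
    set is formed of the copy of \<open>A\<close> there.\<close>
  have "small U (Pow (f ` A))"
    using inaccessible f(2) small_image[OF assms, of f] unfolding inaccessible_def small_def by blast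
  moreover have "inj_on (image f) (Pow A)"
    using f(1) inj_on_image_Pow by blast
  ultimately show ?thesis
    by (rule small_inj_on[rotated 2]) blast
qed

lemma small_PiE:
  assumes "small U A" "small U B"
  shows "small U (A \<rightarrow>\<^sub>E B)"
proof (rule small_inj_on)
  show "small U (Pow (A \<times> B))"
    using assms by (intro small_Pow small_Sigma)
  \<comment> \<open>Extensional functions are determined by their graphs over
    \<open>A\<close>.\<close>
  show "inj_on (\<lambda>f. (\<lambda>x. (x, f x)) ` A) (A \<rightarrow>\<^sub>E B)"
    by (rule inj_onI, rule PiE_ext, assumption, assumption) blast
  show "(\<lambda>f. (\<lambda>x. (x, f x)) ` A) ` (A \<rightarrow>\<^sub>E B) \<subseteq> Pow (A \<times> B)"
    by auto
qed

end


lemma ordLeq_inj_Field: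
  assumes "Card_order \<mu>" "inj_on f (Field \<mu>)" "f ` Field \<mu> \<subseteq> V"
  shows "\<mu> \<le>o |V|"
proof -
  have "|Field \<mu>| \<le>o |V|" using assms(2,3) card_of_ordLeq[of "Field \<mu>" V] by blast
  then show ?thesis
    by (rule ordIso_ordLeq_trans[OF ordIso_symmetric[OF card_of_Field_ordIso[OF assms(1)]]])
qed


section \<open>Colimits of graph-shaped diagrams\<close>

text \<open>A diagram is given by labels \<open>L i\<close> and a set \<open>R\<close> of labelled edges \<open>(i, f, j)\<close>, which need
  not be closed under composition.\<close>

definition gdiagram ::
    "('o, 'a) category \<Rightarrow> 'i set \<Rightarrow> ('i \<Rightarrow> 'o) \<Rightarrow> ('i \<times> 'a \<times> 'i) set \<Rightarrow> bool" where
  "gdiagram C I L R \<longleftrightarrow> (\<forall>i\<in>I. L i \<in> Obj C) \<and>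
     (\<forall>i f j. (i, f, j) \<in> R \<longrightarrow> i \<in> I \<and> j \<in> I \<and> f \<in> hom C (L i) (L j))"

definition gcocone ::
    "('o, 'a) category \<Rightarrow> 'i set \<Rightarrow> ('i \<Rightarrow> 'o) \<Rightarrow> ('i \<times> 'a \<times> 'i) set \<Rightarrow> 'o \<Rightarrow> ('i \<Rightarrow> 'a) \<Rightarrow> bool" where
  "gcocone C I L R X c \<longleftrightarrow> X \<in> Obj C \<and> (\<forall>i\<in>I. c i \<in> hom C (L i) X) \<and>
     (\<forall>i f j. (i, f, j) \<in> R \<longrightarrow> c j \<cdot>\<^bsub>C\<^esub> f = c i)"

definition gcolimit ::
    "('o, 'a) category \<Rightarrow> 'i set \<Rightarrow> ('i \<Rightarrow> 'o) \<Rightarrow> ('i \<times> 'a \<times> 'i) set \<Rightarrow> 'o \<Rightarrow> ('i \<Rightarrow> 'a) \<Rightarrow> bool" where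
  "gcolimit C I L R X c \<longleftrightarrow> gcocone C I L R X c \<and>
     (\<forall>Y d. gcocone C I L R Y d \<longrightarrow> (\<exists>!h. h \<in> hom C X Y \<and> (\<forall>i\<in>I. h \<cdot>\<^bsub>C\<^esub> c i = d i)))"

definition has_gcolimits :: "'u rel \<Rightarrow> ('o, 'a) category \<Rightarrow> bool" where
  "has_gcolimits U C \<longleftrightarrow> (\<forall>(I :: 'u set) L R. small U I \<and> gdiagram C I L R \<longrightarrow>
     (\<exists>X c. gcolimit C I L R X c))"

lemma gdiagramI:
  assumes "\<And>i. i \<in> I \<Longrightarrow> L i \<in> Obj C"
    and "\<And>i f j. (i, f, j) \<in> R \<Longrightarrow> i \<in> I \<and> j \<in> I \<and> f \<in> hom C (L i) (L j)"
  shows "gdiagram C I L R"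
  using assms unfolding gdiagram_def by blast

lemma gdiagramD:
  assumes "gdiagram C I L R"
  shows "i \<in> I \<Longrightarrow> L i \<in> Obj C"
    and "(i, f, j) \<in> R \<Longrightarrow> i \<in> I" "(i, f, j) \<in> R \<Longrightarrow> j \<in> I"
    and "(i, f, j) \<in> R \<Longrightarrow> f \<in> hom C (L i) (L j)"
  using assms unfolding gdiagram_def by blast+

lemma gcoconeI:
  assumes "X \<in> Obj C" "\<And>i. i \<in> I \<Longrightarrow> c i \<in> hom C (L i) X"
    and "\<And>i f j. (i, f, j) \<in> R \<Longrightarrow> c j \<cdot>\<^bsub>C\<^esub> f = c i"
  shows "gcocone C I L R X c"
  using assms unfolding gcocone_def by blast

lemma gcoconeD:
  assumes "gcocone C I L R X c"
  shows "X \<in> Obj C" "i \<in> I \<Longrightarrow> c i \<in> hom C (L i) X" "(i, f, j) \<in> R \<Longrightarrow> c j \<cdot>\<^bsub>C\<^esub> f = c i"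
  using assms unfolding gcocone_def by blast+

lemma gcolimit_gcocone: "gcolimit C I L R X c \<Longrightarrow> gcocone C I L R X c"
  unfolding gcolimit_def by blast

lemmas gcolimitD = gcoconeD[OF gcolimit_gcocone]

lemma gcolimit_mediator:
  assumes "gcolimit C I L R X c" "gcocone C I L R Y d"
  shows "\<exists>h\<in>hom C X Y. \<forall>i\<in>I. h \<cdot>\<^bsub>C\<^esub> c i = d i"
  using assms unfolding gcolimit_def by blast

text \<open>This lets labels be replaced by extensional functions, of which there is only a small
  set.\<close>

lemma gcolimit_cong:
  assumes "\<And>i. i \<in> I \<Longrightarrow> L i = L' i"
  shows "gcolimit C I L R X c \<longleftrightarrow> gcolimit C I L' R X c"
proof -
  have "gcocone C I L R Y d \<longleftrightarrow> gcocone C I L' R Y d" for Y d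
    using assms unfolding gcocone_def by simp
  then show ?thesis unfolding gcolimit_def by simp
qed

text \<open>A cocone sees of an arrow of \<open>J\<close> only its endpoints and its image, so
  arrows that share these may become a single edge.\<close>

lemma is_colimit_iff_gcolimit:
  "is_colimit J C D X c \<longleftrightarrow>
    gcolimit C (Obj J) (Fobj D) ((\<lambda>u. (Dom J u, Farr D u, Cod J u)) ` Arr J) X c"
proof -
  have "cocone J C D Y d \<longleftrightarrow>
      gcocone C (Obj J) (Fobj D) ((\<lambda>u. (Dom J u, Farr D u, Cod J u)) ` Arr J) Y d" for Y d
    unfolding cocone_def gcocone_def by blast
  then show ?thesis
    unfolding is_colimit_def gcolimit_def by simp
qed

context category
begin

lemma homD:
  assumes "f \<in> hom C X Y"
  shows "f \<in> Arr C" "Dom C f = X" "Cod C f = Y" "X \<in> Obj C" "Y \<in> Obj C"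
  using assms Dom_in Cod_in unfolding hom_def by auto

text \<open>The legs are jointly epic because \<open>h\<close> and \<open>h'\<close> both mediate
  for the cocone \<open>h \<cdot> c i\<close>. Equations between arrows out of a colimit are tested
  on its legs in this way from here on.\<close>

lemma gcolimit_unique:
  assumes X: "gcolimit C I L R X c" and h: "h \<in> hom C X Y" "h' \<in> hom C X Y"
    and eq: "\<And>i. i \<in> I \<Longrightarrow> h \<cdot> c i = h' \<cdot> c i"
    and R: "gdiagram C I L R"
  shows "h = h'"
proof -
  have "gcocone C I L R Y (\<lambda>i. h \<cdot> c i)"
  proof (rule gcoconeI)
    show "Y \<in> Obj C" using h homD by blast
    show "h \<cdot> c i \<in> hom C (L i) Y" if "i \<in> I" for i
      using Comp_in gcolimitD(2)[OF X that] h(1) by blast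
    fix i f j assume ij: "(i, f, j) \<in> R"
    have "(h \<cdot> c j) \<cdot> f = h \<cdot> (c j \<cdot> f)"
      using gdiagramD(3,4)[OF R ij] gcolimitD(2)[OF X] h(1) Comp_assoc by blast
    then show "(h \<cdot> c j) \<cdot> f = h \<cdot> c i"
      using gcolimitD(3)[OF X ij] by simp
  qed
  then have "\<exists>!g. g \<in> hom C X Y \<and> (\<forall>i\<in>I. g \<cdot> c i = h \<cdot> c i)"
    using X unfolding gcolimit_def by blast
  then show ?thesis using h eq by metis
qed

lemma gcolimitI:
  assumes X: "gcocone C I L R X c"
    and ex: "\<And>Y d. gcocone C I L R Y d \<Longrightarrow> \<exists>h. h \<in> hom C X Y \<and> (\<forall>i\<in>I. h \<cdot> c i = d i)"
    and un: "\<And>Y h h'. h \<in> hom C X Y \<Longrightarrow> h' \<in> hom C X Y \<Longrightarrow> (\<And>i. i \<in> I \<Longrightarrow> h \<cdot> c i = h' \<cdot> c i) \<Longrightarrow> h = h'"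
  shows "gcolimit C I L R X c"
  unfolding gcolimit_def
proof (intro conjI allI impI X)
  fix Y d assume d: "gcocone C I L R Y d"
  obtain h where h: "h \<in> hom C X Y" "\<forall>i\<in>I. h \<cdot> c i = d i"
    using ex[OF d] by blast
  show "\<exists>!h. h \<in> hom C X Y \<and> (\<forall>i\<in>I. h \<cdot> c i = d i)"
  proof (rule ex1I[of _ h])
    show "h \<in> hom C X Y \<and> (\<forall>i\<in>I. h \<cdot> c i = d i)" using h by blast
    show "h' = h" if "h' \<in> hom C X Y \<and> (\<forall>i\<in>I. h' \<cdot> c i = d i)" for h'
      by (rule un[of h' Y h]) (use h that in simp_all)
  qed
qed

lemma gdiagram_reindex:
  assumes inj: "inj_on \<phi> I" and R: "gdiagram C I L R"
  shows "gdiagram C (\<phi> ` I) (L \<circ> inv_into I \<phi>) ((\<lambda>(i, f, j). (\<phi> i, f, \<phi> j)) ` R)"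
proof (rule gdiagramI)
  fix i assume "i \<in> \<phi> ` I"
  then show "(L \<circ> inv_into I \<phi>) i \<in> Obj C"
    using inj gdiagramD(1)[OF R] by auto
next
  fix i f j assume "(i, f, j) \<in> (\<lambda>(i, f, j). (\<phi> i, f, \<phi> j)) ` R"
  then obtain i' j' where ij: "(i', f, j') \<in> R" "i = \<phi> i'" "j = \<phi> j'" by auto
  then show "i \<in> \<phi> ` I \<and> j \<in> \<phi> ` I \<and> f \<in> hom C ((L \<circ> inv_into I \<phi>) i) ((L \<circ> inv_into I \<phi>) j)"
    using inj gdiagramD(2-4)[OF R ij(1)] by simp
qed

lemma gcolimit_reindex:
  assumes X: "gcolimit C (\<phi> ` I) (L \<circ> inv_into I \<phi>) ((\<lambda>(i, f, j). (\<phi> i, f, \<phi> j)) ` R) X c"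
    and inj: "inj_on \<phi> I" and R: "gdiagram C I L R"
  shows "gcolimit C I L R X (c \<circ> \<phi>)"
proof (rule gcolimitI)
  let ?R = "(\<lambda>(i, f, j). (\<phi> i, f, \<phi> j)) ` R"
  have inv: "inv_into I \<phi> (\<phi> i) = i" if "i \<in> I" for i
    using inj that by simp
  note R' = gdiagram_reindex[OF inj R]
  show "gcocone C I L R X (c \<circ> \<phi>)"
  proof (rule gcoconeI)
    show "X \<in> Obj C" using gcolimitD(1)[OF X] .
    show "(c \<circ> \<phi>) i \<in> hom C (L i) X" if "i \<in> I" for i
      using gcolimitD(2)[OF X, of "\<phi> i"] that inv by simp
    fix i f j assume "(i, f, j) \<in> R"
    then have "(\<phi> i, f, \<phi> j) \<in> ?R" by force
    then show "(c \<circ> \<phi>) j \<cdot> f = (c \<circ> \<phi>) i" using gcolimitD(3)[OF X] by auto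
  qed
  fix Y
  show "\<exists>h. h \<in> hom C X Y \<and> (\<forall>i\<in>I. h \<cdot> (c \<circ> \<phi>) i = d i)" if d: "gcocone C I L R Y d" for d
  proof -
    have "gcocone C (\<phi> ` I) (L \<circ> inv_into I \<phi>) ?R Y (d \<circ> inv_into I \<phi>)"
    proof (rule gcoconeI)
      show "Y \<in> Obj C" using gcoconeD(1)[OF d] .
      show "(d \<circ> inv_into I \<phi>) i \<in> hom C ((L \<circ> inv_into I \<phi>) i) Y" if "i \<in> \<phi> ` I" for i
        using gcoconeD(2)[OF d] that inv by auto
      fix i f j assume "(i, f, j) \<in> ?R"
      then obtain i' j' where ij: "(i', f, j') \<in> R" "i = \<phi> i'" "j = \<phi> j'" by auto
      then show "(d \<circ> inv_into I \<phi>) j \<cdot> f = (d \<circ> inv_into I \<phi>) i"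
        using inv gdiagramD(2,3)[OF R ij(1)] gcoconeD(3)[OF d ij(1)] by simp
    qed
    then obtain h where "h \<in> hom C X Y" "\<And>i. i \<in> \<phi> ` I \<Longrightarrow> h \<cdot> c i = (d \<circ> inv_into I \<phi>) i"
      using gcolimit_mediator[OF X] by metis
    then show ?thesis using inv by auto
  qed
  show "h = h'" if "h \<in> hom C X Y" "h' \<in> hom C X Y" "\<And>i. i \<in> I \<Longrightarrow> h \<cdot> (c \<circ> \<phi>) i = h' \<cdot> (c \<circ> \<phi>) i" for h h'
    using gcolimit_unique[OF X that(1,2) _ R'] that(3) by auto
qed

text \<open>The vertices are renamed into \<open>'u\<close>, and the colimit found there is carried
  back along the renaming.\<close>

lemma has_gcolimitsD:
  assumes "inaccessible U" "has_gcolimits U C" and I: "small U I" and R: "gdiagram C I L R"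
  shows "\<exists>X c. gcolimit C I L R X c"
proof -
  interpret universe U by unfold_locales fact
  obtain \<phi> where \<phi>: "inj_on \<phi> I" "\<phi> ` I \<subseteq> Field U"
    using small_embedding[OF I] .
  obtain X c where "gcolimit C (\<phi> ` I) (L \<circ> inv_into I \<phi>) ((\<lambda>(i, f, j). (\<phi> i, f, \<phi> j)) ` R) X c"
    using assms(2) small_image[OF I, of \<phi>] gdiagram_reindex[OF \<phi>(1) R] unfolding has_gcolimits_def
    by blast
  then show ?thesis using gcolimit_reindex[OF _ \<phi>(1) R] by blast
qed

end

text \<open>A path is recorded by its endpoints and its composite in \<open>C\<close> alone, so that
  the category of paths inherits its laws from \<open>C\<close>.\<close>

inductive_set paths :: "('o, 'a) category \<Rightarrow> 'i set \<Rightarrow> ('i \<Rightarrow> 'o) \<Rightarrow> ('i \<times> 'a \<times> 'i) set \<Rightarrow> ('i \<times> 'a \<times> 'i) set"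
  for C I L R where
  paths_Idt: "i \<in> I \<Longrightarrow> (i, Idt C (L i), i) \<in> paths C I L R"
| paths_step: "(i, f, j) \<in> paths C I L R \<Longrightarrow> (j, g, k) \<in> R \<Longrightarrow> (i, g \<cdot>\<^bsub>C\<^esub> f, k) \<in> paths C I L R"

context category
begin

lemma paths_hom:
  assumes R: "gdiagram C I L R" and "(i, f, j) \<in> paths C I L R"
  shows "i \<in> I \<and> j \<in> I \<and> f \<in> hom C (L i) (L j)"
  using assms(2)
proof (induction i f j rule: paths.induct)
  case (paths_Idt i)
  then show ?case using Idt_in gdiagramD(1)[OF R] by blast
next
  case (paths_step i f j g k)
  then show ?case using Comp_in gdiagramD[OF R] by blast
qed

lemma paths_Comp:
  assumes R: "gdiagram C I L R" and "(j, g, k) \<in> paths C I L R" "(i, f, j) \<in> paths C I L R"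
  shows "(i, g \<cdot> f, k) \<in> paths C I L R"
  using assms(2,3)
proof (induction j g k rule: paths.induct)
  case (paths_Idt j)
  then show ?case using Idt_Comp paths_hom[OF R] by metis
next
  case (paths_step j g k h l)
  then have "(i, h \<cdot> (g \<cdot> f), l) \<in> paths C I L R"
    by (blast intro: paths.paths_step)
  moreover have "(h \<cdot> g) \<cdot> f = h \<cdot> (g \<cdot> f)"
    using paths_step paths_hom[OF R] gdiagramD(4)[OF R] by (meson Comp_assoc)
  ultimately show ?case by simp
qed

lemma edge_in_paths:
  assumes R: "gdiagram C I L R" and ij: "(i, f, j) \<in> R"
  shows "(i, f, j) \<in> paths C I L R"
proof -
  have "(i, f \<cdot> Idt C (L i), j) \<in> paths C I L R"
    using paths_step[OF paths_Idt ij] gdiagramD(2)[OF R ij] by blast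
  then show ?thesis using Comp_Idt gdiagramD(4)[OF R ij] by metis
qed

text \<open>Commuting with edges implies commuting with their composites; hence a graph and its
  category of paths have the same colimits.\<close>

lemma gcocone_paths:
  assumes R: "gdiagram C I L R"
  shows "gcocone C I L (paths C I L R) X c \<longleftrightarrow> gcocone C I L R X c"
proof
  assume "gcocone C I L (paths C I L R) X c"
  then show "gcocone C I L R X c"
    unfolding gcocone_def using edge_in_paths[OF R] by blast
next
  assume c: "gcocone C I L R X c"
  have "c j \<cdot> f = c i" if "(i, f, j) \<in> paths C I L R" for i f j
    using that
  proof (induction i f j rule: paths.induct)
    case (paths_Idt i)
    then show ?case using gcoconeD(2)[OF c] Comp_Idt by blast
  next
    case (paths_step i f j g k)
    have "c k \<cdot> (g \<cdot> f) = (c k \<cdot> g) \<cdot> f"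
      using paths_hom[OF R paths_step(1)] gdiagramD(2-4)[OF R paths_step(2)] gcoconeD(2)[OF c] Comp_assoc
      by metis
    then show ?case using gcoconeD(3)[OF c paths_step(2)] paths_step(3) by simp
  qed
  then show "gcocone C I L (paths C I L R) X c"
    using c unfolding gcocone_def by blast
qed

lemma cocomplete_has_gcolimits:
  fixes U :: "'u rel"
  assumes "inaccessible U" "locally_small U C" "cocomplete_category U C"
  shows "has_gcolimits U C"
  unfolding has_gcolimits_def
proof (intro allI impI, elim conjE)
  fix I :: "'u set" and L R assume I: "small U I" and R: "gdiagram C I L R"
  interpret universe U by unfold_locales fact
  let ?P = "paths C I L R"
  have "?P \<subseteq> I \<times> (\<Union>i\<in>I. \<Union>j\<in>I. hom C (L i) (L j)) \<times> I"
    using paths_hom[OF R] by fast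
  moreover have "small U (\<Union>i\<in>I. \<Union>j\<in>I. hom C (L i) (L j))"
    using assms(2) gdiagramD(1)[OF R] unfolding locally_small_def by (intro small_UN I) blast
  ultimately have P: "small U ?P"
    by (rule small_subset[OF _ small_Sigma[OF I small_Sigma]]) (assumption | rule I)+
  \<comment> \<open>Cocompleteness is about categories with objects and arrows in \<open>'u\<close>.
    The vertices are there already; the arrows of \<open>J\<close> below are names
    \<open>e p\<close> of paths \<open>p\<close>.\<close>
  obtain e where e: "inj_on e ?P" "e ` ?P \<subseteq> Field U"
    using small_embedding[OF P] .
  define d where "d = inv_into ?P e"
  have de [simp]: "d (e p) = p" if "p \<in> ?P" for p
    using e(1) that unfolding d_def by simp
  define J :: "('u, 'u) category" where
    "J = \<lparr>Obj = I, Arr = e ` ?P, Dom = fst \<circ> d, Cod = snd \<circ> snd \<circ> d, Idt = (\<lambda>i. e (i, Idt C (L i), i)),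
       Comp = (\<lambda>v u. e (fst (d u), fst (snd (d v)) \<cdot> fst (snd (d u)), snd (snd (d v))))\<rparr>"
  have homJ: "u \<in> hom J i j \<longleftrightarrow> (\<exists>f. u = e (i, f, j) \<and> (i, f, j) \<in> ?P)" for u i j
    unfolding hom_def J_def by force
  have P_Idt: "(i, Idt C (L i), i) \<in> ?P" "(j, Idt C (L j), j) \<in> ?P" "f \<cdot> Idt C (L i) = f" "Idt C (L j) \<cdot> f = f"
    if "(i, f, j) \<in> ?P" for i f j
    using paths_hom[OF R that] Comp_Idt Idt_Comp by (blast intro: paths_Idt)+
  have catJ: "category J"
  proof
    show "Dom J u \<in> Obj J" "Cod J u \<in> Obj J" if "u \<in> Arr J" for u
      using that paths_hom[OF R] unfolding J_def by auto
    show "Idt J i \<in> hom J i i" if "i \<in> Obj J" for i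
      using that homJ paths_Idt[of i I C L R] unfolding J_def by auto
    show "v \<cdot>\<^bsub>J\<^esub> u \<in> hom J i k" if "u \<in> hom J i j" "v \<in> hom J j k" for u v i j k
      using that paths_Comp[OF R] unfolding homJ by (auto simp: J_def)
    show "u \<cdot>\<^bsub>J\<^esub> Idt J i = u" if "u \<in> hom J i j" for u i j
      using that unfolding homJ by (auto simp: J_def P_Idt)
    show "Idt J j \<cdot>\<^bsub>J\<^esub> u = u" if "u \<in> hom J i j" for u i j
      using that unfolding homJ by (auto simp: J_def P_Idt)
    show "(w \<cdot>\<^bsub>J\<^esub> v) \<cdot>\<^bsub>J\<^esub> u = w \<cdot>\<^bsub>J\<^esub> v \<cdot>\<^bsub>J\<^esub> u"
      if uvw: "u \<in> hom J i j" "v \<in> hom J j k" "w \<in> hom J k l" for u v w i j k l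
    proof -
      obtain f g h where fgh: "u = e (i, f, j)" "(i, f, j) \<in> ?P" "v = e (j, g, k)" "(j, g, k) \<in> ?P"
        "w = e (k, h, l)" "(k, h, l) \<in> ?P"
        using uvw unfolding homJ by blast
      then have "(h \<cdot> g) \<cdot> f = h \<cdot> (g \<cdot> f)"
        using paths_hom[OF R] Comp_assoc by metis
      then show ?thesis
        using fgh paths_Comp[OF R] by (simp add: J_def)
    qed
  qed
  define D where "D = \<lparr>Fobj = L, Farr = fst \<circ> snd \<circ> d\<rparr>"
  have D: "is_functor J C D"
    unfolding is_functor_def
  proof (intro conjI ballI catJ)
    show "category C" by unfold_locales
    show "Fobj D X \<in> Obj C" if "X \<in> Obj J" for X
      using gdiagramD(1)[OF R] that unfolding D_def J_def by simp
    show "Farr D f \<in> hom C (Fobj D i) (Fobj D j)" if "f \<in> hom J i j" for f i j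
      using that paths_hom[OF R] unfolding homJ D_def by auto
    show "Farr D (Idt J X) = Idt C (Fobj D X)" if "X \<in> Obj J" for X
      using paths_Idt[of X I C L R] that unfolding D_def J_def by simp
    show "Farr D (v \<cdot>\<^bsub>J\<^esub> u) = Farr D v \<cdot> Farr D u" if "u \<in> hom J i j" "v \<in> hom J j k" for u v i j k
      using that paths_Comp[OF R] unfolding homJ by (auto simp: J_def D_def)
  qed
  have "small_category U J"
    using catJ I small_image[OF P] unfolding small_category_def J_def by simp
  then obtain X c where "is_colimit J C D X c"
    using assms(3) D unfolding cocomplete_category_def by blast
  moreover have "(\<lambda>u. (Dom J u, Farr D u, Cod J u)) ` Arr J = ?P"
    unfolding J_def D_def by force
  ultimately have "gcolimit C I L ?P X c"
    unfolding is_colimit_iff_gcolimit by (simp add: J_def D_def)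
  then show "\<exists>X c. gcolimit C I L R X c"
    unfolding gcolimit_def gcocone_paths[OF R] by blast
qed

end


section \<open>Completeness from a small set of generators under colimits\<close>

text \<open>One notion covers both uses in Freyd's argument: the set of all cone endomorphisms of a
  weak limit, and a pair of competing mediators.\<close>

definition joint_coequalizer :: "('o, 'a) category \<Rightarrow> 'a set \<Rightarrow> 'o \<Rightarrow> 'o \<Rightarrow> 'a \<Rightarrow> bool" where
  "joint_coequalizer C N B E e \<longleftrightarrow> e \<in> hom C B E \<and> (\<forall>f\<in>N. \<forall>g\<in>N. e \<cdot>\<^bsub>C\<^esub> f = e \<cdot>\<^bsub>C\<^esub> g) \<and>
     (\<forall>Y. \<forall>d\<in>hom C B Y. (\<forall>f\<in>N. \<forall>g\<in>N. d \<cdot>\<^bsub>C\<^esub> f = d \<cdot>\<^bsub>C\<^esub> g) \<longrightarrow> (\<exists>!h. h \<in> hom C E Y \<and> h \<cdot>\<^bsub>C\<^esub> e = d))"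

lemma joint_coequalizerD:
  assumes "joint_coequalizer C N B E e"
  shows "e \<in> hom C B E" "f \<in> N \<Longrightarrow> g \<in> N \<Longrightarrow> e \<cdot>\<^bsub>C\<^esub> f = e \<cdot>\<^bsub>C\<^esub> g"
    and "d \<in> hom C B Y \<Longrightarrow> (\<And>f g. f \<in> N \<Longrightarrow> g \<in> N \<Longrightarrow> d \<cdot>\<^bsub>C\<^esub> f = d \<cdot>\<^bsub>C\<^esub> g) \<Longrightarrow> \<exists>h\<in>hom C E Y. h \<cdot>\<^bsub>C\<^esub> e = d"
  using assms unfolding joint_coequalizer_def by blast+

context category
begin

lemma joint_coequalizer_epi:
  assumes E: "joint_coequalizer C N B E e" and N: "N \<subseteq> hom C A B"
    and h: "h \<in> hom C E Y" "h' \<in> hom C E Y" "h \<cdot> e = h' \<cdot> e"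
  shows "h = h'"
proof -
  have he: "h \<cdot> e \<in> hom C B Y"
    using Comp_in[OF joint_coequalizerD(1)[OF E] h(1)] .
  have eq: "(h \<cdot> e) \<cdot> f = (h \<cdot> e) \<cdot> g" if "f \<in> N" "g \<in> N" for f g
  proof -
    have fg: "f \<in> hom C A B" "g \<in> hom C A B" using that N by auto
    show ?thesis
      using Comp_assoc[OF fg(1) joint_coequalizerD(1)[OF E] h(1)]
        Comp_assoc[OF fg(2) joint_coequalizerD(1)[OF E] h(1)] joint_coequalizerD(2)[OF E that] by simp
  qed
  have "\<exists>!k. k \<in> hom C E Y \<and> k \<cdot> e = h \<cdot> e"
    using E he eq unfolding joint_coequalizer_def by blast
  then show ?thesis using h by metis
qed

lemma joint_coequalizer_exists:
  assumes "inaccessible U" "has_gcolimits U C" and N: "N \<subseteq> hom C A B" "N \<noteq> {}"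
  shows "\<exists>E e. joint_coequalizer C N B E e"
proof -
  interpret universe U by unfold_locales fact
  \<comment> \<open>In the diagram below \<open>True\<close> stands for \<open>B\<close>,
    \<open>False\<close> for \<open>A\<close>, and the edges are the members of \<open>N\<close>. A
    cocone is determined by its leg at \<open>True\<close>; composing with the fixed
    \<open>n\<close> gives the leg at \<open>False\<close>.\<close>
  obtain n where n: "n \<in> N" "n \<in> hom C A B" using N by blast
  define L where "L b = (if b then B else A)" for b
  define R where "R = {(False, f, True) | f. f \<in> N}"
  have R: "gdiagram C UNIV L R"
    by (rule gdiagramI) (use n N homD in \<open>auto simp: L_def R_def\<close>)
  obtain E c where E: "gcolimit C UNIV L R E c"
    using has_gcolimitsD[OF assms(1,2) small_finite[OF finite] R] by blast
  have c: "c True \<in> hom C B E" "c False \<in> hom C A E"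
    using gcolimitD(2)[OF E, of True] gcolimitD(2)[OF E, of False] by (auto simp: L_def)
  have c_eq: "c True \<cdot> f = c False" if "f \<in> N" for f
    using gcolimitD(3)[OF E] that by (auto simp: R_def)
  have fac: "\<exists>h\<in>hom C E Y. h \<cdot> c True = d"
    if d: "d \<in> hom C B Y" "\<And>f g. f \<in> N \<Longrightarrow> g \<in> N \<Longrightarrow> d \<cdot> f = d \<cdot> g" for d Y
  proof -
    have "gcocone C UNIV L R Y (\<lambda>b. if b then d else d \<cdot> n)"
    proof (rule gcoconeI)
      show "Y \<in> Obj C" using d homD by blast
      show "(if i then d else d \<cdot> n) \<in> hom C (L i) Y" for i
        using d(1) Comp_in[OF n(2) d(1)] by (simp add: L_def)
      show "(if j then d else d \<cdot> n) \<cdot> f = (if i then d else d \<cdot> n)" if "(i, f, j) \<in> R" for i f j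
        using that d(2)[OF _ n(1)] by (auto simp: R_def)
    qed
    then obtain h where "h \<in> hom C E Y" "\<forall>b\<in>UNIV. h \<cdot> c b = (if b then d else d \<cdot> n)"
      using gcolimit_mediator[OF E] by blast
    then show ?thesis by (intro bexI[of _ h]) simp_all
  qed
  have un: "h = h'" if h: "h \<in> hom C E Y" "h' \<in> hom C E Y" "h \<cdot> c True = h' \<cdot> c True" for h h' Y
  proof (rule gcolimit_unique[OF E h(1,2) _ R])
    have "h \<cdot> c False = h' \<cdot> c False"
      using h(3) Comp_assoc[OF n(2) c(1) h(1)] Comp_assoc[OF n(2) c(1) h(2)] c_eq[OF n(1)] by simp
    then show "h \<cdot> c b = h' \<cdot> c b" for b
      using h(3) by (cases b) auto
  qed
  have "joint_coequalizer C N B E (c True)"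
    unfolding joint_coequalizer_def
  proof (intro conjI allI impI ballI c)
    show "c True \<cdot> f = c True \<cdot> g" if "f \<in> N" "g \<in> N" for f g
      using that c_eq by simp
    show "\<exists>!h. h \<in> hom C E Y \<and> h \<cdot> c True = d"
      if d: "d \<in> hom C B Y" "\<forall>f\<in>N. \<forall>g\<in>N. d \<cdot> f = d \<cdot> g" for Y d
    proof (rule ex_ex1I)
      show "\<exists>h. h \<in> hom C E Y \<and> h \<cdot> c True = d" using fac[OF d(1)] d(2) by blast
      show "h = h'" if "h \<in> hom C E Y \<and> h \<cdot> c True = d" "h' \<in> hom C E Y \<and> h' \<cdot> c True = d" for h h'
        by (rule un) (use that in auto)
    qed
  qed
  then show ?thesis by blast
qed

lemma cone_Comp:
  assumes "cone J C D X p" "h \<in> hom C Y X" "is_functor J C D"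
  shows "cone J C D Y (\<lambda>i. p i \<cdot> h)"
  unfolding cone_def
proof (intro conjI ballI)
  show "Y \<in> Obj C" using assms(2) homD by blast
  have p: "p i \<in> hom C X (Fobj D i)" if "i \<in> Obj J" for i
    using assms(1) that unfolding cone_def by blast
  show "p i \<cdot> h \<in> hom C Y (Fobj D i)" if "i \<in> Obj J" for i
    using Comp_in[OF assms(2) p[OF that]] .
  fix u assume u: "u \<in> Arr J"
  interpret J: category J using assms(3) unfolding is_functor_def by blast
  have "u \<in> hom J (Dom J u) (Cod J u)" using u unfolding hom_def by simp
  moreover have du: "Dom J u \<in> Obj J" "Cod J u \<in> Obj J" using u J.Dom_in J.Cod_in by auto
  ultimately have "Farr D u \<in> hom C (Fobj D (Dom J u)) (Fobj D (Cod J u))"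
    using assms(3) unfolding is_functor_def by blast
  then have "Farr D u \<cdot> (p (Dom J u) \<cdot> h) = (Farr D u \<cdot> p (Dom J u)) \<cdot> h"
    using p[OF du(1)] assms(2) Comp_assoc by metis
  also have "Farr D u \<cdot> p (Dom J u) = p (Cod J u)"
    using assms(1) u unfolding cone_def by blast
  finally show "Farr D u \<cdot> p (Dom J u) \<cdot> h = p (Cod J u) \<cdot> h" .
qed

text \<open>The witness is the colimit of all cones with vertex in \<open>G\<close>. An arbitrary
  vertex \<open>Y\<close> is a colimit of objects of \<open>G\<close>, and its cone, restricted
  along the legs of that colimit, yields cones that already occur in the diagram, compatibly with
  its edges.\<close>

lemma weak_limit_exists:
  assumes U: "inaccessible U" and loc: "locally_small U C" and col: "has_gcolimits U C"
    and G: "small U G" "G \<subseteq> Obj C"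
    and dense: "\<And>Y. Y \<in> Obj C \<Longrightarrow> \<exists>(I :: 'i set) L R c. gdiagram C I L R \<and> L ` I \<subseteq> G \<and> gcolimit C I L R Y c"
    and J: "small_category U J" "is_functor J C D"
  shows "\<exists>X p. cone J C D X p \<and>
    (\<forall>Y q. cone J C D Y q \<longrightarrow> (\<exists>h\<in>hom C Y X. \<forall>i\<in>Obj J. p i \<cdot> h = q i))"
proof -
  interpret universe U by unfold_locales fact
  interpret J: category J using J(1) unfolding small_category_def by blast
  have smallJ: "small U (Obj J)" using J(1) unfolding small_category_def by blast
  have Dobj: "Fobj D i \<in> Obj C" if "i \<in> Obj J" for i
    using J(2) that unfolding is_functor_def by blast
  have Darr: "Farr D u \<in> hom C (Fobj D (Dom J u)) (Fobj D (Cod J u))" if "u \<in> Arr J" for u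
    using J(2) that J.Dom_in J.Cod_in unfolding is_functor_def hom_def[of J] by blast
  define H where "H = (\<Union>g\<in>G. \<Union>i\<in>Obj J. hom C g (Fobj D i))"
  \<comment> \<open>The legs are extensional families with values in \<open>H\<close>, which keeps
    the set of cones small. The edges \<open>R\<close> are all morphisms between such cones.\<close>
  define S where "S = {(g, q). g \<in> G \<and> q \<in> Obj J \<rightarrow>\<^sub>E H \<and> cone J C D g q}"
  define R where "R = {(s, f, s'). s \<in> S \<and> s' \<in> S \<and> f \<in> hom C (fst s) (fst s') \<and>
    (\<forall>i\<in>Obj J. snd s' i \<cdot> f = snd s i)}"
  have "small U H"
    unfolding H_def using loc G(2) Dobj unfolding locally_small_def
    by (intro small_UN G(1) smallJ) blast
  then have "small U (G \<times> (Obj J \<rightarrow>\<^sub>E H))"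
    by (intro small_Sigma small_PiE G(1) smallJ)
  then have S: "small U S"
    by (rule small_subset[rotated]) (auto simp: S_def)
  have R: "gdiagram C S fst R"
    by (rule gdiagramI) (use G(2) in \<open>auto simp: S_def R_def\<close>)
  obtain X c where X: "gcolimit C S fst R X c"
    using has_gcolimitsD[OF U col S R] by blast
  have "\<exists>pi. pi \<in> hom C X (Fobj D i) \<and> (\<forall>s\<in>S. pi \<cdot> c s = snd s i)" if i: "i \<in> Obj J" for i
  proof -
    have "gcocone C S fst R (Fobj D i) (\<lambda>s. snd s i)"
    proof (rule gcoconeI)
      show "snd s i \<in> hom C (fst s) (Fobj D i)" if "s \<in> S" for s
        using that i unfolding S_def cone_def by auto
      show "snd s' i \<cdot> f = snd s i" if "(s, f, s') \<in> R" for s f s'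
        using that i unfolding R_def by auto
    qed (rule Dobj[OF i])
    then show ?thesis using gcolimit_mediator[OF X] by metis
  qed
  then obtain p where p: "\<And>i. i \<in> Obj J \<Longrightarrow> p i \<in> hom C X (Fobj D i)"
    and pc: "\<And>i s. i \<in> Obj J \<Longrightarrow> s \<in> S \<Longrightarrow> p i \<cdot> c s = snd s i"
    by metis
  have c: "c s \<in> hom C (fst s) X" if "s \<in> S" for s
    using gcolimitD(2)[OF X that] .
  have cone: "cone J C D X p"
    unfolding cone_def
  proof (intro conjI ballI p gcolimitD(1)[OF X])
    fix u assume u: "u \<in> Arr J"
    note du = J.Dom_in[OF u] J.Cod_in[OF u]
    show "Farr D u \<cdot> p (Dom J u) = p (Cod J u)"
    proof (rule gcolimit_unique[OF X _ _ _ R])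
      show "Farr D u \<cdot> p (Dom J u) \<in> hom C X (Fobj D (Cod J u))"
        using Comp_in[OF p[OF du(1)] Darr[OF u]] .
      show "p (Cod J u) \<in> hom C X (Fobj D (Cod J u))" by (rule p[OF du(2)])
      fix s assume s: "s \<in> S"
      have "(Farr D u \<cdot> p (Dom J u)) \<cdot> c s = Farr D u \<cdot> snd s (Dom J u)"
        using Comp_assoc[OF c[OF s] p[OF du(1)] Darr[OF u]] pc[OF du(1) s] by simp
      also have "\<dots> = snd s (Cod J u)"
        using s u unfolding S_def cone_def by auto
      finally show "(Farr D u \<cdot> p (Dom J u)) \<cdot> c s = p (Cod J u) \<cdot> c s"
        using pc[OF du(2) s] by simp
    qed
  qed
  have "\<exists>h\<in>hom C Y X. \<forall>i\<in>Obj J. p i \<cdot> h = q i" if q: "cone J C D Y q" for Y q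
  proof -
    have q_hom: "q i \<in> hom C Y (Fobj D i)" if "i \<in> Obj J" for i
      using q that unfolding cone_def by auto
    have "Y \<in> Obj C" using q unfolding cone_def by blast
    then obtain I :: "'i set" and L R' k where R': "gdiagram C I L R'" and L: "L ` I \<subseteq> G"
      and k: "gcolimit C I L R' Y k"
      using dense by metis
    \<comment> \<open>The restriction of \<open>q\<close> along the leg \<open>k a\<close> is a
      vertex of the diagram with colimit \<open>X\<close>.\<close>
    define s where "s a = (L a, \<lambda>i\<in>Obj J. q i \<cdot> k a)" for a
    have s: "s a \<in> S" if a: "a \<in> I" for a
    proof -
      have La: "L a \<in> G" using L a by blast
      have "cone J C D (L a) (\<lambda>i. q i \<cdot> k a)"
        using cone_Comp[OF q gcolimitD(2)[OF k a] J(2)] .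
      then have *: "cone J C D (L a) (\<lambda>i\<in>Obj J. q i \<cdot> k a)"
        unfolding cone_def using J.Dom_in J.Cod_in by simp
      then show ?thesis
        using La unfolding S_def s_def H_def cone_def by auto
    qed
    have "gcocone C I L R' X (c \<circ> s)"
    proof (rule gcoconeI)
      show "X \<in> Obj C" by (rule gcolimitD(1)[OF X])
      show "(c \<circ> s) a \<in> hom C (L a) X" if "a \<in> I" for a
        using c[OF s[OF that]] by (simp add: s_def)
      fix a f b assume ab: "(a, f, b) \<in> R'"
      note abI = gdiagramD(2-4)[OF R' ab]
      have "(q i \<cdot> k b) \<cdot> f = q i \<cdot> k a" if "i \<in> Obj J" for i
        using Comp_assoc[OF abI(3) gcolimitD(2)[OF k abI(2)] q_hom[OF that]] gcolimitD(3)[OF k ab]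
        by simp
      then have "(s a, f, s b) \<in> R"
        using s abI unfolding R_def by (auto simp: s_def)
      then show "(c \<circ> s) b \<cdot> f = (c \<circ> s) a"
        using gcolimitD(3)[OF X] by simp
    qed
    then obtain h where h: "h \<in> hom C Y X" "\<And>a. a \<in> I \<Longrightarrow> h \<cdot> k a = c (s a)"
      using gcolimit_mediator[OF k] by (metis comp_apply)
    have "p i \<cdot> h = q i" if i: "i \<in> Obj J" for i
    proof (rule gcolimit_unique[OF k _ q_hom[OF i] _ R'])
      show "p i \<cdot> h \<in> hom C Y (Fobj D i)" using Comp_in[OF h(1) p[OF i]] .
      fix a assume a: "a \<in> I"
      have "(p i \<cdot> h) \<cdot> k a = p i \<cdot> c (s a)"
        using Comp_assoc[OF gcolimitD(2)[OF k a] h(1) p[OF i]] h(2)[OF a] by simp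
      also have "\<dots> = q i \<cdot> k a"
        using pc[OF i s[OF a]] i by (simp add: s_def)
      finally show "(p i \<cdot> h) \<cdot> k a = q i \<cdot> k a" .
    qed
    then show ?thesis using h(1) by blast
  qed
  then show ?thesis using cone by blast
qed

text \<open>Freyd's argument: the joint coequalizer of all endomorphisms of a weak limit cone is a limit cone.\<close>

lemma limit_exists:
  assumes U: "inaccessible U" and loc: "locally_small U C" and col: "has_gcolimits U C"
    and G: "small U G" "G \<subseteq> Obj C"
    and dense: "\<And>Y. Y \<in> Obj C \<Longrightarrow> \<exists>(I :: 'i set) L R c. gdiagram C I L R \<and> L ` I \<subseteq> G \<and> gcolimit C I L R Y c"
    and J: "small_category U J" "is_functor J C D"
  shows "\<exists>X p. is_limit J C D X p"
proof -
  obtain X p where p: "cone J C D X p"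
    and weak: "\<And>Y q. cone J C D Y q \<Longrightarrow> \<exists>h\<in>hom C Y X. \<forall>i\<in>Obj J. p i \<cdot> h = q i"
    using weak_limit_exists[OF assms] by auto
  have p_hom: "p i \<in> hom C X (Fobj D i)" if "i \<in> Obj J" for i
    using p that unfolding cone_def by blast
  have X: "X \<in> Obj C" using p unfolding cone_def by blast
  define N where "N = {f \<in> hom C X X. \<forall>i\<in>Obj J. p i \<cdot> f = p i}"
  have id: "Idt C X \<in> N"
    using Idt_in[OF X] Comp_Idt p_hom unfolding N_def by blast
  then have N: "N \<subseteq> hom C X X" "N \<noteq> {}" unfolding N_def by auto
  obtain E e where E: "joint_coequalizer C N X E e"
    using joint_coequalizer_exists[OF U col N] by blast
  note e = joint_coequalizerD(1,2)[OF E] and e_fac = joint_coequalizerD(3)[OF E]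
    and e_epi = joint_coequalizer_epi[OF E N(1)]
  have "\<exists>r\<in>hom C E (Fobj D i). r \<cdot> e = p i" if i: "i \<in> Obj J" for i
    using e_fac[OF p_hom[OF i]] i unfolding N_def by auto
  then obtain r where r: "\<And>i. i \<in> Obj J \<Longrightarrow> r i \<in> hom C E (Fobj D i)"
    and re: "\<And>i. i \<in> Obj J \<Longrightarrow> r i \<cdot> e = p i"
    by metis
  interpret J: category J using J(1) unfolding small_category_def by blast
  have Darr: "Farr D u \<in> hom C (Fobj D (Dom J u)) (Fobj D (Cod J u))" if "u \<in> Arr J" for u
    using J(2) that J.Dom_in J.Cod_in unfolding is_functor_def hom_def[of J] by blast
  \<comment> \<open>The cone equations may be tested after composition with an epi. This serves both
    the quotient \<open>e\<close> and the second quotient \<open>z\<close> below.\<close>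
  have cone_epi: "cone J C D Z q"
    if r: "cone J C D E' r'" and z: "z \<in> hom C E' Z"
      and epi: "\<And>Y h h'. h \<in> hom C Z Y \<Longrightarrow> h' \<in> hom C Z Y \<Longrightarrow> h \<cdot> z = h' \<cdot> z \<Longrightarrow> h = h'"
      and q: "\<And>i. i \<in> Obj J \<Longrightarrow> q i \<in> hom C Z (Fobj D i)" "\<And>i. i \<in> Obj J \<Longrightarrow> q i \<cdot> z = r' i"
    for E' r' z Z q
    unfolding cone_def
  proof (intro conjI ballI q)
    show "Z \<in> Obj C" using z homD by blast
    fix u assume u: "u \<in> Arr J"
    note du = J.Dom_in[OF u] J.Cod_in[OF u]
    show "Farr D u \<cdot> q (Dom J u) = q (Cod J u)"
    proof (rule epi)
      show "Farr D u \<cdot> q (Dom J u) \<in> hom C Z (Fobj D (Cod J u))"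
        using Comp_in[OF q(1)[OF du(1)] Darr[OF u]] .
      show "(Farr D u \<cdot> q (Dom J u)) \<cdot> z = q (Cod J u) \<cdot> z"
        using Comp_assoc[OF z q(1)[OF du(1)] Darr[OF u]] q(2) du r u unfolding cone_def by simp
    qed (rule q(1)[OF du(2)])
  qed
  have rcone: "cone J C D E r"
    by (rule cone_epi[OF p e(1) e_epi r re])
  have "is_limit J C D E r"
    unfolding is_limit_def
  proof (intro conjI rcone allI impI)
    fix Y q assume q: "cone J C D Y q"
    obtain h where h: "h \<in> hom C Y X" "\<forall>i\<in>Obj J. p i \<cdot> h = q i"
      using weak[OF q] by blast
    show "\<exists>!h. h \<in> hom C Y E \<and> (\<forall>i\<in>Obj J. r i \<cdot> h = q i)"
    proof (rule ex_ex1I)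
      have "r i \<cdot> (e \<cdot> h) = q i" if i: "i \<in> Obj J" for i
        using Comp_assoc[OF h(1) e(1) r[OF i]] re[OF i] h(2) i by simp
      then show "\<exists>h. h \<in> hom C Y E \<and> (\<forall>i\<in>Obj J. r i \<cdot> h = q i)"
        using Comp_in[OF h(1) e(1)] by blast
      fix a b assume a: "a \<in> hom C Y E \<and> (\<forall>i\<in>Obj J. r i \<cdot> a = q i)"
        and b: "b \<in> hom C Y E \<and> (\<forall>i\<in>Obj J. r i \<cdot> b = q i)"
      \<comment> \<open>Two mediators \<open>a\<close> and \<open>b\<close> are compared by
        coequalizing them with \<open>z\<close>. The cone \<open>r\<close> factors through
        \<open>z\<close>, the weak limit property leads back from \<open>Z\<close> to
        \<open>X\<close> by some \<open>w\<close>, and the loop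
        \<open>(w \<cdot> z) \<cdot> e\<close> is a cone endomorphism of \<open>X\<close>.\<close>
      have ab: "{a, b} \<subseteq> hom C Y E" "{a, b} \<noteq> {}" using a b by auto
      obtain Z z where Z: "joint_coequalizer C {a, b} E Z z"
        using joint_coequalizer_exists[OF U col ab] by blast
      note z = joint_coequalizerD(1,2)[OF Z] and z_fac = joint_coequalizerD(3)[OF Z]
        and z_epi = joint_coequalizer_epi[OF Z ab(1)]
      have "\<exists>s\<in>hom C Z (Fobj D i). s \<cdot> z = r i" if i: "i \<in> Obj J" for i
        by (rule z_fac[OF r[OF i]]) (use a b i in auto)
      then obtain s where s: "\<And>i. i \<in> Obj J \<Longrightarrow> s i \<in> hom C Z (Fobj D i)"
        and sz: "\<And>i. i \<in> Obj J \<Longrightarrow> s i \<cdot> z = r i"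
        by metis
      have "cone J C D Z s"
        by (rule cone_epi[OF rcone z(1) z_epi s sz])
      then obtain w where w: "w \<in> hom C Z X" "\<And>i. i \<in> Obj J \<Longrightarrow> p i \<cdot> w = s i"
        using weak by metis
      have wz: "w \<cdot> z \<in> hom C E X" using Comp_in[OF z(1) w(1)] .
      have wze: "(w \<cdot> z) \<cdot> e \<in> hom C X X" using Comp_in[OF e(1) wz] .
      have "p i \<cdot> ((w \<cdot> z) \<cdot> e) = p i" if i: "i \<in> Obj J" for i
      proof -
        have "p i \<cdot> ((w \<cdot> z) \<cdot> e) = (p i \<cdot> (w \<cdot> z)) \<cdot> e"
          using Comp_assoc[OF e(1) wz p_hom[OF i]] by simp
        also have "p i \<cdot> (w \<cdot> z) = r i"
          using Comp_assoc[OF z(1) w(1) p_hom[OF i]] w(2)[OF i] sz[OF i] by simp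
        finally show ?thesis using re[OF i] by simp
      qed
      then have "(w \<cdot> z) \<cdot> e \<in> N"
        using wze unfolding N_def by blast
      \<comment> \<open>\<open>e\<close> identifies the loop with the identity. As \<open>e\<close>
        is epi, \<open>e \<cdot> w\<close> is a left inverse of \<open>z\<close>, so
        \<open>z\<close> is monic and \<open>z \<cdot> a = z \<cdot> b\<close> gives
        \<open>a = b\<close>.\<close>
      then have "e \<cdot> ((w \<cdot> z) \<cdot> e) = e \<cdot> Idt C X"
        using e(2) id by blast
      then have "(e \<cdot> (w \<cdot> z)) \<cdot> e = Idt C E \<cdot> e"
        using Comp_assoc[OF e(1) wz e(1)] Comp_Idt[OF e(1)] Idt_Comp[OF e(1)] by simp
      then have "e \<cdot> (w \<cdot> z) = Idt C E"
        using e_epi[OF Comp_in[OF wz e(1)] Idt_in] homD(5)[OF e(1)] by blast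
      then have split: "(e \<cdot> w) \<cdot> z = Idt C E"
        using Comp_assoc[OF z(1) w(1) e(1)] by simp
      have ew: "e \<cdot> w \<in> hom C Z E" using Comp_in[OF w(1) e(1)] .
      have "a = (e \<cdot> w) \<cdot> (z \<cdot> a)"
        using Comp_assoc[OF _ z(1) ew] split Idt_Comp a by metis
      also have "\<dots> = (e \<cdot> w) \<cdot> (z \<cdot> b)"
        using z(2)[of a b] by simp
      also have "\<dots> = b"
        using Comp_assoc[OF _ z(1) ew] split Idt_Comp b by metis
      finally show "a = b" .
    qed
  qed
  then show ?thesis by blast
qed

end

text \<open>A cone over the empty diagram is just an object, so a limit of that diagram is
  terminal.\<close>

lemma complete_category_terminal_object:
  fixes U :: "'u rel"
  assumes "inaccessible U" "complete_category U C"
  shows "\<exists>Z. terminal_object C Z"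
proof -
  interpret universe U by unfold_locales fact
  define J :: "('u, 'u) category" where
    "J = \<lparr>Obj = {}, Arr = {}, Dom = undefined, Cod = undefined, Idt = undefined, Comp = undefined\<rparr>"
  define D :: "('u, 'u, 'a, 'b) cat_functor" where
    "D = \<lparr>Fobj = undefined, Farr = undefined\<rparr>"
  have "category J"
    by unfold_locales (auto simp: J_def hom_def)
  then have "small_category U J" "is_functor J C D"
    using assms(2) small_finite[of "{}"] small_finite[of "{}"]
    unfolding small_category_def is_functor_def complete_category_def J_def by auto
  then obtain X p where X: "is_limit J C D X p"
    using assms(2) unfolding complete_category_def by blast
  have "cone J C D Y q \<longleftrightarrow> Y \<in> Obj C" for Y q
    unfolding cone_def J_def by simp
  then have "terminal_object C X"
    using X unfolding is_limit_def terminal_object_def by (simp add: J_def)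
  then show ?thesis by blast
qed


section \<open>Colimits of graded coalgebras\<close>

locale graded_monad = category C for C :: "('o, 'a) category" (structure) +
  fixes M :: "('t::monoid_mult, 'o, 'a) graded_monad"
  assumes monad: "is_graded_monad C M"
begin

abbreviation F :: "'t \<Rightarrow> 'o \<Rightarrow> 'o" where "F t \<equiv> Fobj (gfun M t)"
abbreviation Fm :: "'t \<Rightarrow> 'a \<Rightarrow> 'a" where "Fm t \<equiv> Farr (gfun M t)"

lemma is_functor_M: "is_functor C C (gfun M t)"
  using monad unfolding is_graded_monad_def by blast

lemma F_Obj: "X \<in> Obj C \<Longrightarrow> F t X \<in> Obj C"
  using is_functor_M[of t] unfolding is_functor_def by blast

lemma Fm_hom: "f \<in> hom C X Y \<Longrightarrow> Fm t f \<in> hom C (F t X) (F t Y)"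
  using is_functor_M[of t] homD(4,5) unfolding is_functor_def by blast

lemma Fm_Idt: "X \<in> Obj C \<Longrightarrow> Fm t (Idt C X) = Idt C (F t X)"
  using is_functor_M[of t] unfolding is_functor_def by blast

lemma Fm_Comp: "f \<in> hom C X Y \<Longrightarrow> g \<in> hom C Y Z \<Longrightarrow> Fm t (g \<cdot> f) = Fm t g \<cdot> Fm t f"
  using is_functor_M[of t] homD(4,5) unfolding is_functor_def by blast

lemma gmult_natural: "natural_transformation C C (comp_functor (gfun M s) (gfun M t)) (gfun M (s * t)) (gmult M s t)"
  using monad unfolding is_graded_monad_def by blast

lemma gmult_hom: "X \<in> Obj C \<Longrightarrow> gmult M s t X \<in> hom C (F s (F t X)) (F (s * t) X)"
  using gmult_natural[of s t] unfolding natural_transformation_def comp_functor_def by simp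

lemma gmult_Fm: "f \<in> hom C X Y \<Longrightarrow> gmult M s t Y \<cdot> Fm s (Fm t f) = Fm (s * t) f \<cdot> gmult M s t X"
  using gmult_natural[of s t] homD(4,5) unfolding natural_transformation_def comp_functor_def by simp

lemma gunit_natural: "natural_transformation C C id_functor (gfun M 1) (gunit M)"
  using monad unfolding is_graded_monad_def by blast

lemma gunit_hom: "X \<in> Obj C \<Longrightarrow> gunit M X \<in> hom C X (F 1 X)"
  using gunit_natural unfolding natural_transformation_def id_functor_def by simp

lemma gunit_Fm: "f \<in> hom C X Y \<Longrightarrow> gunit M Y \<cdot> f = Fm 1 f \<cdot> gunit M X"
  using gunit_natural homD(4,5) unfolding natural_transformation_def id_functor_def by simp

lemma coalgebraD:
  assumes "is_gcoalgebra C M (X, \<gamma>)"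
  shows "X \<in> Obj C" "\<gamma> t \<in> hom C X (F t X)" "\<gamma> 1 = gunit M X"
    "\<gamma> (s * t) = gmult M s t X \<cdot> Fm s (\<gamma> t) \<cdot> \<gamma> s"
  using assms unfolding is_gcoalgebra_def by auto

lemma coalgebra_homD:
  assumes "is_gcoalgebra_hom C M (X, \<gamma>) (Y, \<delta>) h"
  shows "h \<in> hom C X Y" "Fm t h \<cdot> \<gamma> t = \<delta> t \<cdot> h"
  using assms unfolding is_gcoalgebra_hom_def by auto

lemma coalgebra_hom_iff:
  "is_gcoalgebra_hom C M P Q h \<longleftrightarrow>
    h \<in> hom C (fst P) (fst Q) \<and> (\<forall>t. Fm t h \<cdot> snd P t = snd Q t \<cdot> h)"
  unfolding is_gcoalgebra_hom_def by (simp add: case_prod_beta)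

lemma coaction_mult_hom:
  assumes "X \<in> Obj C" "\<And>t. \<gamma> t \<in> hom C X (F t X)"
  shows "gmult M s t X \<cdot> Fm s (\<gamma> t) \<cdot> \<gamma> s \<in> hom C X (F (s * t) X)"
  using Comp_in[OF Comp_in[OF assms(2) Fm_hom[OF assms(2)]] gmult_hom[OF assms(1)]] .

text \<open>Two applications of \<open>eq\<close> and the naturality of \<open>gmult\<close>. It is
  stated for bare families of arrows because it helps to establish the multiplication law for
  coactions still under construction.\<close>

lemma coaction_mult_natural:
  assumes h: "h \<in> hom C X Y" and \<gamma>: "\<And>t. \<gamma> t \<in> hom C X (F t X)" and \<delta>: "\<And>t. \<delta> t \<in> hom C Y (F t Y)"
    and eq: "\<And>t. Fm t h \<cdot> \<gamma> t = \<delta> t \<cdot> h"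
  shows "(gmult M s t Y \<cdot> Fm s (\<delta> t) \<cdot> \<delta> s) \<cdot> h = Fm (s * t) h \<cdot> gmult M s t X \<cdot> Fm s (\<gamma> t) \<cdot> \<gamma> s"
proof -
  have X: "X \<in> Obj C" and Y: "Y \<in> Obj C" using h homD by auto
  note mX = gmult_hom[OF X] and mY = gmult_hom[OF Y]
  have "(gmult M s t Y \<cdot> Fm s (\<delta> t) \<cdot> \<delta> s) \<cdot> h = gmult M s t Y \<cdot> ((Fm s (\<delta> t) \<cdot> \<delta> s) \<cdot> h)"
    using Comp_assoc[OF h Comp_in[OF \<delta> Fm_hom[OF \<delta>]] mY] .
  also have "(Fm s (\<delta> t) \<cdot> \<delta> s) \<cdot> h = Fm s (\<delta> t) \<cdot> Fm s h \<cdot> \<gamma> s"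
    using Comp_assoc[OF h \<delta> Fm_hom[OF \<delta>]] eq by simp
  also have "\<dots> = Fm s (\<delta> t \<cdot> h) \<cdot> \<gamma> s"
    using Comp_assoc[OF \<gamma> Fm_hom[OF h] Fm_hom[OF \<delta>]] Fm_Comp[OF h \<delta>] by simp
  also have "\<dots> = Fm s (Fm t h) \<cdot> Fm s (\<gamma> t) \<cdot> \<gamma> s"
    using Comp_assoc[OF \<gamma> Fm_hom[OF \<gamma>] Fm_hom[OF Fm_hom[OF h]]] Fm_Comp[OF \<gamma> Fm_hom[OF h]] eq by simp
  also have "gmult M s t Y \<cdot> \<dots> = (Fm (s * t) h \<cdot> gmult M s t X) \<cdot> Fm s (\<gamma> t) \<cdot> \<gamma> s"
    using Comp_assoc[OF Comp_in[OF \<gamma> Fm_hom[OF \<gamma>]] Fm_hom[OF Fm_hom[OF h]] mY] gmult_Fm[OF h] by simp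
  also have "\<dots> = Fm (s * t) h \<cdot> gmult M s t X \<cdot> Fm s (\<gamma> t) \<cdot> \<gamma> s"
    using Comp_assoc[OF Comp_in[OF \<gamma> Fm_hom[OF \<gamma>]] mX Fm_hom[OF h]] .
  finally show ?thesis .
qed

lemma hom_GCoAlg:
  "u \<in> hom (GCoAlg C M) P Q \<longleftrightarrow>
    (\<exists>h. u = (P, h, Q) \<and> is_gcoalgebra C M P \<and> is_gcoalgebra C M Q \<and> is_gcoalgebra_hom C M P Q h)"
  unfolding hom_def GCoAlg_def by auto

lemma Obj_GCoAlg: "P \<in> Obj (GCoAlg C M) \<longleftrightarrow> is_gcoalgebra C M P"
  unfolding GCoAlg_def by simp

lemma Comp_GCoAlg: "(Q', g, R) \<cdot>\<^bsub>GCoAlg C M\<^esub> (P, f, Q) = (P, g \<cdot> f, R)"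
  unfolding GCoAlg_def by simp

lemma coalgebra_hom_Comp:
  assumes P: "is_gcoalgebra C M P" and Q: "is_gcoalgebra C M Q" and R: "is_gcoalgebra C M R"
    and f: "is_gcoalgebra_hom C M P Q f" and g: "is_gcoalgebra_hom C M Q R g"
  shows "is_gcoalgebra_hom C M P R (g \<cdot> f)"
proof -
  obtain X \<alpha> Y \<beta> Z \<gamma> where [simp]: "P = (X, \<alpha>)" "Q = (Y, \<beta>)" "R = (Z, \<gamma>)"
    by (metis surj_pair)
  note P = P[simplified] and Q = Q[simplified] and R = R[simplified]
  note f = coalgebra_homD[OF f[simplified]] and g = coalgebra_homD[OF g[simplified]]
  have "Fm t (g \<cdot> f) \<cdot> \<alpha> t = \<gamma> t \<cdot> (g \<cdot> f)" for t
  proof -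
    have "Fm t (g \<cdot> f) \<cdot> \<alpha> t = Fm t g \<cdot> \<beta> t \<cdot> f"
      using Comp_assoc[OF coalgebraD(2)[OF P] Fm_hom[OF f(1)] Fm_hom[OF g(1)]] Fm_Comp[OF f(1) g(1)] f(2) by simp
    also have "\<dots> = (\<gamma> t \<cdot> g) \<cdot> f"
      using Comp_assoc[OF f(1) coalgebraD(2)[OF Q] Fm_hom[OF g(1)]] g(2) by simp
    also have "\<dots> = \<gamma> t \<cdot> (g \<cdot> f)"
      using Comp_assoc[OF f(1) g(1) coalgebraD(2)[OF R]] .
    finally show ?thesis .
  qed
  then show ?thesis
    using Comp_in[OF f(1) g(1)] unfolding is_gcoalgebra_hom_def by simp
qed

lemma coalgebra_hom_Idt:
  assumes "is_gcoalgebra C M P"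
  shows "is_gcoalgebra_hom C M P P (Idt C (fst P))"
proof -
  obtain X \<gamma> where P: "P = (X, \<gamma>)" by fastforce
  note X = coalgebraD[OF assms[unfolded P]]
  show ?thesis
    using Idt_in[OF X(1)] Fm_Idt[OF X(1)] Comp_Idt[OF X(2)] Idt_Comp[OF X(2)]
    unfolding is_gcoalgebra_hom_def P by simp
qed

lemma category_GCoAlg: "category (GCoAlg C M)"
proof
  let ?Q = "GCoAlg C M"
  show "Dom ?Q u \<in> Obj ?Q" "Cod ?Q u \<in> Obj ?Q" if "u \<in> Arr ?Q" for u
    using that unfolding GCoAlg_def by auto
  have Idt: "Idt ?Q P = (P, Idt C (fst P), P)" for P
    unfolding GCoAlg_def by simp
  show "Idt ?Q P \<in> hom ?Q P P" if "P \<in> Obj ?Q" for P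
    using that coalgebra_hom_Idt unfolding Idt hom_GCoAlg Obj_GCoAlg by blast
  show "v \<cdot>\<^bsub>?Q\<^esub> u \<in> hom ?Q P S" if "u \<in> hom ?Q P R" "v \<in> hom ?Q R S" for u v P R S
    using that unfolding hom_GCoAlg by (auto simp: Comp_GCoAlg intro: coalgebra_hom_Comp simp del: split_paired_All)
  have hom: "f \<in> hom C (fst P) (fst Q)" if "is_gcoalgebra_hom C M P Q f" for P Q f
    using that unfolding coalgebra_hom_iff by auto
  show "u \<cdot>\<^bsub>?Q\<^esub> Idt ?Q P = u" "Idt ?Q R \<cdot>\<^bsub>?Q\<^esub> u = u" if u: "u \<in> hom ?Q P R" for u P R
  proof -
    obtain f where f: "u = (P, f, R)" "is_gcoalgebra_hom C M P R f"
      using u unfolding hom_GCoAlg by blast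
    show "u \<cdot>\<^bsub>?Q\<^esub> Idt ?Q P = u" "Idt ?Q R \<cdot>\<^bsub>?Q\<^esub> u = u"
      unfolding f(1) Idt Comp_GCoAlg using Comp_Idt[OF hom[OF f(2)]] Idt_Comp[OF hom[OF f(2)]] by simp_all
  qed
  show "(w \<cdot>\<^bsub>?Q\<^esub> v) \<cdot>\<^bsub>?Q\<^esub> u = w \<cdot>\<^bsub>?Q\<^esub> v \<cdot>\<^bsub>?Q\<^esub> u"
    if uvw: "u \<in> hom ?Q P R" "v \<in> hom ?Q R S" "w \<in> hom ?Q S T" for u v w P R S T
  proof -
    obtain f g h where fgh: "u = (P, f, R)" "v = (R, g, S)" "w = (S, h, T)" and
      homs: "is_gcoalgebra_hom C M P R f" "is_gcoalgebra_hom C M R S g" "is_gcoalgebra_hom C M S T h"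
      using uvw unfolding hom_GCoAlg by blast
    show ?thesis
      unfolding fgh Comp_GCoAlg using Comp_assoc[OF homs[THEN hom]] by simp
  qed
qed

lemma locally_small_GCoAlg:
  assumes "inaccessible U" "locally_small U C"
  shows "locally_small U (GCoAlg C M)"
  unfolding locally_small_def
proof (intro ballI)
  interpret universe U by unfold_locales fact
  fix P Q assume PQ: "P \<in> Obj (GCoAlg C M)" "Q \<in> Obj (GCoAlg C M)"
  have "fst P \<in> Obj C" "fst Q \<in> Obj C"
    using PQ unfolding Obj_GCoAlg is_gcoalgebra_def by auto
  then have "small U ((\<lambda>h. (P, h, Q)) ` hom C (fst P) (fst Q))"
    using small_image assms(2) unfolding locally_small_def by blast
  moreover have "hom (GCoAlg C M) P Q \<subseteq> (\<lambda>h. (P, h, Q)) ` hom C (fst P) (fst Q)"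
    using hom_GCoAlg coalgebra_hom_iff by blast
  ultimately show "small U (hom (GCoAlg C M) P Q)"
    by (rule small_subset[rotated])
qed

definition forget_edges :: "('i \<times> (('o \<times> ('t \<Rightarrow> 'a)) \<times> 'a \<times> ('o \<times> ('t \<Rightarrow> 'a))) \<times> 'i) set \<Rightarrow> ('i \<times> 'a \<times> 'i) set" where
  "forget_edges R = (\<lambda>(i, u, j). (i, fst (snd u), j)) ` R"

lemma forget_edges_iff: "(i, f, j) \<in> forget_edges R \<longleftrightarrow> (\<exists>u. (i, u, j) \<in> R \<and> f = fst (snd u))"
  unfolding forget_edges_def by force

lemma forget_edges_E:
  assumes R: "gdiagram (GCoAlg C M) I L R" and "(i, f, j) \<in> forget_edges R"
  shows "(i, (L i, f, L j), j) \<in> R \<and> i \<in> I \<and> j \<in> I \<and> is_gcoalgebra_hom C M (L i) (L j) f"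
proof -
  obtain u where u: "(i, u, j) \<in> R" "f = fst (snd u)"
    using assms(2) unfolding forget_edges_def by auto
  then show ?thesis
    using gdiagramD(2-4)[OF R u(1)] unfolding hom_GCoAlg by auto
qed

lemma diagram_coalgebra:
  assumes "gdiagram (GCoAlg C M) I L R" "i \<in> I"
  shows "is_gcoalgebra C M (fst (L i), snd (L i))"
  using gdiagramD(1)[OF assms] unfolding Obj_GCoAlg by simp

lemma gdiagram_forget:
  assumes R: "gdiagram (GCoAlg C M) I L R"
  shows "gdiagram C I (fst \<circ> L) (forget_edges R)"
proof (rule gdiagramI)
  show "(fst \<circ> L) i \<in> Obj C" if "i \<in> I" for i
    using coalgebraD(1)[OF diagram_coalgebra[OF R that]] by simp
  show "i \<in> I \<and> j \<in> I \<and> f \<in> hom C ((fst \<circ> L) i) ((fst \<circ> L) j)" if "(i, f, j) \<in> forget_edges R" for i f j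
    using forget_edges_E[OF R that] unfolding coalgebra_hom_iff by auto
qed

text \<open>The forgetful functor reflects colimits: a mediator in \<open>C\<close> between cocones
  of homomorphisms is itself a homomorphism, as the required equation can be tested on the jointly
  epic legs.\<close>

lemma gcolimit_GCoAlg:
  assumes R: "gdiagram (GCoAlg C M) I L R"
    and X: "gcolimit C I (fst \<circ> L) (forget_edges R) X c"
    and \<gamma>: "is_gcoalgebra C M (X, \<gamma>)"
    and c: "\<And>i. i \<in> I \<Longrightarrow> is_gcoalgebra_hom C M (L i) (X, \<gamma>) (c i)"
  shows "gcolimit (GCoAlg C M) I L R (X, \<gamma>) (\<lambda>i. (L i, c i, (X, \<gamma>)))"
proof -
  interpret Q: category "GCoAlg C M" by (rule category_GCoAlg)
  have L: "is_gcoalgebra C M (L i)" if "i \<in> I" for i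
    using diagram_coalgebra[OF R that] by simp
  show ?thesis
  proof (rule Q.gcolimitI)
    show "gcocone (GCoAlg C M) I L R (X, \<gamma>) (\<lambda>i. (L i, c i, (X, \<gamma>)))"
    proof (rule gcoconeI)
      show "(X, \<gamma>) \<in> Obj (GCoAlg C M)" using \<gamma> unfolding Obj_GCoAlg .
      show "(L i, c i, (X, \<gamma>)) \<in> hom (GCoAlg C M) (L i) (X, \<gamma>)" if "i \<in> I" for i
        using L[OF that] \<gamma> c[OF that] unfolding hom_GCoAlg by blast
      fix i u j assume ij: "(i, u, j) \<in> R"
      then have "(i, fst (snd u), j) \<in> forget_edges R"
        unfolding forget_edges_def by force
      moreover obtain f where "u = (L i, f, L j)"
        using gdiagramD(4)[OF R ij] unfolding hom_GCoAlg by blast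
      ultimately show "(L j, c j, (X, \<gamma>)) \<cdot>\<^bsub>GCoAlg C M\<^esub> u = (L i, c i, (X, \<gamma>))"
        using gcolimitD(3)[OF X] by (simp add: Comp_GCoAlg)
    qed
    fix P
    show "\<exists>h. h \<in> hom (GCoAlg C M) (X, \<gamma>) P \<and> (\<forall>i\<in>I. h \<cdot>\<^bsub>GCoAlg C M\<^esub> (L i, c i, (X, \<gamma>)) = d i)"
      if d: "gcocone (GCoAlg C M) I L R P d" for d
    proof -
      obtain Y \<delta> where P: "P = (Y, \<delta>)" by fastforce
      have \<delta>: "is_gcoalgebra C M (Y, \<delta>)" using gcoconeD(1)[OF d] unfolding Obj_GCoAlg P .
      define d' where "d' i = fst (snd (d i))" for i
      have di: "d i = (L i, d' i, (Y, \<delta>))" "is_gcoalgebra_hom C M (L i) (Y, \<delta>) (d' i)" if "i \<in> I" for i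
        using gcoconeD(2)[OF d that] unfolding hom_GCoAlg P d'_def by auto
      have d'_hom: "d' i \<in> hom C (fst (L i)) Y" "Fm t (d' i) \<cdot> snd (L i) t = \<delta> t \<cdot> d' i" if "i \<in> I" for i t
        using di(2)[OF that] unfolding coalgebra_hom_iff by auto
      have c_hom: "c i \<in> hom C (fst (L i)) X" "Fm t (c i) \<cdot> snd (L i) t = \<gamma> t \<cdot> c i" if "i \<in> I" for i t
        using c[OF that] unfolding coalgebra_hom_iff by auto
      have "gcocone C I (fst \<circ> L) (forget_edges R) Y d'"
      proof (rule gcoconeI)
        show "Y \<in> Obj C" using coalgebraD(1)[OF \<delta>] .
        show "d' i \<in> hom C ((fst \<circ> L) i) Y" if "i \<in> I" for i
          using d'_hom(1)[OF that] by simp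
        fix i f j assume "(i, f, j) \<in> forget_edges R"
        from forget_edges_E[OF R this] have ij: "(i, (L i, f, L j), j) \<in> R" "i \<in> I" "j \<in> I" by auto
        show "d' j \<cdot> f = d' i"
          using gcoconeD(3)[OF d ij(1)] di(1)[OF ij(2)] di(1)[OF ij(3)] by (simp add: Comp_GCoAlg)
      qed
      then obtain h where h: "h \<in> hom C X Y" "\<forall>i\<in>I. h \<cdot> c i = d' i"
        using gcolimit_mediator[OF X] by blast
      have "Fm t h \<cdot> \<gamma> t = \<delta> t \<cdot> h" for t
      proof (rule gcolimit_unique[OF X _ _ _ gdiagram_forget[OF R]])
        show "Fm t h \<cdot> \<gamma> t \<in> hom C X (F t Y)"
          using Comp_in[OF coalgebraD(2)[OF \<gamma>] Fm_hom[OF h(1)]] .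
        show "\<delta> t \<cdot> h \<in> hom C X (F t Y)"
          using Comp_in[OF h(1) coalgebraD(2)[OF \<delta>]] .
        fix i assume i: "i \<in> I"
        have "(Fm t h \<cdot> \<gamma> t) \<cdot> c i = Fm t h \<cdot> Fm t (c i) \<cdot> snd (L i) t"
          using Comp_assoc[OF c_hom(1)[OF i] coalgebraD(2)[OF \<gamma>] Fm_hom[OF h(1)]] c_hom(2)[OF i] by simp
        also have "\<dots> = (Fm t h \<cdot> Fm t (c i)) \<cdot> snd (L i) t"
          using Comp_assoc[OF coalgebraD(2)[OF diagram_coalgebra[OF R i]] Fm_hom[OF c_hom(1)[OF i]] Fm_hom[OF h(1)]]
          by simp
        also have "\<dots> = \<delta> t \<cdot> (h \<cdot> c i)"
          using Fm_Comp[OF c_hom(1)[OF i] h(1)] h(2) i d'_hom(2)[OF i] by simp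
        also have "\<dots> = (\<delta> t \<cdot> h) \<cdot> c i"
          using Comp_assoc[OF c_hom(1)[OF i] h(1) coalgebraD(2)[OF \<delta>]] by simp
        finally show "(Fm t h \<cdot> \<gamma> t) \<cdot> c i = (\<delta> t \<cdot> h) \<cdot> c i" .
      qed
      then have "((X, \<gamma>), h, P) \<in> hom (GCoAlg C M) (X, \<gamma>) P"
        using \<gamma> \<delta> h(1) unfolding hom_GCoAlg P is_gcoalgebra_hom_def by simp
      then show ?thesis
        using h(2) di(1) by (intro exI[of _ "((X, \<gamma>), h, P)"]) (auto simp: Comp_GCoAlg P)
    qed
    show "u = v" if uv: "u \<in> hom (GCoAlg C M) (X, \<gamma>) P" "v \<in> hom (GCoAlg C M) (X, \<gamma>) P"
      and eq: "\<And>i. i \<in> I \<Longrightarrow> u \<cdot>\<^bsub>GCoAlg C M\<^esub> (L i, c i, (X, \<gamma>)) = v \<cdot>\<^bsub>GCoAlg C M\<^esub> (L i, c i, (X, \<gamma>))" for u v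
    proof -
      obtain f g where fg: "u = ((X, \<gamma>), f, P)" "is_gcoalgebra_hom C M (X, \<gamma>) P f"
        "v = ((X, \<gamma>), g, P)" "is_gcoalgebra_hom C M (X, \<gamma>) P g"
        using uv unfolding hom_GCoAlg by blast
      have "f = g"
      proof (rule gcolimit_unique[OF X _ _ _ gdiagram_forget[OF R]])
        show "f \<in> hom C X (fst P)" "g \<in> hom C X (fst P)"
          using fg unfolding coalgebra_hom_iff by auto
        show "f \<cdot> c i = g \<cdot> c i" if "i \<in> I" for i
          using eq[OF that] fg by (simp add: Comp_GCoAlg)
      qed
      then show ?thesis using fg by simp
    qed
  qed
qed

text \<open>The composites \<open>Fm t (c i) \<cdot> snd (L i) t\<close> form a cocone on the
  underlying diagram, and its mediator is the coaction on the colimit. The coalgebra laws are again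
  tested on the legs.\<close>

lemma has_gcolimits_GCoAlg:
  assumes "has_gcolimits U C"
  shows "has_gcolimits U (GCoAlg C M)"
  unfolding has_gcolimits_def
proof (intro allI impI, elim conjE)
  fix I :: "'b set" and L R assume I: "small U I" and R: "gdiagram (GCoAlg C M) I L R"
  note R' = gdiagram_forget[OF R]
  obtain X c where X: "gcolimit C I (fst \<circ> L) (forget_edges R) X c"
    using assms I R' unfolding has_gcolimits_def by blast
  note L = diagram_coalgebra[OF R]
  have c: "c i \<in> hom C (fst (L i)) X" if "i \<in> I" for i
    using gcolimitD(2)[OF X that] by simp
  have XO: "X \<in> Obj C" using gcolimitD(1)[OF X] .
  have "\<exists>g\<in>hom C X (F t X). \<forall>i\<in>I. g \<cdot> c i = Fm t (c i) \<cdot> snd (L i) t" for t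
  proof (rule gcolimit_mediator[OF X], rule gcoconeI)
    show "F t X \<in> Obj C" using F_Obj[OF XO] .
    show "Fm t (c i) \<cdot> snd (L i) t \<in> hom C ((fst \<circ> L) i) (F t X)" if "i \<in> I" for i
      using Comp_in[OF coalgebraD(2)[OF L[OF that]] Fm_hom[OF c[OF that]]] by simp
    fix i f j assume ij: "(i, f, j) \<in> forget_edges R"
    then have i: "i \<in> I" and j: "j \<in> I" and f: "is_gcoalgebra_hom C M (fst (L i), snd (L i)) (fst (L j), snd (L j)) f"
      using forget_edges_E[OF R ij] by auto
    note f = coalgebra_homD[OF f]
    have "(Fm t (c j) \<cdot> snd (L j) t) \<cdot> f = Fm t (c j) \<cdot> (Fm t f \<cdot> snd (L i) t)"
      using Comp_assoc[OF f(1) coalgebraD(2)[OF L[OF j]] Fm_hom[OF c[OF j]]] f(2) by simp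
    also have "\<dots> = (Fm t (c j) \<cdot> Fm t f) \<cdot> snd (L i) t"
      using Comp_assoc[OF coalgebraD(2)[OF L[OF i]] Fm_hom[OF f(1)] Fm_hom[OF c[OF j]]] by simp
    also have "\<dots> = Fm t (c i) \<cdot> snd (L i) t"
      using Fm_Comp[OF f(1) c[OF j]] gcolimitD(3)[OF X ij] by simp
    finally show "(Fm t (c j) \<cdot> snd (L j) t) \<cdot> f = Fm t (c i) \<cdot> snd (L i) t" .
  qed
  then obtain \<gamma> where \<gamma>: "\<And>t. \<gamma> t \<in> hom C X (F t X)"
    and \<gamma>c: "\<And>t i. i \<in> I \<Longrightarrow> \<gamma> t \<cdot> c i = Fm t (c i) \<cdot> snd (L i) t"
    by metis
  have "\<gamma> 1 = gunit M X"
  proof (rule gcolimit_unique[OF X \<gamma> gunit_hom[OF XO] _ R'])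
    show "\<gamma> 1 \<cdot> c i = gunit M X \<cdot> c i" if "i \<in> I" for i
      using \<gamma>c[OF that] coalgebraD(3)[OF L[OF that]] gunit_Fm[OF c[OF that]] by simp
  qed
  moreover have "\<gamma> (s * t) = gmult M s t X \<cdot> Fm s (\<gamma> t) \<cdot> \<gamma> s" for s t
  proof (rule gcolimit_unique[OF X \<gamma> coaction_mult_hom[OF XO \<gamma>] _ R'])
    show "\<gamma> (s * t) \<cdot> c i = (gmult M s t X \<cdot> Fm s (\<gamma> t) \<cdot> \<gamma> s) \<cdot> c i" if i: "i \<in> I" for i
      using coaction_mult_natural[OF c[OF i] coalgebraD(2)[OF L[OF i]] \<gamma> \<gamma>c[OF i, symmetric]]
        \<gamma>c[OF i] coalgebraD(4)[OF L[OF i]] by simp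
  qed
  ultimately have "is_gcoalgebra C M (X, \<gamma>)"
    using XO \<gamma> unfolding is_gcoalgebra_def by simp
  moreover have "is_gcoalgebra_hom C M (L i) (X, \<gamma>) (c i)" if "i \<in> I" for i
    using c[OF that] \<gamma>c[OF that] unfolding coalgebra_hom_iff by simp
  ultimately show "\<exists>X c. gcolimit (GCoAlg C M) I L R X c"
    using gcolimit_GCoAlg[OF R X] by blast
qed

end


section \<open>Presentable objects\<close>

lemma is_functor_comp:
  assumes "is_functor A B D" "is_functor B E G"
  shows "is_functor A E (comp_functor G D)"
  unfolding is_functor_def
proof (intro conjI ballI)
  show "category A" "category E" using assms unfolding is_functor_def by auto
  have D_Obj: "Fobj D X \<in> Obj B" if "X \<in> Obj A" for X
    using assms(1) that unfolding is_functor_def by blast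
  have D_hom: "Farr D f \<in> hom B (Fobj D X) (Fobj D Y)" if "X \<in> Obj A" "Y \<in> Obj A" "f \<in> hom A X Y" for f X Y
    using assms(1) that unfolding is_functor_def by blast
  show "Fobj (comp_functor G D) X \<in> Obj E" if "X \<in> Obj A" for X
    using assms(2) D_Obj[OF that] unfolding is_functor_def comp_functor_def by simp
  show "Farr (comp_functor G D) f \<in> hom E (Fobj (comp_functor G D) X) (Fobj (comp_functor G D) Y)"
    if "X \<in> Obj A" "Y \<in> Obj A" "f \<in> hom A X Y" for X Y f
    using assms(2) D_Obj D_hom that unfolding is_functor_def comp_functor_def by simp
  show "Farr (comp_functor G D) (Idt A X) = Idt E (Fobj (comp_functor G D) X)" if "X \<in> Obj A" for X
    using assms D_Obj that unfolding is_functor_def comp_functor_def by simp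
  show "Farr (comp_functor G D) (g \<cdot>\<^bsub>A\<^esub> f) = Farr (comp_functor G D) g \<cdot>\<^bsub>E\<^esub> Farr (comp_functor G D) f"
    if XYZ: "X \<in> Obj A" "Y \<in> Obj A" "Z \<in> Obj A" and fg: "f \<in> hom A X Y" "g \<in> hom A Y Z" for X Y Z f g
  proof -
    have "Farr D (g \<cdot>\<^bsub>A\<^esub> f) = Farr D g \<cdot>\<^bsub>B\<^esub> Farr D f"
      using assms(1) XYZ fg unfolding is_functor_def by blast
    moreover have "Farr G (Farr D g \<cdot>\<^bsub>B\<^esub> Farr D f) = Farr G (Farr D g) \<cdot>\<^bsub>E\<^esub> Farr G (Farr D f)"
      using assms(2) D_Obj[OF XYZ(1)] D_Obj[OF XYZ(2)] D_Obj[OF XYZ(3)] D_hom[OF XYZ(1,2) fg(1)] D_hom[OF XYZ(2,3) fg(2)]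
      unfolding is_functor_def by blast
    ultimately show ?thesis unfolding comp_functor_def by simp
  qed
qed

lemma poset_functorD:
  assumes D: "is_functor (poset_category I r) C D" and ij: "(i, j) \<in> r"
  shows "i \<in> I" "j \<in> I" "Farr D (i, j) \<in> hom C (Fobj D i) (Fobj D j)"
    and "(j, k) \<in> r \<Longrightarrow> Farr D (i, k) = Farr D (j, k) \<cdot>\<^bsub>C\<^esub> Farr D (i, j)"
proof -
  let ?J = "poset_category I r"
  interpret J: category ?J using D unfolding is_functor_def by blast
  have hom: "(i, j) \<in> hom ?J i j" "i \<in> Obj ?J" "j \<in> Obj ?J" if "(i, j) \<in> r" for i j
    using that J.Dom_in[of "(i, j)"] J.Cod_in[of "(i, j)"] unfolding hom_def poset_category_def by auto
  show "i \<in> I" "j \<in> I" using hom[OF ij] unfolding poset_category_def by auto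
  show "Farr D (i, j) \<in> hom C (Fobj D i) (Fobj D j)"
    using D hom[OF ij] unfolding is_functor_def by blast
  assume jk: "(j, k) \<in> r"
  have "Farr D ((j, k) \<cdot>\<^bsub>?J\<^esub> (i, j)) = Farr D (j, k) \<cdot>\<^bsub>C\<^esub> Farr D (i, j)"
    using D hom[OF ij] hom[OF jk] unfolding is_functor_def by blast
  then show "Farr D (i, k) = Farr D (j, k) \<cdot>\<^bsub>C\<^esub> Farr D (i, j)"
    unfolding poset_category_def by simp
qed

lemma directed_poset_upper_bound:
  assumes "directed_poset U \<kappa> I r" "Cinfinite \<kappa>" "i \<in> I" "j \<in> I"
  obtains k where "k \<in> I" "(i, k) \<in> r" "(j, k) \<in> r"
proof -
  have "|{i, j}| <o \<kappa>"
    using assms(2) unfolding cinfinite_def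
    by (intro finite_ordLess_infinite card_of_Well_order) (auto simp: Field_card_of intro: card_order_on_well_order_on)
  then show thesis
    using assms that unfolding directed_poset_def by (metis empty_subsetI insert_subset insertCI)
qed

context category
begin

text \<open>That a presentable object preserves a colimit is only ever tested against maps into a
  two-element set, that is, against predicates.\<close>

lemma presentable_predicates:
  fixes U :: "'u rel"
  assumes U: "inaccessible U" and N: "presentable_object U \<kappa> C N"
    and I: "directed_poset U \<kappa> I r" and D: "is_functor (poset_category I r) C D"
    and X: "is_colimit (poset_category I r) C D X c"
  shows "(\<And>i j g. (i, j) \<in> r \<Longrightarrow> g \<in> hom C N (Fobj D i) \<Longrightarrow> Q j (Farr D (i, j) \<cdot> g) \<longleftrightarrow> Q i g) \<Longrightarrow>
      \<exists>q. \<forall>i\<in>I. \<forall>g\<in>hom C N (Fobj D i). q (c i \<cdot> g) \<longleftrightarrow> Q i g" (is "PROP ?compat \<Longrightarrow> _")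
    and "(\<And>i g. i \<in> I \<Longrightarrow> g \<in> hom C N (Fobj D i) \<Longrightarrow> p (c i \<cdot> g) \<longleftrightarrow> p' (c i \<cdot> g)) \<Longrightarrow>
      f \<in> hom C N X \<Longrightarrow> p f \<longleftrightarrow> p' f"
proof -
  interpret universe U by unfold_locales fact
  let ?J = "poset_category I r"
  let ?S = "set_category U :: (('a + 'u) set, ('a + 'u) set \<times> ('a + 'u \<Rightarrow> 'a + 'u) \<times> ('a + 'u) set) category"
  let ?H = "hom_functor C N :: ('o, 'a, ('a + 'u) set, ('a + 'u) set \<times> ('a + 'u \<Rightarrow> 'a + 'u) \<times> ('a + 'u) set) cat_functor"
  let ?A = "\<lambda>Y. Inl ` hom C N Y :: ('a + 'u) set"
  have HX: "is_colimit ?J ?S (comp_functor ?H D) (?A X) (\<lambda>i. Farr ?H (c i))"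
    using N I D X unfolding presentable_object_def preserves_directed_colimits_def
    by (simp add: hom_functor_def)
  have J: "Obj ?J = I" "Arr ?J = r" "Dom ?J = fst" "Cod ?J = snd"
    unfolding poset_category_def by simp_all
  have c: "c i \<in> hom C (Fobj D i) X" if "i \<in> I" for i
    using X that unfolding is_colimit_def cocone_def J by blast
  have Hc: "Farr ?H g = (?A Y, \<lambda>x\<in>?A Y. Inl (g \<cdot> projl x), ?A Z)" if "g \<in> hom C Y Z" for g Y Z
    using homD[OF that] unfolding hom_functor_def by simp
  have small_A: "small U (?A (Fobj D i))" if "i \<in> I" for i
  proof -
    \<comment> \<open>Smallness of the hom-sets is read off from the preserved cocone, which
      consists of arrows of \<open>set_category U\<close>.\<close>
    have "Farr ?H (c i) \<in> Arr ?S"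
      using HX that unfolding is_colimit_def cocone_def J hom_def by blast
    then show ?thesis
      unfolding Hc[OF c[OF that]] set_category_def by auto
  qed
  have small_AX: "small U (?A X)"
    using HX unfolding is_colimit_def cocone_def set_category_def by auto
  \<comment> \<open>Two points of the summand \<open>'u\<close> serve as truth values, so that the
    set of truth values is an object of \<open>set_category U\<close>.\<close>
  obtain u v where uv: "u \<in> Field U" "v \<in> Field U" "u \<noteq> v"
    using infinite_U by (metis finite.emptyI finite_insert insertI1 insert_iff subsetI finite_subset)
  define code :: "bool \<Rightarrow> 'a + 'u" where "code b = Inr (if b then u else v)" for b
  have code_eq: "code a = code b \<longleftrightarrow> a = b" for a b
    using uv(3) unfolding code_def by auto
  let ?B = "range code"
  have small_B: "small U ?B" by (rule small_finite) simp
  \<comment> \<open>These are characteristic functions; by \<open>chi_comp\<close>, composing one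
    with a leg restricts the predicate along that leg.\<close>
  define chi :: "('a + 'u) set \<Rightarrow> ('a \<Rightarrow> bool) \<Rightarrow> _" where
    "chi A q = (A, \<lambda>x\<in>A. code (q (projl x)), ?B)" for A q
  have chi: "chi A q \<in> hom ?S A ?B" if "small U A" for A q
    using that small_B unfolding chi_def hom_def set_category_def by auto
  have chi_comp: "chi (?A Z) q \<cdot>\<^bsub>?S\<^esub> Farr ?H g = chi (?A Y) (\<lambda>f. q (g \<cdot> f))" if g: "g \<in> hom C Y Z" for g Y Z q
  proof -
    have "compose (?A Y) (\<lambda>x\<in>?A Z. code (q (projl x))) (\<lambda>x\<in>?A Y. Inl (g \<cdot> projl x)) =
        (\<lambda>x\<in>?A Y. code (q (g \<cdot> projl x)))"
      unfolding compose_def using Comp_in[OF _ g] by (intro restrict_ext) auto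
    then show ?thesis unfolding Hc[OF g] chi_def set_category_def by simp
  qed
  have chi_eq: "chi A q = chi A q' \<longleftrightarrow> (\<forall>f. Inl f \<in> A \<longrightarrow> q f = q' f)" if "A \<subseteq> range Inl" for A q q'
  proof -
    have "chi A q = chi A q' \<longleftrightarrow> (\<forall>x\<in>A. code (q (projl x)) = code (q' (projl x)))"
      unfolding chi_def by (auto simp: restrict_def fun_eq_iff)
    then show ?thesis using that unfolding code_eq by force
  qed
  show "p f \<longleftrightarrow> p' f"
    if eq: "\<And>i g. i \<in> I \<Longrightarrow> g \<in> hom C N (Fobj D i) \<Longrightarrow> p (c i \<cdot> g) \<longleftrightarrow> p' (c i \<cdot> g)" and f: "f \<in> hom C N X"
  proof -
    define d where "d i = chi (?A (Fobj D i)) (\<lambda>f. p (c i \<cdot> f))" for i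
    have eq_d: "chi (?A X) p \<cdot>\<^bsub>?S\<^esub> Farr ?H (c i) = d i" "chi (?A X) p' \<cdot>\<^bsub>?S\<^esub> Farr ?H (c i) = d i" if "i \<in> I" for i
      unfolding d_def chi_comp[OF c[OF that]] using eq[OF that] by (subst chi_eq; auto)+
    have "cocone ?J ?S (comp_functor ?H D) ?B d"
      unfolding cocone_def J
    proof (intro conjI ballI)
      show "?B \<in> Obj ?S" using small_B unfolding set_category_def by simp
      show "d i \<in> hom ?S (Fobj (comp_functor ?H D) i) ?B" if "i \<in> I" for i
        using chi[OF small_A[OF that]] unfolding d_def
        by (simp add: comp_functor_def hom_functor_def)
      fix w assume w: "w \<in> r"
      obtain i j where ij: "w = (i, j)" by fastforce
      note D' = poset_functorD[OF D w[unfolded ij]]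
      have cD: "c j \<cdot> Farr D (i, j) = c i"
        using X w unfolding is_colimit_def cocone_def J ij by fastforce
      have "d j \<cdot>\<^bsub>?S\<^esub> Farr ?H (Farr D (i, j)) = chi (?A (Fobj D i)) (\<lambda>f. p (c j \<cdot> (Farr D (i, j) \<cdot> f)))"
        unfolding d_def chi_comp[OF D'(3)] ..
      also have "\<dots> = chi (?A (Fobj D i)) (\<lambda>f. p (c i \<cdot> f))"
        using Comp_assoc[OF _ D'(3) c[OF D'(2)]] cD by (subst chi_eq) auto
      finally show "d (snd w) \<cdot>\<^bsub>?S\<^esub> Farr (comp_functor ?H D) w = d (fst w)"
        unfolding d_def by (simp add: comp_functor_def ij)
    qed
    \<comment> \<open>The characteristic functions of \<open>p\<close> and \<open>p'\<close> mediate
      for the same cocone, so uniqueness makes them equal.\<close>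
    then have "\<exists>!h. h \<in> hom ?S (?A X) ?B \<and> (\<forall>i\<in>I. h \<cdot>\<^bsub>?S\<^esub> Farr ?H (c i) = d i)"
      using HX unfolding is_colimit_def J by blast
    then have "chi (?A X) p = chi (?A X) p'"
      using chi[OF small_AX] eq_d by blast
    then show ?thesis using f by (subst (asm) chi_eq) auto
  qed
  assume compat: "PROP ?compat"
  show "\<exists>q. \<forall>i\<in>I. \<forall>g\<in>hom C N (Fobj D i). q (c i \<cdot> g) \<longleftrightarrow> Q i g"
  proof -
    define d where "d i = chi (?A (Fobj D i)) (Q i)" for i
    have "cocone ?J ?S (comp_functor ?H D) ?B d"
      unfolding cocone_def J
    proof (intro conjI ballI)
      show "?B \<in> Obj ?S" using small_B unfolding set_category_def by simp
      show "d i \<in> hom ?S (Fobj (comp_functor ?H D) i) ?B" if "i \<in> I" for i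
        using chi[OF small_A[OF that]] unfolding d_def
        by (simp add: comp_functor_def hom_functor_def)
      fix w assume w: "w \<in> r"
      obtain i j where ij: "w = (i, j)" by fastforce
      note D' = poset_functorD[OF D w[unfolded ij]]
      have "d j \<cdot>\<^bsub>?S\<^esub> Farr ?H (Farr D (i, j)) = chi (?A (Fobj D i)) (\<lambda>f. Q j (Farr D (i, j) \<cdot> f))"
        unfolding d_def chi_comp[OF D'(3)] ..
      also have "\<dots> = chi (?A (Fobj D i)) (Q i)"
        using compat[OF w[unfolded ij]] by (subst chi_eq) auto
      finally show "d (snd w) \<cdot>\<^bsub>?S\<^esub> Farr (comp_functor ?H D) w = d (fst w)"
        unfolding d_def by (simp add: comp_functor_def ij)
    qed
    \<comment> \<open>A compatible family of predicates is a cocone; the predicate on arrows into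
      \<open>X\<close> is read off from its mediator.\<close>
    then obtain h where h: "h \<in> hom ?S (?A X) ?B" "\<forall>i\<in>I. h \<cdot>\<^bsub>?S\<^esub> Farr ?H (c i) = d i"
      using HX unfolding is_colimit_def J by blast
    define \<phi> where "\<phi> = fst (snd h)"
    have "\<phi> (Inl (c i \<cdot> g)) = code (Q i g)" if i: "i \<in> I" and g: "g \<in> hom C N (Fobj D i)" for i g
    proof -
      have "fst (snd (h \<cdot>\<^bsub>?S\<^esub> Farr ?H (c i))) (Inl g) = fst (snd (d i)) (Inl g)"
        using h(2) i by simp
      then show ?thesis
        using g unfolding \<phi>_def Hc[OF c[OF i]] d_def chi_def set_category_def by (simp add: compose_def)
    qed
    then show ?thesis
      by (intro exI[of _ "\<lambda>f. \<phi> (Inl f) = code True"]) (simp add: code_eq)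
  qed
qed

text \<open>The constantly true predicate and the predicate of factoring through some leg agree on
  all arrows \<open>c i \<cdot> g\<close>, hence on every arrow from \<open>N\<close> to the
  colimit.\<close>

lemma presentable_factor:
  assumes U: "inaccessible U" and N: "presentable_object U \<kappa> C N"
    and I: "directed_poset U \<kappa> I r" and D: "is_functor (poset_category I r) C D"
    and X: "is_colimit (poset_category I r) C D X c" and f: "f \<in> hom C N X"
  shows "\<exists>i\<in>I. \<exists>g\<in>hom C N (Fobj D i). c i \<cdot> g = f"
proof -
  have "True \<longleftrightarrow> (\<exists>i\<in>I. \<exists>g\<in>hom C N (Fobj D i). c i \<cdot> g = f)"
    by (rule presentable_predicates(2)[OF U N I D X _ f, where p = "\<lambda>_. True"]) blast
  then show ?thesis by simp
qed

text \<open>Becoming equal to \<open>f\<close> at some later stage is a predicate compatible with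
  the transition arrows, so it descends to the colimit. There \<open>f\<close> and \<open>g\<close>
  have the same image, and the predicate holds of \<open>f\<close>.\<close>

lemma presentable_merge:
  assumes U: "inaccessible U" and N: "presentable_object U \<kappa> C N" and \<kappa>: "Cinfinite \<kappa>"
    and I: "directed_poset U \<kappa> I r" and D: "is_functor (poset_category I r) C D"
    and X: "is_colimit (poset_category I r) C D X c"
    and i: "i \<in> I" and fg: "f \<in> hom C N (Fobj D i)" "g \<in> hom C N (Fobj D i)" "c i \<cdot> f = c i \<cdot> g"
  shows "\<exists>j. (i, j) \<in> r \<and> Farr D (i, j) \<cdot> f = Farr D (i, j) \<cdot> g"
proof -
  have r: "trans r" "\<And>j. j \<in> I \<Longrightarrow> (j, j) \<in> r"
    using I unfolding directed_poset_def partial_order_on_def preorder_on_def refl_on_def by auto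
  note PF = poset_functorD[OF D]
  have assoc: "Farr D (j, l) \<cdot> h = Farr D (k, l) \<cdot> (Farr D (j, k) \<cdot> h)"
    if "(j, k) \<in> r" "(k, l) \<in> r" "h \<in> hom C N (Fobj D j)" for j k l h
    using Comp_assoc[OF that(3) PF(3)[OF that(1)] PF(3)[OF that(2)]] PF(4)[OF that(1,2)] by simp
  define Q where "Q j h \<longleftrightarrow> (\<exists>k. (i, k) \<in> r \<and> (j, k) \<in> r \<and> Farr D (j, k) \<cdot> h = Farr D (i, k) \<cdot> f)" for j h
  have compat: "Q j' (Farr D (j, j') \<cdot> h) \<longleftrightarrow> Q j h" if jj': "(j, j') \<in> r" and h: "h \<in> hom C N (Fobj D j)" for j j' h
  proof
    assume "Q j' (Farr D (j, j') \<cdot> h)"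
    then show "Q j h" unfolding Q_def using assoc[OF jj' _ h] transD[OF r(1) jj'] by metis
  next
    assume "Q j h"
    then obtain k where k: "(i, k) \<in> r" "(j, k) \<in> r" "Farr D (j, k) \<cdot> h = Farr D (i, k) \<cdot> f"
      unfolding Q_def by blast
    obtain l where l: "(k, l) \<in> r" "(j', l) \<in> r"
      using directed_poset_upper_bound[OF I \<kappa> PF(2)[OF k(1)] PF(2)[OF jj']] by blast
    have "Farr D (j', l) \<cdot> (Farr D (j, j') \<cdot> h) = Farr D (i, l) \<cdot> f"
      using assoc[OF jj' l(2) h] assoc[OF k(2) l(1) h] assoc[OF k(1) l(1) fg(1)] k(3) by simp
    then show "Q j' (Farr D (j, j') \<cdot> h)"
      unfolding Q_def using l(2) transD[OF r(1) k(1) l(1)] by blast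
  qed
  obtain q where q: "\<forall>j\<in>I. \<forall>h\<in>hom C N (Fobj D j). q (c j \<cdot> h) \<longleftrightarrow> Q j h"
    using presentable_predicates(1)[OF U N I D X, of Q] compat by blast
  have "Q i f" unfolding Q_def using r(2)[OF i] by blast
  then have "Q i g" using q i fg by metis
  then show ?thesis unfolding Q_def by metis
qed

end


section \<open>Approximating a colimit by the colimits of bounded subdiagrams\<close>

definition subedges :: "('i \<times> 'a \<times> 'i) set \<Rightarrow> 'i set \<Rightarrow> ('i \<times> 'a \<times> 'i) set" where
  "subedges R S = {(i, f, j) \<in> R. i \<in> S \<and> j \<in> S}"

text \<open>The colimits \<open>K S\<close> are parameters so that an instance can draw all of them
  from one small set of objects.\<close>

locale bounded_subdiagrams = category C for C :: "('o, 'a) category" (structure) +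
  fixes V :: "'v set" and I :: "'i set" and L R X k K \<iota>
  assumes infinite_V: "infinite V"
    and R: "gdiagram C I L R"
    and X: "gcolimit C I L R X k"
    and K: "\<And>S. S \<subseteq> I \<Longrightarrow> |S| \<le>o |V| \<Longrightarrow> gcolimit C S L (subedges R S) (K S) (\<iota> S)"
begin

definition P :: "'i set set" where
  "P = {S. S \<subseteq> I \<and> |S| \<le>o |V|}"

lemma P_subset: "S \<in> P \<Longrightarrow> i \<in> S \<Longrightarrow> i \<in> I"
  unfolding P_def by blast

text \<open>An infinite cardinal absorbs its square. The directedness of \<open>P\<close> and all
  simultaneous enlargements below come from this closure property.\<close>

lemma P_UN: "|A| \<le>o |V| \<Longrightarrow> (\<And>a. a \<in> A \<Longrightarrow> B a \<in> P) \<Longrightarrow> (\<Union>a\<in>A. B a) \<in> P"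
  unfolding P_def using card_of_UNION_ordLeq_infinite[OF infinite_V, of A B] by blast

lemma finite_ordLeq_V: "finite A \<Longrightarrow> |A| \<le>o |V|"
  by (intro ordLess_imp_ordLeq finite_ordLess_infinite card_of_Well_order)
    (simp_all add: infinite_V Field_card_of)

lemma P_Un: "S \<in> P \<Longrightarrow> S' \<in> P \<Longrightarrow> S \<union> S' \<in> P"
  using P_UN[of "{S, S'}" id] finite_ordLeq_V[of "{S, S'}"] by auto

lemma P_singleton: "i \<in> I \<Longrightarrow> {i} \<in> P"
  unfolding P_def using finite_ordLeq_V[of "{i}"] by simp

lemma K_colimit: "S \<in> P \<Longrightarrow> gcolimit C S L (subedges R S) (K S) (\<iota> S)"
  using K unfolding P_def by blast

lemma subdiagram: "S \<subseteq> I \<Longrightarrow> gdiagram C S L (subedges R S)"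
  using R unfolding gdiagram_def subedges_def by blast

lemma \<iota>_hom: "S \<in> P \<Longrightarrow> i \<in> S \<Longrightarrow> \<iota> S i \<in> hom C (L i) (K S)"
  using gcolimitD(2)[OF K_colimit] .

lemma K_Obj: "S \<in> P \<Longrightarrow> K S \<in> Obj C"
  using gcolimitD(1)[OF K_colimit] .

lemma k_hom: "i \<in> I \<Longrightarrow> k i \<in> hom C (L i) X"
  using gcolimitD(2)[OF X] .

lemma X_Obj: "X \<in> Obj C"
  using gcolimitD(1)[OF X] .

lemma edge: "(i, f, j) \<in> R \<Longrightarrow> i \<in> I \<and> j \<in> I \<and> f \<in> hom C (L i) (L j)"
  using gdiagramD(2-4)[OF R] by blast

lemma \<iota>_edge: "S \<in> P \<Longrightarrow> (i, f, j) \<in> R \<Longrightarrow> i \<in> S \<Longrightarrow> j \<in> S \<Longrightarrow> \<iota> S j \<cdot> f = \<iota> S i"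
  using gcolimitD(3)[OF K_colimit] unfolding subedges_def by blast

lemma K_unique:
  assumes "S \<in> P" "h \<in> hom C (K S) Y" "h' \<in> hom C (K S) Y" "\<And>i. i \<in> S \<Longrightarrow> h \<cdot> \<iota> S i = h' \<cdot> \<iota> S i"
  shows "h = h'"
proof -
  have "S \<subseteq> I" using assms(1) unfolding P_def by blast
  from gcolimit_unique[OF K_colimit[OF assms(1)] assms(2-4) subdiagram[OF this]] show ?thesis .
qed

lemma K_mediator:
  assumes S: "S \<in> P" and Y: "Y \<in> Obj C" and d: "\<And>i. i \<in> S \<Longrightarrow> d i \<in> hom C (L i) Y"
    and edge: "\<And>i f j. (i, f, j) \<in> R \<Longrightarrow> i \<in> S \<Longrightarrow> j \<in> S \<Longrightarrow> d j \<cdot> f = d i"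
  shows "\<exists>h\<in>hom C (K S) Y. \<forall>i\<in>S. h \<cdot> \<iota> S i = d i"
proof (rule gcolimit_mediator[OF K_colimit[OF S]], rule gcoconeI)
  show "d j \<cdot> f = d i" if "(i, f, j) \<in> subedges R S" for i f j
    using edge that unfolding subedges_def by blast
qed (use Y d in blast)+

section \<open>Comparison arrows between the colimits of bounded subdiagrams\<close>

definition \<kappa> :: "'i set \<Rightarrow> 'i set \<Rightarrow> 'a" where
  "\<kappa> S S' = (SOME h. h \<in> hom C (K S) (K S') \<and> (\<forall>i\<in>S. h \<cdot> \<iota> S i = \<iota> S' i))"

definition \<pi> :: "'i set \<Rightarrow> 'a" where
  "\<pi> S = (SOME h. h \<in> hom C (K S) X \<and> (\<forall>i\<in>S. h \<cdot> \<iota> S i = k i))"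

lemma \<kappa>_spec:
  assumes "S \<in> P" "S' \<in> P" "S \<subseteq> S'"
  shows "\<kappa> S S' \<in> hom C (K S) (K S') \<and> (\<forall>i\<in>S. \<kappa> S S' \<cdot> \<iota> S i = \<iota> S' i)"
proof -
  have "\<exists>h\<in>hom C (K S) (K S'). \<forall>i\<in>S. h \<cdot> \<iota> S i = \<iota> S' i"
    by (rule K_mediator[OF assms(1) K_Obj[OF assms(2)]])
      (use assms \<iota>_hom[OF assms(2)] \<iota>_edge[OF assms(2)] in blast)+
  then show ?thesis
    unfolding \<kappa>_def Bex_def
    by (rule someI_ex[where P = "\<lambda>h. h \<in> hom C (K S) (K S') \<and> (\<forall>i\<in>S. h \<cdot> \<iota> S i = \<iota> S' i)"])
qed

lemmas \<kappa>_hom = \<kappa>_spec[THEN conjunct1]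
lemmas \<kappa>_\<iota> = \<kappa>_spec[THEN conjunct2, rule_format]

lemma \<pi>_spec:
  assumes "S \<in> P"
  shows "\<pi> S \<in> hom C (K S) X \<and> (\<forall>i\<in>S. \<pi> S \<cdot> \<iota> S i = k i)"
proof -
  have "\<exists>h\<in>hom C (K S) X. \<forall>i\<in>S. h \<cdot> \<iota> S i = k i"
    by (rule K_mediator[OF assms X_Obj]) (use k_hom P_subset[OF assms] gcolimitD(3)[OF X] in blast)+
  then show ?thesis
    unfolding \<pi>_def Bex_def
    by (rule someI_ex[where P = "\<lambda>h. h \<in> hom C (K S) X \<and> (\<forall>i\<in>S. h \<cdot> \<iota> S i = k i)"])
qed

lemmas \<pi>_hom = \<pi>_spec[THEN conjunct1]
lemmas \<pi>_\<iota> = \<pi>_spec[THEN conjunct2, rule_format]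

lemma \<kappa>_Comp:
  assumes "S \<in> P" "S' \<in> P" "S'' \<in> P" "S \<subseteq> S'" "S' \<subseteq> S''"
  shows "\<kappa> S' S'' \<cdot> \<kappa> S S' = \<kappa> S S''"
proof (rule K_unique[OF assms(1)])
  have SS: "S \<subseteq> S''" using assms by blast
  note h = \<kappa>_hom[OF assms(1,2,4)] \<kappa>_hom[OF assms(2,3,5)]
  show "\<kappa> S' S'' \<cdot> \<kappa> S S' \<in> hom C (K S) (K S'')" using Comp_in[OF h] .
  show "\<kappa> S S'' \<in> hom C (K S) (K S'')" using \<kappa>_hom[OF assms(1,3) SS] .
  fix i assume i: "i \<in> S"
  show "(\<kappa> S' S'' \<cdot> \<kappa> S S') \<cdot> \<iota> S i = \<kappa> S S'' \<cdot> \<iota> S i"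
    using Comp_assoc[OF \<iota>_hom[OF assms(1) i] h] \<kappa>_\<iota>[OF assms(1,2,4) i] \<kappa>_\<iota>[OF assms(2,3,5), of i]
      \<kappa>_\<iota>[OF assms(1,3) SS i] i assms(4) by auto
qed

lemma \<kappa>_refl:
  assumes "S \<in> P"
  shows "\<kappa> S S = Idt C (K S)"
proof (rule K_unique[OF assms])
  show "\<kappa> S S \<in> hom C (K S) (K S)" using \<kappa>_hom[OF assms assms] by simp
  show "Idt C (K S) \<in> hom C (K S) (K S)" using Idt_in[OF K_Obj[OF assms]] .
  show "\<kappa> S S \<cdot> \<iota> S i = Idt C (K S) \<cdot> \<iota> S i" if "i \<in> S" for i
    using \<kappa>_\<iota>[OF assms assms subset_refl that] Idt_Comp[OF \<iota>_hom[OF assms that]] by simp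
qed

lemma \<pi>_\<kappa>:
  assumes "S \<in> P" "S' \<in> P" "S \<subseteq> S'"
  shows "\<pi> S' \<cdot> \<kappa> S S' = \<pi> S"
proof (rule K_unique[OF assms(1)])
  note h = \<kappa>_hom[OF assms] \<pi>_hom[OF assms(2)]
  show "\<pi> S' \<cdot> \<kappa> S S' \<in> hom C (K S) X" using Comp_in[OF h] .
  show "\<pi> S \<in> hom C (K S) X" using \<pi>_hom[OF assms(1)] .
  show "(\<pi> S' \<cdot> \<kappa> S S') \<cdot> \<iota> S i = \<pi> S \<cdot> \<iota> S i" if i: "i \<in> S" for i
    using Comp_assoc[OF \<iota>_hom[OF assms(1) i] h] \<kappa>_\<iota>[OF assms i] \<pi>_\<iota>[OF assms(2), of i] \<pi>_\<iota>[OF assms(1) i] i assms(3)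
    by auto
qed

text \<open>A cocone on the \<open>K (\<sigma> p)\<close> restricts to the labels
  \<open>L i\<close>, independently of the chosen \<open>p\<close>, because by cofinality two
  indices lie below a third. The indexing \<open>\<sigma>\<close> allows \<open>W\<close> to be a
  set of names in \<open>'u\<close> as well as a family of subsets of \<open>I\<close>
  itself.\<close>

lemma cofinal_colimit:
  assumes W: "\<And>p. p \<in> W \<Longrightarrow> \<sigma> p \<in> P" and cofinal: "\<And>T. T \<in> P \<Longrightarrow> \<exists>p\<in>W. T \<subseteq> \<sigma> p"
  shows "gcolimit C W (\<lambda>p. K (\<sigma> p)) {(p, \<kappa> (\<sigma> p) (\<sigma> q), q) | p q. p \<in> W \<and> q \<in> W \<and> \<sigma> p \<subseteq> \<sigma> q} X (\<lambda>p. \<pi> (\<sigma> p))"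
    (is "gcolimit C W ?L ?E X ?c")
proof (rule gcolimitI)
  have cover: "\<exists>p\<in>W. i \<in> \<sigma> p" if "i \<in> I" for i
    using cofinal[OF P_singleton[OF that]] by blast
  show "gcocone C W ?L ?E X ?c"
    by (rule gcoconeI) (use X_Obj \<pi>_hom W \<pi>_\<kappa> in auto)
  fix Y
  show "\<exists>h. h \<in> hom C X Y \<and> (\<forall>p\<in>W. h \<cdot> \<pi> (\<sigma> p) = d p)" if d: "gcocone C W ?L ?E Y d" for d
  proof -
    have d_hom: "d p \<in> hom C (K (\<sigma> p)) Y" if "p \<in> W" for p
      using gcoconeD(2)[OF d that] .
    have indep1: "d p \<cdot> \<iota> (\<sigma> p) i = d q \<cdot> \<iota> (\<sigma> q) i" if pq: "p \<in> W" "q \<in> W" "\<sigma> p \<subseteq> \<sigma> q" "i \<in> \<sigma> p" for p q i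
    proof -
      have "(p, \<kappa> (\<sigma> p) (\<sigma> q), q) \<in> ?E" using pq by blast
      from gcoconeD(3)[OF d this] have "d p = d q \<cdot> \<kappa> (\<sigma> p) (\<sigma> q)" by simp
      then show ?thesis
        using Comp_assoc[OF \<iota>_hom[OF W[OF pq(1)] pq(4)] \<kappa>_hom[OF W[OF pq(1)] W[OF pq(2)] pq(3)] d_hom[OF pq(2)]]
          \<kappa>_\<iota>[OF W[OF pq(1)] W[OF pq(2)] pq(3,4)] by simp
    qed
    have indep: "d p \<cdot> \<iota> (\<sigma> p) i = d q \<cdot> \<iota> (\<sigma> q) i" if pq: "p \<in> W" "q \<in> W" "i \<in> \<sigma> p" "i \<in> \<sigma> q" for p q i
    proof -
      obtain w where "w \<in> W" "\<sigma> p \<subseteq> \<sigma> w" "\<sigma> q \<subseteq> \<sigma> w"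
        using cofinal[OF P_Un[OF W[OF pq(1)] W[OF pq(2)]]] by blast
      then show ?thesis using indep1[of p w i] indep1[of q w i] pq by simp
    qed
    obtain s where s: "\<And>i. i \<in> I \<Longrightarrow> s i \<in> W" "\<And>i. i \<in> I \<Longrightarrow> i \<in> \<sigma> (s i)"
      using cover by metis
    define e where "e i = d (s i) \<cdot> \<iota> (\<sigma> (s i)) i" for i
    have e: "e i = d p \<cdot> \<iota> (\<sigma> p) i" if "p \<in> W" "i \<in> \<sigma> p" for p i
      using indep s that P_subset[OF W[OF that(1)] that(2)] unfolding e_def by blast
    have "gcocone C I L R Y e"
    proof (rule gcoconeI)
      show "Y \<in> Obj C" using gcoconeD(1)[OF d] .
      show "e i \<in> hom C (L i) Y" if i: "i \<in> I" for i
        using Comp_in[OF \<iota>_hom[OF W[OF s(1)[OF i]] s(2)[OF i]] d_hom[OF s(1)[OF i]]] unfolding e_def .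
      fix i f j assume ij: "(i, f, j) \<in> R"
      note ijI = edge[OF ij]
      obtain p where p: "p \<in> W" "i \<in> \<sigma> p" "j \<in> \<sigma> p"
        using cofinal[OF P_Un[OF P_singleton P_singleton], of i j] ijI by blast
      show "e j \<cdot> f = e i"
        unfolding e[OF p(1,2)] e[OF p(1,3)]
        using Comp_assoc[OF ijI[THEN conjunct2, THEN conjunct2] \<iota>_hom[OF W[OF p(1)] p(3)] d_hom[OF p(1)]] \<iota>_edge[OF W[OF p(1)] ij p(2,3)]
        by simp
    qed
    then obtain h where h: "h \<in> hom C X Y" "\<forall>i\<in>I. h \<cdot> k i = e i"
      using gcolimit_mediator[OF X] by blast
    have "h \<cdot> \<pi> (\<sigma> p) = d p" if p: "p \<in> W" for p
    proof (rule K_unique[OF W[OF p] _ d_hom[OF p]])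
      show "h \<cdot> \<pi> (\<sigma> p) \<in> hom C (K (\<sigma> p)) Y" using Comp_in[OF \<pi>_hom[OF W[OF p]] h(1)] .
      show "(h \<cdot> \<pi> (\<sigma> p)) \<cdot> \<iota> (\<sigma> p) i = d p \<cdot> \<iota> (\<sigma> p) i" if i: "i \<in> \<sigma> p" for i
        using Comp_assoc[OF \<iota>_hom[OF W[OF p] i] \<pi>_hom[OF W[OF p]] h(1)] \<pi>_\<iota>[OF W[OF p] i]
          h(2) P_subset[OF W[OF p] i] e[OF p i] by simp
    qed
    then show ?thesis using h(1) by blast
  qed
  show "h = h'" if h: "h \<in> hom C X Y" "h' \<in> hom C X Y" "\<And>p. p \<in> W \<Longrightarrow> h \<cdot> \<pi> (\<sigma> p) = h' \<cdot> \<pi> (\<sigma> p)" for h h'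
  proof (rule gcolimit_unique[OF X h(1,2) _ R])
    fix i assume "i \<in> I"
    then obtain p where p: "p \<in> W" "i \<in> \<sigma> p" using cover by blast
    have "(h \<cdot> \<pi> (\<sigma> p)) \<cdot> \<iota> (\<sigma> p) i = (h' \<cdot> \<pi> (\<sigma> p)) \<cdot> \<iota> (\<sigma> p) i"
      using h(3)[OF p(1)] by simp
    then show "h \<cdot> k i = h' \<cdot> k i"
      using Comp_assoc[OF \<iota>_hom[OF W[OF p(1)] p(2)] \<pi>_hom[OF W[OF p(1)]] h(1)]
        Comp_assoc[OF \<iota>_hom[OF W[OF p(1)] p(2)] \<pi>_hom[OF W[OF p(1)]] h(2)]
        \<pi>_\<iota>[OF W[OF p(1)] p(2)] by simp
  qed
qed

text \<open>All \<open>b i j\<close> are added in countably many rounds, and the infinite set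
  \<open>V\<close> absorbs the countable union.\<close>

lemma closed_superset:
  assumes b: "\<And>i j. i \<in> I \<Longrightarrow> j \<in> I \<Longrightarrow> b i j \<in> P" and T: "T \<in> P"
  shows "\<exists>S\<in>P. T \<subseteq> S \<and> (\<forall>i\<in>S. \<forall>j\<in>S. b i j \<subseteq> S)"
proof -
  define step where "step A = A \<union> (\<Union>i\<in>A. \<Union>j\<in>A. b i j)" for A
  have step: "step A \<in> P" if A: "A \<in> P" for A
  proof -
    have "|A| \<le>o |V|" using A unfolding P_def by blast
    then have "(\<Union>i\<in>A. \<Union>j\<in>A. b i j) \<in> P"
      using b P_subset[OF A] by (intro P_UN) auto
    then show ?thesis unfolding step_def using P_Un[OF A] by blast
  qed
  have n: "(step ^^ n) T \<in> P" for n
    by (induction n) (use T step in auto)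
  have "|UNIV :: nat set| \<le>o |V|"
    using infinite_V infinite_iff_card_of_nat by blast
  then have "(\<Union>n. (step ^^ n) T) \<in> P"
    using n by (intro P_UN) auto
  moreover have "T \<subseteq> (\<Union>n. (step ^^ n) T)"
    using UN_upper[of 0 UNIV "\<lambda>n. (step ^^ n) T"] by simp
  moreover have "b i j \<subseteq> (\<Union>n. (step ^^ n) T)" if ij: "i \<in> (\<Union>n. (step ^^ n) T)" "j \<in> (\<Union>n. (step ^^ n) T)" for i j
  proof -
    have mono: "(step ^^ m) T \<subseteq> (step ^^ (m + n)) T" for m n
      by (induction n) (auto simp: step_def)
    obtain m n where "i \<in> (step ^^ m) T" "j \<in> (step ^^ n) T" using ij by blast
    \<comment> \<open>Elements of rounds \<open>m\<close> and \<open>n\<close> are both present in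
      round \<open>m + n\<close>, so \<open>b i j\<close> arrives one round later.\<close>
    then have "i \<in> (step ^^ (m + n)) T" "j \<in> (step ^^ (m + n)) T"
      using mono[of m n] mono[of n m] by (auto simp: add.commute)
    then have "b i j \<subseteq> (step ^^ Suc (m + n)) T"
      by (auto simp: step_def)
    then show ?thesis by blast
  qed
  ultimately show ?thesis by (intro bexI[of _ "\<Union>n. (step ^^ n) T"]) auto
qed

text \<open>Directed posets have to live on \<open>'u\<close>, whereas \<open>P\<close> consists of
  sets; \<open>W\<close> is a set of names for its members.\<close>

lemma encode_P:
  fixes U :: "'u rel"
  assumes U: "inaccessible U" and I: "small U I"
  obtains W :: "'u set" and \<sigma> where "\<sigma> ` W = P" "inj_on \<sigma> W" "small U W"
proof -
  interpret universe U by unfold_locales fact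
  have P: "small U P"
    by (rule small_subset[OF _ small_Pow[OF I]]) (auto simp: P_def)
  obtain e where "inj_on e P" "e ` P \<subseteq> Field U"
    using small_embedding[OF P] .
  then show thesis
    using that[of "inv_into P e" "e ` P"] small_image[OF P, of e] by (simp add: inj_on_inv_into)
qed

text \<open>Upper bounds are unions. One poset thus serves every accessibility index bounded by
  \<open>|V|\<close>.\<close>

lemma directed_poset_P:
  assumes \<sigma>: "\<sigma> ` W = P" "inj_on \<sigma> W" "small U W" and \<mu>: "\<mu> \<le>o |V|"
  shows "directed_poset U \<mu> W {(p, q). p \<in> W \<and> q \<in> W \<and> \<sigma> p \<subseteq> \<sigma> q}"
  unfolding directed_poset_def
proof (intro conjI allI impI)
  show "small U W" by fact
  show "partial_order_on W {(p, q). p \<in> W \<and> q \<in> W \<and> \<sigma> p \<subseteq> \<sigma> q}"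
    using \<sigma>(2) unfolding partial_order_on_def preorder_on_def refl_on_def trans_def antisym_def inj_on_def
    by auto
  fix S assume S: "S \<subseteq> W" "|S| <o \<mu>"
  have "(\<Union>p\<in>S. \<sigma> p) \<in> P"
    by (rule P_UN) (use S \<sigma>(1) ordLess_ordLeq_trans[OF S(2) \<mu>] ordLess_imp_ordLeq in blast)+
  then obtain b where "b \<in> W" "\<sigma> b = (\<Union>p\<in>S. \<sigma> p)" using \<sigma>(1) by (metis imageE)
  then show "\<exists>b\<in>W. \<forall>a\<in>S. (a, b) \<in> {(p, q). p \<in> W \<and> q \<in> W \<and> \<sigma> p \<subseteq> \<sigma> q}"
    using S(1) by (intro bexI[of _ b]) auto
qed

section \<open>Arrows from presentable objects factor through bounded stages\<close>

context
  fixes U :: "'u rel" and \<mu> \<nu> G N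
  assumes U: "inaccessible U" and I: "small U I"
    and G: "is_functor C C G" "preserves_directed_colimits U \<mu> C C G" "\<mu> \<le>o |V|"
    and N: "presentable_object U \<nu> C N" "Cinfinite \<nu>" "\<nu> \<le>o |V|"
begin

text \<open>\<open>G\<close> preserves the colimit of the \<open>K S\<close> because the poset of
  names is directed for the index \<open>\<mu>\<close> of \<open>G\<close>. The index
  \<open>\<nu>\<close> of \<open>N\<close> enters only afterwards, when arrows from \<open>N\<close>
  into the resulting colimit \<open>Fobj G X\<close> are factored and merged.\<close>

lemma encoded_diagram:
  fixes W :: "'u set"
  assumes \<sigma>: "\<sigma> ` W = P" "inj_on \<sigma> W" "small U W"
  defines "r \<equiv> {(p, q). p \<in> W \<and> q \<in> W \<and> \<sigma> p \<subseteq> \<sigma> q}"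
    and "D \<equiv> \<lparr>Fobj = (\<lambda>p. K (\<sigma> p)), Farr = (\<lambda>u. \<kappa> (\<sigma> (fst u)) (\<sigma> (snd u)))\<rparr>"
  shows "is_functor (poset_category W r) C (comp_functor G D)"
    and "is_colimit (poset_category W r) C (comp_functor G D) (Fobj G X) (\<lambda>p. Farr G (\<pi> (\<sigma> p)))"
proof -
  have W: "\<sigma> p \<in> P" if "p \<in> W" for p using that \<sigma>(1) by blast
  have cofinal: "\<exists>p\<in>W. T \<subseteq> \<sigma> p" if "T \<in> P" for T
    using that unfolding \<sigma>(1)[symmetric] by blast
  let ?J = "poset_category W r"
  have hom: "u \<in> hom ?J p q \<longleftrightarrow> u = (p, q) \<and> p \<in> W \<and> q \<in> W \<and> \<sigma> p \<subseteq> \<sigma> q" for u p q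
    unfolding hom_def poset_category_def r_def by auto
  have J: "category ?J"
    by unfold_locales (auto simp: hom, auto simp: poset_category_def r_def)
  have D: "is_functor ?J C D"
    unfolding is_functor_def
  proof (intro conjI ballI J)
    show "category C" by unfold_locales
    show "Fobj D p \<in> Obj C" if "p \<in> Obj ?J" for p
      using K_Obj[OF W] that unfolding D_def poset_category_def by simp
    show "Farr D u \<in> hom C (Fobj D p) (Fobj D q)" if "u \<in> hom ?J p q" for u p q
      using \<kappa>_hom W that unfolding D_def hom by auto
    show "Farr D (Idt ?J p) = Idt C (Fobj D p)" if "p \<in> Obj ?J" for p
      using \<kappa>_refl[OF W] that unfolding D_def poset_category_def by simp
    show "Farr D (v \<cdot>\<^bsub>?J\<^esub> u) = Farr D v \<cdot> Farr D u" if "u \<in> hom ?J p q" "v \<in> hom ?J q s" for u v p q s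
      using \<kappa>_Comp W that unfolding D_def hom by (auto simp: poset_category_def)
  qed
  show "is_functor ?J C (comp_functor G D)"
    using is_functor_comp[OF D G(1)] .
  have E: "(\<lambda>u. (Dom ?J u, Farr D u, Cod ?J u)) ` Arr ?J = {(p, \<kappa> (\<sigma> p) (\<sigma> q), q) | p q. p \<in> W \<and> q \<in> W \<and> \<sigma> p \<subseteq> \<sigma> q}"
    unfolding poset_category_def D_def r_def by force
  have "gcolimit C W (\<lambda>p. K (\<sigma> p)) {(p, \<kappa> (\<sigma> p) (\<sigma> q), q) | p q. p \<in> W \<and> q \<in> W \<and> \<sigma> p \<subseteq> \<sigma> q} X (\<lambda>p. \<pi> (\<sigma> p))"
    by (rule cofinal_colimit[OF W cofinal])
  then have "is_colimit ?J C D X (\<lambda>p. \<pi> (\<sigma> p))"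
    unfolding is_colimit_iff_gcolimit E by (simp add: D_def poset_category_def)
  then show "is_colimit ?J C (comp_functor G D) (Fobj G X) (\<lambda>p. Farr G (\<pi> (\<sigma> p)))"
    using G(2)[unfolded preserves_directed_colimits_def, rule_format, of W r D X "\<lambda>p. \<pi> (\<sigma> p)"]
      D directed_poset_P[OF \<sigma> G(3)] unfolding r_def by simp
qed

lemma factor_through_P:
  assumes "f \<in> hom C N (Fobj G X)"
  shows "\<exists>S\<in>P. \<exists>g\<in>hom C N (Fobj G (K S)). Farr G (\<pi> S) \<cdot> g = f"
proof -
  obtain W :: "'u set" and \<sigma> where \<sigma>: "\<sigma> ` W = P" "inj_on \<sigma> W" "small U W"
    using encode_P[OF U I] .
  show ?thesis
    using presentable_factor[OF U N(1) directed_poset_P[OF \<sigma> N(3)] encoded_diagram[OF \<sigma>] assms] \<sigma>(1)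
    by (auto simp: comp_functor_def)
qed

lemma merge_in_P:
  assumes S: "S \<in> P" and fg: "f \<in> hom C N (Fobj G (K S))" "g \<in> hom C N (Fobj G (K S))"
    "Farr G (\<pi> S) \<cdot> f = Farr G (\<pi> S) \<cdot> g"
  shows "\<exists>S'\<in>P. S \<subseteq> S' \<and> Farr G (\<kappa> S S') \<cdot> f = Farr G (\<kappa> S S') \<cdot> g"
proof -
  obtain W :: "'u set" and \<sigma> where \<sigma>: "\<sigma> ` W = P" "inj_on \<sigma> W" "small U W"
    using encode_P[OF U I] .
  obtain p where p: "p \<in> W" "\<sigma> p = S" using S unfolding \<sigma>(1)[symmetric] by blast
  show ?thesis
    using presentable_merge[OF U N(1,2) directed_poset_P[OF \<sigma> N(3)] encoded_diagram[OF \<sigma>] p(1), of f g] fg \<sigma>(1)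
    by (auto simp: comp_functor_def p(2))
qed

end

end


section \<open>Approximating a coalgebra by bounded coalgebras\<close>

text \<open>\<open>factor\<close> and \<open>merge\<close> are what is retained of presentability
  and accessibility. \<open>R_unique\<close>, which holds for diagrams on posets, leaves one edge at
  most for each ordered pair of vertices, so one family of equations to be merged.\<close>

locale coalgebra_approximation =
  bounded_subdiagrams C V I L R X k K \<iota> + graded_monad C M
  for C :: "('o, 'a) category" (structure) and V :: "'v set" and I :: "'i set" and L R X k K \<iota>
    and M :: "('t::monoid_mult, 'o, 'a) graded_monad" +
  fixes \<gamma> :: "'t \<Rightarrow> 'a"
  assumes coalgebra: "is_gcoalgebra C M (X, \<gamma>)"
    and T_ordLeq_V: "|UNIV :: 't set| \<le>o |V|"
    and R_unique: "(i, f, j) \<in> R \<Longrightarrow> (i, f', j) \<in> R \<Longrightarrow> f = f'"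
    and factor: "i \<in> I \<Longrightarrow> f \<in> hom C (L i) (F t X) \<Longrightarrow>
      \<exists>S\<in>P. \<exists>g\<in>hom C (L i) (F t (K S)). Fm t (\<pi> S) \<cdot> g = f"
    and merge: "i \<in> I \<Longrightarrow> S \<in> P \<Longrightarrow> f \<in> hom C (L i) (F t (K S)) \<Longrightarrow> g \<in> hom C (L i) (F t (K S)) \<Longrightarrow>
      Fm t (\<pi> S) \<cdot> f = Fm t (\<pi> S) \<cdot> g \<Longrightarrow>
      \<exists>S'\<in>P. S \<subseteq> S' \<and> Fm t (\<kappa> S S') \<cdot> f = Fm t (\<kappa> S S') \<cdot> g"
begin

lemma \<gamma>_hom: "\<gamma> t \<in> hom C X (F t X)"
  using coalgebraD(2)[OF coalgebra] .

lemma Fm_\<kappa>_\<kappa>: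
  assumes S: "S \<in> P" "S' \<in> P" "S'' \<in> P" "S \<subseteq> S'" "S' \<subseteq> S''" and f: "f \<in> hom C N (F t (K S))"
  shows "Fm t (\<kappa> S' S'') \<cdot> (Fm t (\<kappa> S S') \<cdot> f) = Fm t (\<kappa> S S'') \<cdot> f"
proof -
  note h = \<kappa>_hom[OF S(1,2,4)] \<kappa>_hom[OF S(2,3,5)]
  show ?thesis
    using Comp_assoc[OF f Fm_hom[OF h(1)] Fm_hom[OF h(2)]] Fm_Comp[OF h] \<kappa>_Comp[OF S] by simp
qed

lemma Fm_\<pi>_\<kappa>:
  assumes S: "S \<in> P" "S' \<in> P" "S \<subseteq> S'" and f: "f \<in> hom C N (F t (K S))"
  shows "Fm t (\<pi> S') \<cdot> (Fm t (\<kappa> S S') \<cdot> f) = Fm t (\<pi> S) \<cdot> f"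
proof -
  note h = \<kappa>_hom[OF S] \<pi>_hom[OF S(2)]
  show ?thesis
    using Comp_assoc[OF f Fm_hom[OF h(1)] Fm_hom[OF h(2)]] Fm_Comp[OF h] \<pi>_\<kappa>[OF S] by simp
qed

lemma Fm_\<kappa>_hom:
  assumes S: "S \<in> P" "S' \<in> P" "S \<subseteq> S'" and f: "f \<in> hom C N (F t (K S))"
  shows "Fm t (\<kappa> S S') \<cdot> f \<in> hom C N (F t (K S'))"
  using Comp_in[OF f Fm_hom[OF \<kappa>_hom[OF S]]] .

text \<open>The stages at which the single pairs merge are united, and equations persist under
  enlargement by functoriality. Later \<open>A\<close> is the set of grades, the set of pairs of
  grades, or a single point.\<close>

lemma merge_all:
  assumes i: "i \<in> I" and S: "S \<in> P" and A: "|A| \<le>o |V|"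
    and fg: "\<And>x. x \<in> A \<Longrightarrow> f x \<in> hom C (L i) (F (t x) (K S))" "\<And>x. x \<in> A \<Longrightarrow> g x \<in> hom C (L i) (F (t x) (K S))"
    and eq: "\<And>x. x \<in> A \<Longrightarrow> Fm (t x) (\<pi> S) \<cdot> f x = Fm (t x) (\<pi> S) \<cdot> g x"
  shows "\<exists>S'\<in>P. S \<subseteq> S' \<and> (\<forall>x\<in>A. Fm (t x) (\<kappa> S S') \<cdot> f x = Fm (t x) (\<kappa> S S') \<cdot> g x)"
proof -
  have "\<forall>x\<in>A. \<exists>S'. S' \<in> P \<and> S \<subseteq> S' \<and> Fm (t x) (\<kappa> S S') \<cdot> f x = Fm (t x) (\<kappa> S S') \<cdot> g x"
    using merge[OF i S fg eq] by blast
  then obtain s where s: "\<forall>x\<in>A. s x \<in> P \<and> S \<subseteq> s x \<and> Fm (t x) (\<kappa> S (s x)) \<cdot> f x = Fm (t x) (\<kappa> S (s x)) \<cdot> g x"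
    by (rule bchoice[THEN exE])
  define S' where "S' = S \<union> (\<Union>x\<in>A. s x)"
  have S': "S' \<in> P" unfolding S'_def using s by (intro P_Un[OF S] P_UN[OF A]) blast
  have "Fm (t x) (\<kappa> S S') \<cdot> f x = Fm (t x) (\<kappa> S S') \<cdot> g x" if x: "x \<in> A" for x
  proof -
    have sx: "s x \<in> P" "S \<subseteq> s x" "s x \<subseteq> S'" using s x unfolding S'_def by auto
    show ?thesis
      using Fm_\<kappa>_\<kappa>[OF S sx(1) S' sx(2,3) fg(1)[OF x]] Fm_\<kappa>_\<kappa>[OF S sx(1) S' sx(2,3) fg(2)[OF x]] s x by simp
  qed
  then show ?thesis using S' unfolding S'_def by blast
qed

text \<open>Each grade has its own stage; their union is still bounded because there are at most
  \<open>|V|\<close> grades.\<close>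

lemma factor_coaction:
  assumes i: "i \<in> I"
  shows "\<exists>S c. S \<in> P \<and> (\<forall>t. c t \<in> hom C (L i) (F t (K S)) \<and> Fm t (\<pi> S) \<cdot> c t = \<gamma> t \<cdot> k i)"
proof -
  have "\<forall>t. \<exists>S g. S \<in> P \<and> g \<in> hom C (L i) (F t (K S)) \<and> Fm t (\<pi> S) \<cdot> g = \<gamma> t \<cdot> k i"
    using factor[OF i Comp_in[OF k_hom[OF i] \<gamma>_hom]] by blast
  then obtain s g where s: "\<And>t. s t \<in> P" and g: "\<And>t. g t \<in> hom C (L i) (F t (K (s t)))"
    and eq: "\<And>t. Fm t (\<pi> (s t)) \<cdot> g t = \<gamma> t \<cdot> k i"
    by metis
  define S where "S = (\<Union>t. s t)"
  have S: "S \<in> P" unfolding S_def by (rule P_UN[OF T_ordLeq_V s])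
  have sS: "s t \<subseteq> S" for t unfolding S_def by blast
  have "Fm t (\<kappa> (s t) S) \<cdot> g t \<in> hom C (L i) (F t (K S))"
    "Fm t (\<pi> S) \<cdot> (Fm t (\<kappa> (s t) S) \<cdot> g t) = \<gamma> t \<cdot> k i" for t
    using Fm_\<kappa>_hom[OF s S sS g] Fm_\<pi>_\<kappa>[OF s S sS g] eq by auto
  then show ?thesis
    by (intro exI[of _ S] exI[of _ "\<lambda>t. Fm t (\<kappa> (s t) S) \<cdot> g t"] conjI S allI)
qed

text \<open>Along an edge \<open>f\<close>, both \<open>ci t\<close> and
  \<open>cj t \<cdot> f\<close> become \<open>\<gamma> t \<cdot> k i\<close> over \<open>X\<close>,
  so a common enlargement identifies them, for all grades at once.\<close>

lemma merge_edge:
  assumes i: "i \<in> I" and j: "j \<in> I" and S: "Si \<in> P" "Sj \<in> P"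
    and ci: "\<And>t. ci t \<in> hom C (L i) (F t (K Si))" "\<And>t. Fm t (\<pi> Si) \<cdot> ci t = \<gamma> t \<cdot> k i"
    and cj: "\<And>t. cj t \<in> hom C (L j) (F t (K Sj))" "\<And>t. Fm t (\<pi> Sj) \<cdot> cj t = \<gamma> t \<cdot> k j"
  shows "\<exists>S\<in>P. Si \<subseteq> S \<and> Sj \<subseteq> S \<and>
    (\<forall>f t. (i, f, j) \<in> R \<longrightarrow> Fm t (\<kappa> Si S) \<cdot> ci t = Fm t (\<kappa> Sj S) \<cdot> (cj t \<cdot> f))"
proof (cases "\<exists>f. (i, f, j) \<in> R")
  \<comment> \<open>Without an edge, only the inclusions of \<open>Si\<close> and \<open>Sj\<close>
    have to be met.\<close>
  case False
  then show ?thesis using P_Un[OF S] by blast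
next
  case True
  then obtain f where f: "(i, f, j) \<in> R" by blast
  have f_hom: "f \<in> hom C (L i) (L j)" using edge[OF f] by blast
  define S0 where "S0 = Si \<union> Sj"
  have S0: "S0 \<in> P" "Si \<subseteq> S0" "Sj \<subseteq> S0" unfolding S0_def using P_Un[OF S] by auto
  have cjf: "cj t \<cdot> f \<in> hom C (L i) (F t (K Sj))" for t using Comp_in[OF f_hom cj(1)] .
  have "\<exists>S\<in>P. S0 \<subseteq> S \<and> (\<forall>t\<in>UNIV. Fm t (\<kappa> S0 S) \<cdot> (Fm t (\<kappa> Si S0) \<cdot> ci t) =
      Fm t (\<kappa> S0 S) \<cdot> (Fm t (\<kappa> Sj S0) \<cdot> (cj t \<cdot> f)))"
  proof (rule merge_all[OF i S0(1) T_ordLeq_V])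
    fix t
    show "Fm t (\<kappa> Si S0) \<cdot> ci t \<in> hom C (L i) (F t (K S0))"
      using Fm_\<kappa>_hom[OF S(1) S0(1,2) ci(1)] .
    show "Fm t (\<kappa> Sj S0) \<cdot> (cj t \<cdot> f) \<in> hom C (L i) (F t (K S0))"
      using Fm_\<kappa>_hom[OF S(2) S0(1,3) cjf] .
    have "Fm t (\<pi> Sj) \<cdot> (cj t \<cdot> f) = (\<gamma> t \<cdot> k j) \<cdot> f"
      using Comp_assoc[OF f_hom cj(1) Fm_hom[OF \<pi>_hom[OF S(2)]]] cj(2) by simp
    also have "\<dots> = \<gamma> t \<cdot> k i"
      using Comp_assoc[OF f_hom k_hom[OF j] \<gamma>_hom] gcolimitD(3)[OF X f] by simp
    finally show "Fm t (\<pi> S0) \<cdot> (Fm t (\<kappa> Si S0) \<cdot> ci t) = Fm t (\<pi> S0) \<cdot> (Fm t (\<kappa> Sj S0) \<cdot> (cj t \<cdot> f))"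
      using Fm_\<pi>_\<kappa>[OF S(1) S0(1,2) ci(1)] Fm_\<pi>_\<kappa>[OF S(2) S0(1,3) cjf] ci(2) by simp
  qed
  then obtain S where S': "S \<in> P" "S0 \<subseteq> S" and
    eq: "\<And>t. Fm t (\<kappa> S0 S) \<cdot> (Fm t (\<kappa> Si S0) \<cdot> ci t) = Fm t (\<kappa> S0 S) \<cdot> (Fm t (\<kappa> Sj S0) \<cdot> (cj t \<cdot> f))"
    by blast
  have "Fm t (\<kappa> Si S) \<cdot> ci t = Fm t (\<kappa> Sj S) \<cdot> (cj t \<cdot> f)" for t
    using eq[of t] Fm_\<kappa>_\<kappa>[OF S(1) S0(1) S'(1) S0(2) S'(2) ci(1)] Fm_\<kappa>_\<kappa>[OF S(2) S0(1) S'(1) S0(3) S'(2) cjf] by simp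
  then have "\<forall>f' t. (i, f', j) \<in> R \<longrightarrow> Fm t (\<kappa> Si S) \<cdot> ci t = Fm t (\<kappa> Sj S) \<cdot> (cj t \<cdot> f')"
    using R_unique[OF f] by blast
  then show ?thesis using S' S0 by (intro bexI[of _ S]) auto
qed

text \<open>\<open>a i\<close> is a stage where the coaction on \<open>L i\<close> factors,
  \<open>c i\<close> are the factorisations, and at \<open>b i j\<close> they fit together along the
  edge. They are fixed before closed sets are introduced, so that the coactions on different closed
  sets stem from the same data and are compatible.\<close>

lemma coaction_data:
  obtains a c b where
    "\<And>i. i \<in> I \<Longrightarrow> a i \<in> P"
    "\<And>i t. i \<in> I \<Longrightarrow> c i t \<in> hom C (L i) (F t (K (a i)))"
    "\<And>i t. i \<in> I \<Longrightarrow> Fm t (\<pi> (a i)) \<cdot> c i t = \<gamma> t \<cdot> k i"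
    "\<And>i j. i \<in> I \<Longrightarrow> j \<in> I \<Longrightarrow> b i j \<in> P"
    "\<And>i j. i \<in> I \<Longrightarrow> j \<in> I \<Longrightarrow> a i \<subseteq> b i j \<and> a j \<subseteq> b i j"
    "\<And>i f j t. (i, f, j) \<in> R \<Longrightarrow> Fm t (\<kappa> (a i) (b i j)) \<cdot> c i t = Fm t (\<kappa> (a j) (b i j)) \<cdot> (c j t \<cdot> f)"
proof -
  have "\<forall>i\<in>I. \<exists>p. fst p \<in> P \<and> (\<forall>t. snd p t \<in> hom C (L i) (F t (K (fst p))) \<and> Fm t (\<pi> (fst p)) \<cdot> snd p t = \<gamma> t \<cdot> k i)"
    using factor_coaction by simp
  then obtain p where p: "\<forall>i\<in>I. fst (p i) \<in> P \<and>
      (\<forall>t. snd (p i) t \<in> hom C (L i) (F t (K (fst (p i)))) \<and> Fm t (\<pi> (fst (p i))) \<cdot> snd (p i) t = \<gamma> t \<cdot> k i)"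
    by (rule bchoice[THEN exE])
  define a where "a i = fst (p i)" for i
  define c where "c i = snd (p i)" for i
  have a: "a i \<in> P" if "i \<in> I" for i using p that unfolding a_def by blast
  have c: "c i t \<in> hom C (L i) (F t (K (a i)))" "Fm t (\<pi> (a i)) \<cdot> c i t = \<gamma> t \<cdot> k i" if "i \<in> I" for i t
    using p that unfolding a_def c_def by auto
  define good where "good i j S \<longleftrightarrow> S \<in> P \<and> a i \<subseteq> S \<and> a j \<subseteq> S \<and>
    (\<forall>f t. (i, f, j) \<in> R \<longrightarrow> Fm t (\<kappa> (a i) S) \<cdot> c i t = Fm t (\<kappa> (a j) S) \<cdot> (c j t \<cdot> f))" for i j S
  define b where "b i j = (SOME S. good i j S)" for i j
  have b: "good i j (b i j)" if "i \<in> I" "j \<in> I" for i j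
  proof -
    have "\<exists>S. good i j S"
      using merge_edge[OF that a[OF that(1)] a[OF that(2)] c[OF that(1)] c[OF that(2)]] unfolding good_def by blast
    then show ?thesis unfolding b_def by (rule someI_ex)
  qed
  show thesis
  proof (rule that[OF a c])
    show "b i j \<in> P" "a i \<subseteq> b i j \<and> a j \<subseteq> b i j" if "i \<in> I" "j \<in> I" for i j
      using b[OF that] unfolding good_def by auto
    show "Fm t (\<kappa> (a i) (b i j)) \<cdot> c i t = Fm t (\<kappa> (a j) (b i j)) \<cdot> (c j t \<cdot> f)" if "(i, f, j) \<in> R" for i f j t
      using b[of i j] edge[OF that] that unfolding good_def by blast
  qed
qed

section \<open>Coactions on closed subdiagrams\<close>

context
  fixes a c b
  assumes a: "\<And>i. i \<in> I \<Longrightarrow> a i \<in> P"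
    and c: "\<And>i t. i \<in> I \<Longrightarrow> c i t \<in> hom C (L i) (F t (K (a i)))"
    and c_\<gamma>: "\<And>i t. i \<in> I \<Longrightarrow> Fm t (\<pi> (a i)) \<cdot> c i t = \<gamma> t \<cdot> k i"
    and b: "\<And>i j. i \<in> I \<Longrightarrow> j \<in> I \<Longrightarrow> b i j \<in> P"
    and ab: "\<And>i j. i \<in> I \<Longrightarrow> j \<in> I \<Longrightarrow> a i \<subseteq> b i j \<and> a j \<subseteq> b i j"
    and c_edge: "\<And>i f j t. (i, f, j) \<in> R \<Longrightarrow> Fm t (\<kappa> (a i) (b i j)) \<cdot> c i t = Fm t (\<kappa> (a j) (b i j)) \<cdot> (c j t \<cdot> f)"
begin

definition closed :: "'i set \<Rightarrow> bool" where
  "closed S \<longleftrightarrow> S \<in> P \<and> (\<forall>i\<in>S. \<forall>j\<in>S. b i j \<subseteq> S)"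

definition \<delta> :: "'i set \<Rightarrow> 't \<Rightarrow> 'a" where
  "\<delta> S t = (SOME h. h \<in> hom C (K S) (F t (K S)) \<and> (\<forall>i\<in>S. h \<cdot> \<iota> S i = Fm t (\<kappa> (a i) S) \<cdot> c i t))"

lemma closed_P: "closed S \<Longrightarrow> S \<in> P"
  unfolding closed_def by blast

lemma closed_a:
  assumes "closed S" "i \<in> S"
  shows "i \<in> I" "a i \<in> P" "a i \<subseteq> S"
proof -
  show i: "i \<in> I" using P_subset[OF closed_P[OF assms(1)] assms(2)] .
  show "a i \<in> P" using a[OF i] .
  \<comment> \<open>The diagonal instance is what brings \<open>a i\<close> into a closed
    set.\<close>
  have "b i i \<subseteq> S" using assms unfolding closed_def by blast
  then show "a i \<subseteq> S" using ab[OF i i] by blast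
qed

text \<open>The factorisations, pushed forward from \<open>a i\<close> to \<open>S\<close>, form a
  cocone: along an edge from \<open>i\<close> to \<open>j\<close> they already agree at
  \<open>b i j\<close>, which lies inside \<open>S\<close> by closedness.\<close>

lemma \<delta>_spec:
  assumes S: "closed S"
  shows "\<delta> S t \<in> hom C (K S) (F t (K S)) \<and> (\<forall>i\<in>S. \<delta> S t \<cdot> \<iota> S i = Fm t (\<kappa> (a i) S) \<cdot> c i t)"
proof -
  note SP = closed_P[OF S]
  have "\<exists>h\<in>hom C (K S) (F t (K S)). \<forall>i\<in>S. h \<cdot> \<iota> S i = Fm t (\<kappa> (a i) S) \<cdot> c i t"
  proof (rule K_mediator[OF SP])
    show "F t (K S) \<in> Obj C" using F_Obj[OF K_Obj[OF SP]] .
    show "Fm t (\<kappa> (a i) S) \<cdot> c i t \<in> hom C (L i) (F t (K S))" if "i \<in> S" for i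
      using Fm_\<kappa>_hom[OF closed_a(2)[OF S that] SP closed_a(3)[OF S that] c[OF closed_a(1)[OF S that]]] .
    fix i f j assume ij: "(i, f, j) \<in> R" "i \<in> S" "j \<in> S"
    note ai = closed_a[OF S ij(2)] and aj = closed_a[OF S ij(3)]
    have f: "f \<in> hom C (L i) (L j)" using edge[OF ij(1)] by blast
    have bij: "b i j \<in> P" "b i j \<subseteq> S" using b[OF ai(1) aj(1)] S ij unfolding closed_def by auto
    have cjf: "c j t \<cdot> f \<in> hom C (L i) (F t (K (a j)))" using Comp_in[OF f c[OF aj(1)]] .
    have abs: "a i \<subseteq> b i j" "a j \<subseteq> b i j" using ab[OF ai(1) aj(1)] by auto
    have "Fm t (\<kappa> (a j) S) \<cdot> (c j t \<cdot> f) = Fm t (\<kappa> (a i) S) \<cdot> c i t"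
      using Fm_\<kappa>_\<kappa>[OF ai(2) bij(1) SP abs(1) bij(2) c[OF ai(1)]]
        Fm_\<kappa>_\<kappa>[OF aj(2) bij(1) SP abs(2) bij(2) cjf] c_edge[OF ij(1)] by simp
    then show "(Fm t (\<kappa> (a j) S) \<cdot> c j t) \<cdot> f = Fm t (\<kappa> (a i) S) \<cdot> c i t"
      using Comp_assoc[OF f c[OF aj(1)] Fm_hom[OF \<kappa>_hom[OF aj(2) SP aj(3)]]] by simp
  qed
  then show ?thesis
    unfolding \<delta>_def Bex_def
    by (rule someI_ex[where P = "\<lambda>h. h \<in> hom C (K S) (F t (K S)) \<and> (\<forall>i\<in>S. h \<cdot> \<iota> S i = Fm t (\<kappa> (a i) S) \<cdot> c i t)"])
qed

lemmas \<delta>_hom = \<delta>_spec[THEN conjunct1]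
lemmas \<delta>_\<iota> = \<delta>_spec[THEN conjunct2, rule_format]

text \<open>On the leg at \<open>i\<close>, both sides are the same \<open>c i t\<close> pushed
  forward to \<open>S'\<close>.\<close>

lemma \<kappa>_\<delta>:
  assumes S: "closed S" "closed S'" "S \<subseteq> S'"
  shows "Fm t (\<kappa> S S') \<cdot> \<delta> S t = \<delta> S' t \<cdot> \<kappa> S S'"
proof -
  note P = closed_P[OF S(1)] closed_P[OF S(2)]
  note \<kappa> = \<kappa>_hom[OF P S(3)]
  show ?thesis
  proof (rule K_unique[OF P(1)])
    show "Fm t (\<kappa> S S') \<cdot> \<delta> S t \<in> hom C (K S) (F t (K S'))"
      using Comp_in[OF \<delta>_hom[OF S(1)] Fm_hom[OF \<kappa>]] .
    show "\<delta> S' t \<cdot> \<kappa> S S' \<in> hom C (K S) (F t (K S'))"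
      using Comp_in[OF \<kappa> \<delta>_hom[OF S(2)]] .
    fix i assume i: "i \<in> S"
    note ai = closed_a[OF S(1) i]
    have i': "i \<in> S'" using i S(3) by blast
    have "(Fm t (\<kappa> S S') \<cdot> \<delta> S t) \<cdot> \<iota> S i = Fm t (\<kappa> (a i) S') \<cdot> c i t"
      using Comp_assoc[OF \<iota>_hom[OF P(1) i] \<delta>_hom[OF S(1)] Fm_hom[OF \<kappa>]] \<delta>_\<iota>[OF S(1) i]
        Fm_\<kappa>_\<kappa>[OF ai(2) P ai(3) S(3) c[OF ai(1)]] by simp
    also have "\<dots> = (\<delta> S' t \<cdot> \<kappa> S S') \<cdot> \<iota> S i"
      using Comp_assoc[OF \<iota>_hom[OF P(1) i] \<kappa> \<delta>_hom[OF S(2)]] \<kappa>_\<iota>[OF P S(3) i] \<delta>_\<iota>[OF S(2) i'] by simp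
    finally show "(Fm t (\<kappa> S S') \<cdot> \<delta> S t) \<cdot> \<iota> S i = (\<delta> S' t \<cdot> \<kappa> S S') \<cdot> \<iota> S i" .
  qed
qed

lemma \<pi>_\<delta>:
  assumes S: "closed S"
  shows "Fm t (\<pi> S) \<cdot> \<delta> S t = \<gamma> t \<cdot> \<pi> S"
proof -
  note P = closed_P[OF S]
  note \<pi> = \<pi>_hom[OF P]
  show ?thesis
  proof (rule K_unique[OF P])
    show "Fm t (\<pi> S) \<cdot> \<delta> S t \<in> hom C (K S) (F t X)"
      using Comp_in[OF \<delta>_hom[OF S] Fm_hom[OF \<pi>]] .
    show "\<gamma> t \<cdot> \<pi> S \<in> hom C (K S) (F t X)"
      using Comp_in[OF \<pi> \<gamma>_hom] .
    fix i assume i: "i \<in> S"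
    note ai = closed_a[OF S i]
    have "(Fm t (\<pi> S) \<cdot> \<delta> S t) \<cdot> \<iota> S i = \<gamma> t \<cdot> k i"
      using Comp_assoc[OF \<iota>_hom[OF P i] \<delta>_hom[OF S] Fm_hom[OF \<pi>]] \<delta>_\<iota>[OF S i]
        Fm_\<pi>_\<kappa>[OF ai(2) P ai(3) c[OF ai(1)]] c_\<gamma>[OF ai(1)] by simp
    also have "\<dots> = (\<gamma> t \<cdot> \<pi> S) \<cdot> \<iota> S i"
      using Comp_assoc[OF \<iota>_hom[OF P i] \<pi> \<gamma>_hom] \<pi>_\<iota>[OF P i] by simp
    finally show "(Fm t (\<pi> S) \<cdot> \<delta> S t) \<cdot> \<iota> S i = (\<gamma> t \<cdot> \<pi> S) \<cdot> \<iota> S i" .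
  qed
qed

text \<open>The family \<open>e\<close> makes room for closure conditions that are found only after
  the coactions have been built.\<close>

lemma closed_cofinal:
  assumes e: "\<And>i. i \<in> I \<Longrightarrow> e i \<in> P" and T: "T \<in> P"
  shows "\<exists>S. closed S \<and> T \<subseteq> S \<and> (\<forall>i\<in>S. e i \<subseteq> S)"
proof -
  have "b i j \<union> e i \<in> P" if "i \<in> I" "j \<in> I" for i j
    using P_Un[OF b[OF that] e[OF that(1)]] .
  then obtain S where "S \<in> P" "T \<subseteq> S" "\<forall>i\<in>S. \<forall>j\<in>S. b i j \<union> e i \<subseteq> S"
    using closed_superset[OF _ T, of "\<lambda>i j. b i j \<union> e i"] by blast
  then show ?thesis
    unfolding closed_def by (intro exI[of _ S]) auto
qed

text \<open>For \<open>i \<in> I\<close> the two sides of the equations, restricted to \<open>L i\<close>, are merged between one closed set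
  containing \<open>i\<close> and some \<open>e i\<close>; naturality carries this over to every closed set including \<open>e i\<close>.\<close>

lemma equations_on_closed:
  assumes A: "|A| \<le>o |V|"
    and pq: "\<And>x S. x \<in> A \<Longrightarrow> closed S \<Longrightarrow> p x S \<in> hom C (K S) (F (t x) (K S))"
      "\<And>x S. x \<in> A \<Longrightarrow> closed S \<Longrightarrow> q x S \<in> hom C (K S) (F (t x) (K S))"
    and p_\<kappa>: "\<And>x S S'. x \<in> A \<Longrightarrow> closed S \<Longrightarrow> closed S' \<Longrightarrow> S \<subseteq> S' \<Longrightarrow> Fm (t x) (\<kappa> S S') \<cdot> p x S = p x S' \<cdot> \<kappa> S S'"
    and q_\<kappa>: "\<And>x S S'. x \<in> A \<Longrightarrow> closed S \<Longrightarrow> closed S' \<Longrightarrow> S \<subseteq> S' \<Longrightarrow> Fm (t x) (\<kappa> S S') \<cdot> q x S = q x S' \<cdot> \<kappa> S S'"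
    and eq: "\<And>x S. x \<in> A \<Longrightarrow> closed S \<Longrightarrow> Fm (t x) (\<pi> S) \<cdot> p x S = Fm (t x) (\<pi> S) \<cdot> q x S"
  shows "\<exists>e. (\<forall>i\<in>I. e i \<in> P) \<and> (\<forall>S x. closed S \<longrightarrow> (\<forall>i\<in>S. e i \<subseteq> S) \<longrightarrow> x \<in> A \<longrightarrow> p x S = q x S)"
proof -
  have "\<exists>E\<in>P. \<forall>S x. closed S \<longrightarrow> i \<in> S \<longrightarrow> E \<subseteq> S \<longrightarrow> x \<in> A \<longrightarrow> p x S \<cdot> \<iota> S i = q x S \<cdot> \<iota> S i" if i: "i \<in> I" for i
  proof -
    \<comment> \<open>The instance \<open>a\<close> asks nothing new of closed sets, which contain
      every \<open>a i\<close> already; the point is to have one closed set around \<open>i\<close>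
      on which both sides are defined.\<close>
    obtain S0 where S0: "closed S0" "{i} \<subseteq> S0"
      using closed_cofinal[of a, OF a P_singleton[OF i]] by blast
    note P0 = closed_P[OF S0(1)]
    have i0: "i \<in> S0" using S0 by blast
    note \<iota>0 = \<iota>_hom[OF P0 i0] and \<pi>0 = \<pi>_hom[OF P0]
    have "\<exists>E\<in>P. S0 \<subseteq> E \<and> (\<forall>x\<in>A. Fm (t x) (\<kappa> S0 E) \<cdot> (p x S0 \<cdot> \<iota> S0 i) = Fm (t x) (\<kappa> S0 E) \<cdot> (q x S0 \<cdot> \<iota> S0 i))"
    proof (rule merge_all[OF i P0 A])
      fix x assume x: "x \<in> A"
      note p0 = pq(1)[OF x S0(1)] and q0 = pq(2)[OF x S0(1)]
      show "p x S0 \<cdot> \<iota> S0 i \<in> hom C (L i) (F (t x) (K S0))" using Comp_in[OF \<iota>0 p0] .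
      show "q x S0 \<cdot> \<iota> S0 i \<in> hom C (L i) (F (t x) (K S0))" using Comp_in[OF \<iota>0 q0] .
      show "Fm (t x) (\<pi> S0) \<cdot> (p x S0 \<cdot> \<iota> S0 i) = Fm (t x) (\<pi> S0) \<cdot> (q x S0 \<cdot> \<iota> S0 i)"
        using Comp_assoc[OF \<iota>0 p0 Fm_hom[OF \<pi>0]] Comp_assoc[OF \<iota>0 q0 Fm_hom[OF \<pi>0]] eq[OF x S0(1)] by simp
    qed
    then obtain E where E: "E \<in> P" "S0 \<subseteq> E"
      and E_eq: "\<And>x. x \<in> A \<Longrightarrow> Fm (t x) (\<kappa> S0 E) \<cdot> (p x S0 \<cdot> \<iota> S0 i) = Fm (t x) (\<kappa> S0 E) \<cdot> (q x S0 \<cdot> \<iota> S0 i)"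
      by blast
    have "p x S \<cdot> \<iota> S i = q x S \<cdot> \<iota> S i" if S: "closed S" "E \<subseteq> S" and x: "x \<in> A" for S x
    proof -
      note P = closed_P[OF S(1)]
      have S0S: "S0 \<subseteq> S" using E(2) S(2) by blast
      note \<kappa>0 = \<kappa>_hom[OF P0 P S0S]
      \<comment> \<open>Naturality rewrites either side on \<open>L i\<close> as its value on
        \<open>S0\<close> pushed forward through \<open>E\<close>, where the two sides have been
        merged.\<close>
      have *: "r S \<cdot> \<iota> S i = Fm (t x) (\<kappa> E S) \<cdot> (Fm (t x) (\<kappa> S0 E) \<cdot> (r S0 \<cdot> \<iota> S0 i))"
        if r: "\<And>S. closed S \<Longrightarrow> r S \<in> hom C (K S) (F (t x) (K S))"
          and r_\<kappa>: "Fm (t x) (\<kappa> S0 S) \<cdot> r S0 = r S \<cdot> \<kappa> S0 S" for r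
      proof -
        have "r S \<cdot> \<iota> S i = (r S \<cdot> \<kappa> S0 S) \<cdot> \<iota> S0 i"
          using Comp_assoc[OF \<iota>0 \<kappa>0 r[OF S(1)]] \<kappa>_\<iota>[OF P0 P S0S i0] by simp
        also have "\<dots> = Fm (t x) (\<kappa> S0 S) \<cdot> (r S0 \<cdot> \<iota> S0 i)"
          using Comp_assoc[OF \<iota>0 r[OF S0(1)] Fm_hom[OF \<kappa>0]] r_\<kappa> by simp
        also have "\<dots> = Fm (t x) (\<kappa> E S) \<cdot> (Fm (t x) (\<kappa> S0 E) \<cdot> (r S0 \<cdot> \<iota> S0 i))"
          using Fm_\<kappa>_\<kappa>[OF P0 E(1) P E(2) S(2) Comp_in[OF \<iota>0 r[OF S0(1)]]] by simp
        finally show ?thesis .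
      qed
      show ?thesis
        using *[OF pq(1)[OF x] p_\<kappa>[OF x S0(1) S(1) S0S]] *[OF pq(2)[OF x] q_\<kappa>[OF x S0(1) S(1) S0S]] E_eq[OF x]
        by simp
    qed
    then show ?thesis using E(1) by blast
  qed
  then have "\<forall>i\<in>I. \<exists>E. E \<in> P \<and> (\<forall>S x. closed S \<longrightarrow> i \<in> S \<longrightarrow> E \<subseteq> S \<longrightarrow> x \<in> A \<longrightarrow> p x S \<cdot> \<iota> S i = q x S \<cdot> \<iota> S i)"
    by blast
  then obtain e where e: "\<forall>i\<in>I. e i \<in> P \<and>
      (\<forall>S x. closed S \<longrightarrow> i \<in> S \<longrightarrow> e i \<subseteq> S \<longrightarrow> x \<in> A \<longrightarrow> p x S \<cdot> \<iota> S i = q x S \<cdot> \<iota> S i)"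
    by (rule bchoice[THEN exE])
  have "p x S = q x S" if S: "closed S" "\<forall>i\<in>S. e i \<subseteq> S" and x: "x \<in> A" for S x
  proof (rule K_unique[OF closed_P[OF S(1)] pq(1)[OF x S(1)] pq(2)[OF x S(1)]])
    fix i assume "i \<in> S"
    then show "p x S \<cdot> \<iota> S i = q x S \<cdot> \<iota> S i"
      using e S x closed_a(1)[OF S(1)] by blast
  qed
  then show ?thesis using e by (intro exI[of _ e]) blast
qed

text \<open>After composition with \<open>Fm t (\<pi> S)\<close> the laws follow from those of
  \<open>\<gamma>\<close>, as \<open>\<pi> S\<close> is compatible with the coactions; that arrow
  need not be monic, so the two sides have to be merged. The multiplication law is one equation per
  pair of grades, hence the bound \<open>TT\<close>; the unit law is a single equation.\<close>

lemma coalgebra_closed: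
  "\<exists>e. (\<forall>i\<in>I. e i \<in> P) \<and> (\<forall>S. closed S \<longrightarrow> (\<forall>i\<in>S. e i \<subseteq> S) \<longrightarrow> is_gcoalgebra C M (K S, \<delta> S))"
proof -
  have TT: "|UNIV :: ('t \<times> 't) set| \<le>o |V|"
    unfolding UNIV_Times_UNIV[symmetric]
    by (rule card_of_Times_ordLeq_infinite_Field[OF _ T_ordLeq_V T_ordLeq_V card_of_Card_order])
      (simp add: Field_card_of infinite_V)
  define m where "m x S = gmult M (fst x) (snd x) (K S) \<cdot> Fm (fst x) (\<delta> S (snd x)) \<cdot> \<delta> S (fst x)" for x :: "'t \<times> 't" and S
  have m_hom: "m x S \<in> hom C (K S) (F (fst x * snd x) (K S))" if "closed S" for x S
    unfolding m_def using coaction_mult_hom[OF K_Obj[OF closed_P[OF that]] \<delta>_hom[OF that]] .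
  have m_\<kappa>: "Fm (fst x * snd x) (\<kappa> S S') \<cdot> m x S = m x S' \<cdot> \<kappa> S S'" if S: "closed S" "closed S'" "S \<subseteq> S'" for x S S'
    unfolding m_def
    by (rule coaction_mult_natural[symmetric, OF \<kappa>_hom[OF closed_P[OF S(1)] closed_P[OF S(2)] S(3)]
          \<delta>_hom[OF S(1)] \<delta>_hom[OF S(2)] \<kappa>_\<delta>[OF S]])
  have m_\<pi>: "Fm (fst x * snd x) (\<pi> S) \<cdot> \<delta> S (fst x * snd x) = Fm (fst x * snd x) (\<pi> S) \<cdot> m x S" if S: "closed S" for x S
    using coaction_mult_natural[OF \<pi>_hom[OF closed_P[OF S]] \<delta>_hom[OF S] \<gamma>_hom \<pi>_\<delta>[OF S]]
      \<pi>_\<delta>[OF S] coalgebraD(4)[OF coalgebra] unfolding m_def by simp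
  have "\<exists>e. (\<forall>i\<in>I. e i \<in> P) \<and>
      (\<forall>S x. closed S \<longrightarrow> (\<forall>i\<in>S. e i \<subseteq> S) \<longrightarrow> x \<in> UNIV \<longrightarrow> \<delta> S (fst x * snd x) = m x S)"
    by (rule equations_on_closed[OF TT, of "\<lambda>x S. \<delta> S (fst x * snd x)" "\<lambda>x. fst x * snd x" m])
      (rule \<delta>_hom m_hom \<kappa>_\<delta> m_\<kappa> m_\<pi>; assumption)+
  then obtain e1 where e1: "(\<forall>i\<in>I. e1 i \<in> P) \<and>
      (\<forall>S x. closed S \<longrightarrow> (\<forall>i\<in>S. e1 i \<subseteq> S) \<longrightarrow> x \<in> UNIV \<longrightarrow> \<delta> S (fst x * snd x) = m x S)"
    by (rule exE)
  then have e1P: "e1 i \<in> P" if "i \<in> I" for i using that by simp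
  have e1_eq: "\<delta> S (fst x * snd x) = m x S" if "closed S" "\<forall>i\<in>S. e1 i \<subseteq> S" for S x
    using e1 that by simp
  have unit: "|{()}| \<le>o |V|" by (rule finite_ordLeq_V) simp
  have u_hom: "gunit M (K S) \<in> hom C (K S) (F 1 (K S))" if "closed S" for S
    using gunit_hom[OF K_Obj[OF closed_P[OF that]]] .
  have u_\<kappa>: "Fm 1 (\<kappa> S S') \<cdot> gunit M (K S) = gunit M (K S') \<cdot> \<kappa> S S'" if S: "closed S" "closed S'" "S \<subseteq> S'" for S S'
    using gunit_Fm[OF \<kappa>_hom[OF closed_P[OF S(1)] closed_P[OF S(2)] S(3)]] by simp
  have u_\<pi>: "Fm 1 (\<pi> S) \<cdot> \<delta> S 1 = Fm 1 (\<pi> S) \<cdot> gunit M (K S)" if S: "closed S" for S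
    using \<pi>_\<delta>[OF S, of 1] coalgebraD(3)[OF coalgebra] gunit_Fm[OF \<pi>_hom[OF closed_P[OF S]]] by simp
  have "\<exists>e. (\<forall>i\<in>I. e i \<in> P) \<and>
      (\<forall>S x. closed S \<longrightarrow> (\<forall>i\<in>S. e i \<subseteq> S) \<longrightarrow> x \<in> {()} \<longrightarrow> \<delta> S 1 = gunit M (K S))"
    by (rule equations_on_closed[OF unit, of "\<lambda>x S. \<delta> S 1" "\<lambda>x. 1" "\<lambda>x S. gunit M (K S)"])
      (rule \<delta>_hom u_hom \<kappa>_\<delta> u_\<kappa> u_\<pi>; assumption)+
  then obtain e2 where e2: "(\<forall>i\<in>I. e2 i \<in> P) \<and>
      (\<forall>S (x :: unit). closed S \<longrightarrow> (\<forall>i\<in>S. e2 i \<subseteq> S) \<longrightarrow> x \<in> {()} \<longrightarrow> \<delta> S 1 = gunit M (K S))"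
    by (rule exE)
  then have e2P: "e2 i \<in> P" if "i \<in> I" for i using that by simp
  have e2_eq: "\<delta> S 1 = gunit M (K S)" if "closed S" "\<forall>i\<in>S. e2 i \<subseteq> S" for S
    using e2 that by simp
  show ?thesis
  proof (intro exI[of _ "\<lambda>i. e1 i \<union> e2 i"] conjI ballI allI impI)
    show "e1 i \<union> e2 i \<in> P" if "i \<in> I" for i using P_Un[OF e1P[OF that] e2P[OF that]] .
    fix S assume S: "closed S" "\<forall>i\<in>S. e1 i \<union> e2 i \<subseteq> S"
    have "\<delta> S (s * t) = gmult M s t (K S) \<cdot> Fm s (\<delta> S t) \<cdot> \<delta> S s" for s t
      using e1_eq[OF S(1), of "(s, t)"] S(2) unfolding m_def by simp
    moreover have "\<delta> S 1 = gunit M (K S)"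
      using e2_eq[OF S(1)] S(2) by simp
    ultimately show "is_gcoalgebra C M (K S, \<delta> S)"
      using K_Obj[OF closed_P[OF S(1)]] \<delta>_hom[OF S(1)] unfolding is_gcoalgebra_def by simp
  qed
qed

text \<open>The sets that survive both rounds of closure are cofinal in \<open>P\<close>, so their
  colimit in \<open>C\<close> is still \<open>X\<close>, and the forgetful functor reflects
  it.\<close>

lemma closed_gcolimit:
  "\<exists>(J :: 'i set set) L' R' c'. gdiagram (GCoAlg C M) J L' R' \<and> (\<forall>S\<in>J. S \<in> P \<and> fst (L' S) = K S) \<and>
    gcolimit (GCoAlg C M) J L' R' (X, \<gamma>) c'"
proof -
  obtain e where e_coalg: "(\<forall>i\<in>I. e i \<in> P) \<and>
      (\<forall>S. closed S \<longrightarrow> (\<forall>i\<in>S. e i \<subseteq> S) \<longrightarrow> is_gcoalgebra C M (K S, \<delta> S))"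
    using coalgebra_closed by (rule exE)
  then have e: "e i \<in> P" if "i \<in> I" for i using that by simp
  have coalg: "is_gcoalgebra C M (K S, \<delta> S)" if "closed S" "\<forall>i\<in>S. e i \<subseteq> S" for S
    using e_coalg that by simp
  define J where "J = {S. closed S \<and> (\<forall>i\<in>S. e i \<subseteq> S)}"
  define R' where "R' = {(S, ((K S, \<delta> S), \<kappa> S S', (K S', \<delta> S')), S') | S S'. S \<in> J \<and> S' \<in> J \<and> S \<subseteq> S'}"
  have J: "closed S" "S \<in> P" "is_gcoalgebra C M (K S, \<delta> S)" if "S \<in> J" for S
    using that closed_P coalg unfolding J_def by auto
  have R': "gdiagram (GCoAlg C M) J (\<lambda>S. (K S, \<delta> S)) R'"
  proof (rule gdiagramI)
    show "(K S, \<delta> S) \<in> Obj (GCoAlg C M)" if "S \<in> J" for S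
      using J(3)[OF that] unfolding Obj_GCoAlg .
    fix S u S' assume "(S, u, S') \<in> R'"
    then have S: "S \<in> J" "S' \<in> J" "S \<subseteq> S'" and u: "u = ((K S, \<delta> S), \<kappa> S S', (K S', \<delta> S'))"
      unfolding R'_def by auto
    have "is_gcoalgebra_hom C M (K S, \<delta> S) (K S', \<delta> S') (\<kappa> S S')"
      using \<kappa>_hom[OF J(2)[OF S(1)] J(2)[OF S(2)] S(3)] \<kappa>_\<delta>[OF J(1)[OF S(1)] J(1)[OF S(2)] S(3)]
      unfolding coalgebra_hom_iff by simp
    then show "S \<in> J \<and> S' \<in> J \<and> u \<in> hom (GCoAlg C M) (K S, \<delta> S) (K S', \<delta> S')"
      using S J(3) unfolding hom_GCoAlg u by blast
  qed
  have edges: "forget_edges R' = {(S, \<kappa> S S', S') | S S'. S \<in> J \<and> S' \<in> J \<and> S \<subseteq> S'}"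
    by (rule set_eqI) (auto simp: forget_edges_iff R'_def)
  have cofinal: "\<exists>S\<in>J. T \<subseteq> S" if T: "T \<in> P" for T
  proof -
    obtain S where "closed S \<and> T \<subseteq> S \<and> (\<forall>i\<in>S. e i \<subseteq> S)"
      using closed_cofinal[OF e T] by (rule exE)
    then show ?thesis unfolding J_def by (intro bexI[of _ S]) auto
  qed
  have "gcolimit C J (\<lambda>S. K S) {(S, \<kappa> S S', S') | S S'. S \<in> J \<and> S' \<in> J \<and> S \<subseteq> S'} X (\<lambda>S. \<pi> S)"
    using cofinal_colimit[of J "\<lambda>S. S", OF J(2) cofinal] .
  then have "gcolimit C J (fst \<circ> (\<lambda>S. (K S, \<delta> S))) (forget_edges R') X \<pi>"
    unfolding edges comp_def by simp
  then have "gcolimit (GCoAlg C M) J (\<lambda>S. (K S, \<delta> S)) R' (X, \<gamma>) (\<lambda>S. ((K S, \<delta> S), \<pi> S, (X, \<gamma>)))"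
  proof (rule gcolimit_GCoAlg[OF R' _ coalgebra])
    show "is_gcoalgebra_hom C M (K S, \<delta> S) (X, \<gamma>) (\<pi> S)" if "S \<in> J" for S
      using \<pi>_hom[OF J(2)[OF that]] \<pi>_\<delta>[OF J(1)[OF that]] unfolding coalgebra_hom_iff by simp
  qed
  then show ?thesis
    using R' J(2) by (intro exI[of _ J] exI[of _ "\<lambda>S. (K S, \<delta> S)"] exI[of _ R']) auto
qed

end

lemma coalgebra_gcolimit:
  "\<exists>(J :: 'i set set) L' R' c'. gdiagram (GCoAlg C M) J L' R' \<and> (\<forall>S\<in>J. S \<in> P \<and> fst (L' S) = K S) \<and>
    gcolimit (GCoAlg C M) J L' R' (X, \<gamma>) c'"
proof (rule coaction_data, goal_cases)
  case (1 a c b)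
  show ?case by (rule closed_gcolimit[OF 1])
qed

end


section \<open>Completeness of the category of graded coalgebras\<close>

context category
begin

text \<open>The vertices of a diagram of size at most \<open>|V|\<close> can be renamed into
  \<open>V\<close>. With labels in \<open>A\<close> and edges among the arrows \<open>H\<close>,
  only a small set of diagrams remains. One colimit of each is enough, as colimits are carried along
  renamings.\<close>

lemma small_set_of_colimits:
  fixes V :: "'v set"
  assumes U: "inaccessible U" and loc: "locally_small U C" and col: "has_gcolimits U C"
    and A: "small U A" "A \<subseteq> Obj C" and V: "small U V"
  shows "\<exists>B. small U B \<and> B \<subseteq> Obj C \<and> (\<forall>(S :: 'i set) L R. |S| \<le>o |V| \<longrightarrow> gdiagram C S L R \<longrightarrow>
    L ` S \<subseteq> A \<longrightarrow> (\<exists>X\<in>B. \<exists>c. gcolimit C S L R X c))"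
proof -
  interpret universe U by unfold_locales fact
  define H where "H = (\<Union>a\<in>A. \<Union>b\<in>A. hom C a b)"
  have H: "small U H"
    unfolding H_def using loc A unfolding locally_small_def by (intro small_UN) blast+
  define \<D> where "\<D> = (SIGMA W : Pow V. (W \<rightarrow>\<^sub>E A) \<times> Pow (V \<times> H \<times> V))"
  have "small U \<D>"
    unfolding \<D>_def
  proof (intro small_Sigma small_Pow small_PiE V H A)
    show "small U W" if "W \<in> Pow V" for W
      using small_subset[OF _ V] that by blast
  qed
  define colim where "colim d = (SOME X. \<exists>c. gcolimit C (fst d) (fst (snd d)) (snd (snd d)) X c)" for d :: "'v set \<times> ('v \<Rightarrow> 'o) \<times> ('v \<times> 'a \<times> 'v) set"
  \<comment> \<open>Members of \<open>\<D>\<close> are raw data whose edges need not fit their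
    labels; therefore only those that possess a colimit are used.\<close>
  define B where "B = colim ` {d \<in> \<D>. \<exists>X c. gcolimit C (fst d) (fst (snd d)) (snd (snd d)) X c}"
  have colim: "\<exists>c. gcolimit C (fst d) (fst (snd d)) (snd (snd d)) (colim d) c"
    if "\<exists>X c. gcolimit C (fst d) (fst (snd d)) (snd (snd d)) X c" for d
    using that unfolding colim_def by (rule someI_ex)
  have "small U B"
    unfolding B_def by (rule small_image, rule small_subset[OF _ \<open>small U \<D>\<close>]) blast
  moreover have "B \<subseteq> Obj C"
  proof
    fix X assume "X \<in> B"
    then obtain d where d: "X = colim d" "\<exists>X c. gcolimit C (fst d) (fst (snd d)) (snd (snd d)) X c"
      unfolding B_def by blast
    obtain c where "gcolimit C (fst d) (fst (snd d)) (snd (snd d)) (colim d) c"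
      using colim[OF d(2)] by blast
    from gcolimitD(1)[OF this] show "X \<in> Obj C" unfolding d(1) .
  qed
  moreover have "\<exists>X\<in>B. \<exists>c. gcolimit C S L R X c"
    if S: "|S| \<le>o |V|" and R: "gdiagram C S L R" and L: "L ` S \<subseteq> A" for S :: "'i set" and L R
  proof -
    obtain \<phi> where \<phi>: "inj_on \<phi> S" "\<phi> ` S \<subseteq> V"
      using S card_of_ordLeq[of S V] by blast
    let ?L = "L \<circ> inv_into S \<phi>" and ?R = "(\<lambda>(i, f, j). (\<phi> i, f, \<phi> j)) ` R"
    \<comment> \<open>The labels are made extensional in order to belong to \<open>\<D>\<close>;
      values off the vertices do not affect the colimit.\<close>
    define d where "d = (\<phi> ` S, restrict ?L (\<phi> ` S), ?R)"
    have cong: "gcolimit C (\<phi> ` S) ?L ?R X c \<longleftrightarrow> gcolimit C (fst d) (fst (snd d)) (snd (snd d)) X c" for X c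
      unfolding d_def fst_conv snd_conv by (rule gcolimit_cong) simp
    have "small U S" using small_ordLeq[OF S V] .
    then have "\<exists>X c. gcolimit C (\<phi> ` S) ?L ?R X c"
      by (intro has_gcolimitsD[OF U col] gdiagram_reindex[OF \<phi>(1) R] small_image)
    then have d: "\<exists>X c. gcolimit C (fst d) (fst (snd d)) (snd (snd d)) X c"
      unfolding cong .
    have "?R \<subseteq> V \<times> H \<times> V"
    proof
      fix p assume "p \<in> ?R"
      then obtain i f j where ij: "(i, f, j) \<in> R" "p = (\<phi> i, f, \<phi> j)" by auto
      note ijS = gdiagramD(2-4)[OF R ij(1)]
      then have "f \<in> H" using L unfolding H_def by blast
      then show "p \<in> V \<times> H \<times> V" using ijS \<phi>(2) unfolding ij(2) by blast
    qed
    moreover have "restrict ?L (\<phi> ` S) \<in> \<phi> ` S \<rightarrow>\<^sub>E A"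
      using L \<phi>(1) by auto
    ultimately have "d \<in> \<D>"
      using \<phi>(2) unfolding d_def \<D>_def by blast
    then have "colim d \<in> B" using d unfolding B_def by blast
    moreover obtain c where "gcolimit C (\<phi> ` S) ?L ?R (colim d) c"
      using colim[OF d] unfolding cong by blast
    ultimately show ?thesis
      by (intro bexI[of _ "colim d"] exI[of _ "c \<circ> \<phi>"] gcolimit_reindex[OF _ \<phi>(1) R])
  qed
  ultimately show ?thesis by blast
qed

end

theorem theorem4p6:
  fixes U :: "'u rel"
    and C :: "('o, 'a) category"
    and M :: "('t::monoid_mult, 'o, 'a) graded_monad"
  assumes "inaccessible U"
    and "small U (UNIV :: 't set)"
    and "locally_presentable U C"
    and "is_graded_monad C M"
    and "\<And>t. accessible_functor U C C (gfun M t)"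
  shows "complete_category U (GCoAlg C M) \<and> (\<exists>Z. terminal_object (GCoAlg C M) Z)"
proof -
  note U = assms(1)
  interpret universe U by unfold_locales fact
  obtain \<mu> where \<mu>: "regular_cardinal U \<mu>" and acc: "accessible_for U \<mu> C"
    using assms(3) unfolding locally_presentable_def accessible_category_def by blast
  interpret category C using acc unfolding accessible_for_def by blast
  interpret graded_monad C M by unfold_locales fact
  have loc: "locally_small U C" using acc unfolding accessible_for_def by blast
  have col: "has_gcolimits U C"
    using cocomplete_has_gcolimits[OF U loc] assms(3) unfolding locally_presentable_def by blast
  obtain A where A: "small U A" "\<And>N. N \<in> A \<Longrightarrow> presentable_object U \<mu> C N"
    and dense: "\<And>X. X \<in> Obj C \<Longrightarrow> \<exists>I r D c. directed_poset U \<mu> I r \<and>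
      is_functor (poset_category I r) C D \<and> (\<forall>i\<in>I. Fobj D i \<in> A) \<and> is_colimit (poset_category I r) C D X c"
    using acc unfolding accessible_for_def by blast
  have A_Obj: "A \<subseteq> Obj C" using A(2) unfolding presentable_object_def by blast
  have "\<forall>t. \<exists>\<nu>. regular_cardinal U \<nu> \<and> preserves_directed_colimits U \<nu> C C (gfun M t)"
    using assms(5) unfolding accessible_functor_def by blast
  then obtain \<nu> where \<nu>: "\<And>t. regular_cardinal U (\<nu> t)"
    and pres: "\<And>t. preserves_directed_colimits U (\<nu> t) C C (gfun M t)"
    by metis
  \<comment> \<open>Besides copies of each \<open>Field (\<nu> t)\<close> and of
    \<open>Field \<mu>\<close>, this contains a copy of the set of grades, namely the pairs
    \<open>(t, Inr z)\<close> for a fixed \<open>z\<close> in \<open>Field \<mu>\<close>.\<close>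
  define V where "V = (SIGMA t : (UNIV :: 't set). Field (\<nu> t) <+> Field \<mu>)"
  have V: "small U V"
    unfolding V_def
  proof (rule small_Sigma[OF assms(2)])
    show "small U (Field (\<nu> t) <+> Field \<mu>)" for t
      using small_Field[OF \<nu>] small_Field[OF \<mu>] unfolding small_def
      by (intro card_of_Plus_ordLess_infinite_Field[OF infinite_U Card_order_U])
  qed
  have \<mu>_card: "Card_order \<mu>" "infinite (Field \<mu>)" and \<nu>_card: "Card_order (\<nu> t)" "infinite (Field (\<nu> t))" for t
    using \<mu> \<nu> unfolding regular_cardinal_def cinfinite_def by auto
  have \<mu>_V: "\<mu> \<le>o |V|"
    by (rule ordLeq_inj_Field[OF \<mu>_card(1), of "\<lambda>x. (1, Inr x)"]) (auto simp: inj_on_def V_def)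
  have \<nu>_V: "\<nu> t \<le>o |V|" for t
    by (rule ordLeq_inj_Field[OF \<nu>_card(1), of "\<lambda>x. (t, Inl x)"]) (auto simp: inj_on_def V_def)
  obtain z where z: "z \<in> Field \<mu>" using \<mu>_card(2) by fastforce
  have T_V: "|UNIV :: 't set| \<le>o |V|"
    unfolding card_of_ordLeq[symmetric]
    by (rule exI[of _ "\<lambda>t. (t, Inr z)"]) (use z in \<open>auto simp: inj_on_def V_def\<close>)
  have infinite_V: "infinite V"
  proof
    assume "finite V"
    moreover have "(\<lambda>x. (1, Inr x)) ` Field \<mu> \<subseteq> V" by (auto simp: V_def)
    ultimately have "finite ((\<lambda>x. (1 :: 't, Inr x :: 'u + 'u)) ` Field \<mu>)" using finite_subset by blast
    then show False using \<mu>_card(2) finite_imageD[of "\<lambda>x. (1 :: 't, Inr x :: 'u + 'u)"] by (auto simp: inj_on_def)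
  qed
  obtain B where B: "small U B" "B \<subseteq> Obj C"
    and B_colimit: "\<And>(S :: 'u set) L R. |S| \<le>o |V| \<Longrightarrow> gdiagram C S L R \<Longrightarrow> L ` S \<subseteq> A \<Longrightarrow>
      \<exists>X\<in>B. \<exists>c. gcolimit C S L R X c"
    using small_set_of_colimits[OF U loc col A(1) A_Obj V, where 'i = 'u] by blast
  \<comment> \<open>The generators. A carrier in \<open>B\<close> admits only a small set of
    coactions, since the grades and the hom-sets are small.\<close>
  define G where "G = {P. is_gcoalgebra C M P \<and> fst P \<in> B}"
  have "small U (SIGMA X : B. (UNIV :: 't set) \<rightarrow>\<^sub>E (\<Union>t. hom C X (F t X)))"
    using loc B(2) F_Obj unfolding locally_small_def
    by (intro small_Sigma[OF B(1)] small_PiE[OF assms(2)] small_UN[OF assms(2)]) blast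
  then have G: "small U G"
  proof (rule small_subset[rotated], intro subsetI)
    fix P assume P: "P \<in> G"
    obtain X \<gamma> where X: "P = (X, \<gamma>)" by fastforce
    have "is_gcoalgebra C M (X, \<gamma>)" "X \<in> B" using P unfolding G_def X by auto
    then show "P \<in> (SIGMA X : B. UNIV \<rightarrow>\<^sub>E (\<Union>t. hom C X (F t X)))"
      using coalgebraD(2) unfolding X by auto
  qed
  have G_Obj: "G \<subseteq> Obj (GCoAlg C M)" using Obj_GCoAlg unfolding G_def by blast
  have G_dense: "\<exists>(J :: 'u set set) L R c. gdiagram (GCoAlg C M) J L R \<and> L ` J \<subseteq> G \<and> gcolimit (GCoAlg C M) J L R Y c"
    if Y: "Y \<in> Obj (GCoAlg C M)" for Y
  proof -
    obtain X \<gamma> where Y_eq: "Y = (X, \<gamma>)" by fastforce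
    have coalg: "is_gcoalgebra C M (X, \<gamma>)" using Y unfolding Obj_GCoAlg Y_eq .
    obtain I r D k where I: "directed_poset U \<mu> I r" and D: "is_functor (poset_category I r) C D"
      and DA: "\<forall>i\<in>I. Fobj D i \<in> A" and k: "is_colimit (poset_category I r) C D X k"
      using dense[OF coalgebraD(1)[OF coalg]] by blast
    define R where "R = (\<lambda>u. (fst u, Farr D u, snd u)) ` r"
    have X: "gcolimit C I (Fobj D) R X k"
      using k unfolding is_colimit_iff_gcolimit by (simp add: poset_category_def R_def)
    have R: "gdiagram C I (Fobj D) R"
    proof (rule gdiagramI)
      show "Fobj D i \<in> Obj C" if "i \<in> I" for i using DA A_Obj that by blast
      show "i \<in> I \<and> j \<in> I \<and> f \<in> hom C (Fobj D i) (Fobj D j)" if "(i, f, j) \<in> R" for i f j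
        using that poset_functorD(1-3)[OF D] unfolding R_def by auto
    qed
    \<comment> \<open>The pair \<open>p\<close> is a colimit vertex with its legs. Taking the vertex
      from \<open>B\<close> is what puts the approximating coalgebras into \<open>G\<close>.\<close>
    have "\<exists>p. fst p \<in> B \<and> gcolimit C S (Fobj D) (subedges R S) (fst p) (snd p)" if S: "S \<subseteq> I" "|S| \<le>o |V|" for S
    proof -
      have "gdiagram C S (Fobj D) (subedges R S)"
        using R S(1) unfolding gdiagram_def subedges_def by blast
      moreover have "Fobj D ` S \<subseteq> A" using DA S(1) by blast
      ultimately show ?thesis using B_colimit[OF S(2)] by fastforce
    qed
    then obtain p where p: "\<And>S. S \<subseteq> I \<Longrightarrow> |S| \<le>o |V| \<Longrightarrow> fst (p S) \<in> B"
      "\<And>S. S \<subseteq> I \<Longrightarrow> |S| \<le>o |V| \<Longrightarrow> gcolimit C S (Fobj D) (subedges R S) (fst (p S)) (snd (p S))"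
      by metis
    interpret bounded_subdiagrams C V I "Fobj D" R X k "\<lambda>S. fst (p S)" "\<lambda>S. snd (p S)"
      by unfold_locales (fact infinite_V R X | rule p(2); assumption)+
    have small_I: "small U I" using I unfolding directed_poset_def by blast
    have "Cinfinite \<mu>" using \<mu> unfolding regular_cardinal_def by blast
    \<comment> \<open>Compared with the two lemmas the letters are exchanged: here
      \<open>\<nu> t\<close> is the index of the functor and \<open>\<mu>\<close> that of the
      presentable labels.\<close>
    note through = factor_through_P[OF U small_I is_functor_M pres \<nu>_V _ this \<mu>_V]
      merge_in_P[OF U small_I is_functor_M pres \<nu>_V _ this \<mu>_V]
    have N: "presentable_object U \<mu> C (Fobj D i)" if "i \<in> I" for i
      using A(2) DA that by blast
    interpret coalgebra_approximation C V I "Fobj D" R X k "\<lambda>S. fst (p S)" "\<lambda>S. snd (p S)" M \<gamma>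
    proof unfold_locales
      show "is_gcoalgebra C M (X, \<gamma>)" by (rule coalg)
      show "|UNIV :: 't set| \<le>o |V|" by (rule T_V)
      show "f = f'" if "(i, f, j) \<in> R" "(i, f', j) \<in> R" for i f j f'
        using that unfolding R_def by auto
      show "\<exists>S\<in>P. \<exists>g\<in>hom C (Fobj D i) (F t (fst (p S))). Fm t (\<pi> S) \<cdot>\<^bsub>C\<^esub> g = f"
        if "i \<in> I" "f \<in> hom C (Fobj D i) (F t X)" for i f t
        using through(1)[OF N[OF that(1)] that(2)] .
      show "\<exists>S'\<in>P. S \<subseteq> S' \<and> Fm t (\<kappa> S S') \<cdot>\<^bsub>C\<^esub> f = Fm t (\<kappa> S S') \<cdot>\<^bsub>C\<^esub> g"
        if "i \<in> I" "S \<in> P" "f \<in> hom C (Fobj D i) (F t (fst (p S)))" "g \<in> hom C (Fobj D i) (F t (fst (p S)))"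
          "Fm t (\<pi> S) \<cdot>\<^bsub>C\<^esub> f = Fm t (\<pi> S) \<cdot>\<^bsub>C\<^esub> g" for i S f t g
        using through(2)[OF N[OF that(1)] that(2-5)] .
    qed
    obtain J L' R' c' where J: "gdiagram (GCoAlg C M) J L' R'" "\<forall>S\<in>J. S \<in> P \<and> fst (L' S) = fst (p S)"
      "gcolimit (GCoAlg C M) J L' R' (X, \<gamma>) c'"
      using coalgebra_gcolimit by blast
    have "L' S \<in> G" if "S \<in> J" for S
      using gdiagramD(1)[OF J(1) that] J(2) p(1)[of S] that unfolding G_def Obj_GCoAlg P_def by auto
    then show ?thesis using J(1,3) unfolding Y_eq by blast
  qed
  interpret Q: category "GCoAlg C M" by (rule category_GCoAlg)
  have "complete_category U (GCoAlg C M)"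
    unfolding complete_category_def
    using Q.limit_exists[OF U locally_small_GCoAlg[OF U loc] has_gcolimits_GCoAlg[OF col] G G_Obj G_dense]
      Q.category_axioms by blast
  then show ?thesis
    using complete_category_terminal_object[OF U] by blast
qed

end
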